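(* There exists $k_0$ such that for every polite integer $k\ge k_0$ there exists $t_0=t_0(k)$ such that for every $t\ge t_0$ the following holds: every graph $H$ on $t$ vertices obtained from $K_k$ by adding $t-k$ pendant edges is a 3-color bonbon.
   Context: All graphs are finite and simple. $r(a,b)$ denotes the two-color Ramsey number: the least $r$ such that any red/blue coloring of $E(K_r)$ contains a red $K_a$ or a blue $K_b$. A positive integer $k$ is polite if $$r(k,\lceil k/2\rceil)\le 2^{-31}\, r(k,k)\qquad\text{and}\qquad \frac{r(k,k)-1}{r(k,k-1)}\ge 1+25\left(\frac{r(k,\lceil k/2\rceil)}{r(k,k)}\right)^{1/4}.$$ A graph $H$ is obtained from $K_k$ by adding pendant edges if $K_k$ is an induced subgraph of $H$, and every vertex of $H$ outside this $K_k$ has degree $1$ in $H$ with its unique neighbor lying in the $K_k$ (no assumption is made on which vertices of the $K_k$ are these neighbors). A $3$-coloring of $E(K_n)$ is Ramsey-blowup-like (with parameter $k$) if there is a color such that the graph of edges in that color is a disjoint union of $r(k,k)-1$ cliques, each of size $\left\lfloor \frac{n}{r(k,k)-1}\right\rfloor$ or $\left\lceil \frac{n}{r(k,k)-1}\right\rceil$, and such that there is no monochromatic $K_k$ in either of the other two colors. A connected graph $H$ with clique number $k$ is a 3-color bonbon if, for all sufficiently large $n$, any $3$-coloring of $E(K_n)$ with the minimum number of monochromatic copies of $H$ (among all $3$-colorings of $E(K_n)$) is Ramsey-blowup-like with parameter $k$. *)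

theory Defs
  imports Complex_Main "HOL-Library.Ramsey" "HOL-Library.Disjoint_Sets"
begin

section \<open>Ramsey numbers and polite integers\<close>

definition ramsey_number :: "nat \<Rightarrow> nat \<Rightarrow> nat" where
  "ramsey_number a b = (LEAST r. partn_lst {..<r} [a, b] 2)"

lemma partn_lst_ramsey_number: "partn_lst {..<ramsey_number a b} [a, b] 2"
proof -
  obtain N :: nat where "partn_lst {..<N} [a, b] 2"
    using ramsey2_full by blast
  then show ?thesis
    unfolding ramsey_number_def by (rule LeastI)
qed

definition polite :: "nat \<Rightarrow> bool" where
  "polite k \<longleftrightarrow>
     k > 0 \<and>
     real (ramsey_number k (nat \<lceil>real k / 2\<rceil>)) \<le> real (ramsey_number k k) / 2 ^ 31 \<and>
     (real (ramsey_number k k) - 1) / real (ramsey_number k (k - 1))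
       \<ge> 1 + 25 * root 4 (real (ramsey_number k (nat \<lceil>real k / 2\<rceil>)) / real (ramsey_number k k))"


section \<open>Finite simple graphs\<close>

definition simple_graph :: "'a set \<Rightarrow> 'a set set \<Rightarrow> bool" where
  "simple_graph V E \<longleftrightarrow> finite V \<and> E \<subseteq> [V]\<^bsup>2\<^esup>"

definition connected_graph :: "'a set \<Rightarrow> 'a set set \<Rightarrow> bool" where
  "connected_graph V E \<longleftrightarrow>
     simple_graph V E \<and> V \<noteq> {} \<and> (\<forall>u\<in>V. \<forall>v\<in>V. (u, v) \<in> {(x, y). {x, y} \<in> E}\<^sup>*)"

definition clique_number :: "'a set \<Rightarrow> 'a set set \<Rightarrow> nat" where
  "clique_number V E = Max (card ` {K. K \<subseteq> V \<and> clique K E})"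

definition graph_iso :: "'a set \<Rightarrow> 'a set set \<Rightarrow> 'b set \<Rightarrow> 'b set set \<Rightarrow> bool" where
  "graph_iso V E W F \<longleftrightarrow> (\<exists>\<phi>. bij_betw \<phi> V W \<and> F = (`) \<phi> ` E)"

text \<open>In a simple graph, an outside vertex has degree 1 with its neighbor in the clique
  iff its neighborhood is a singleton contained in the clique.\<close>

definition clique_plus_pendants :: "nat \<Rightarrow> 'a set \<Rightarrow> 'a set set \<Rightarrow> bool" where
  "clique_plus_pendants k V E \<longleftrightarrow>
     simple_graph V E \<and>
     (\<exists>K. K \<subseteq> V \<and> card K = k \<and> clique K E \<and>
          (\<forall>v\<in>V - K. \<exists>u\<in>K. {w. {v, w} \<in> E} = {u}))"


section \<open>3-colorings of complete graphs\<close>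

definition colorings3 :: "nat \<Rightarrow> (nat set \<Rightarrow> nat) set" where
  "colorings3 n = [{..<n}]\<^bsup>2\<^esup> \<rightarrow> {..<3}"

text \<open>A copy of the graph with vertex set \<open>V\<close> and edge set \<open>E\<close> is a (not necessarily induced)
  subgraph \<open>(W, F)\<close> of the complete graph isomorphic to it, so copies are unlabelled.\<close>

definition mono_copies ::
    "'a set \<Rightarrow> 'a set set \<Rightarrow> nat \<Rightarrow> (nat set \<Rightarrow> nat) \<Rightarrow> (nat set \<times> nat set set) set" where
  "mono_copies V E n f =
     {(W, F). W \<subseteq> {..<n} \<and> F \<subseteq> [W]\<^bsup>2\<^esup> \<and> graph_iso V E W F \<and> (\<exists>c<3. \<forall>e\<in>F. f e = c)}"

definition minimizes_mono_copies ::
    "'a set \<Rightarrow> 'a set set \<Rightarrow> nat \<Rightarrow> (nat set \<Rightarrow> nat) \<Rightarrow> bool" where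
  "minimizes_mono_copies V E n f \<longleftrightarrow>
     f \<in> colorings3 n \<and>
     (\<forall>g\<in>colorings3 n. card (mono_copies V E n f) \<le> card (mono_copies V E n g))"

text \<open>The cliques form an indexed family rather than a set of sets, so that for
  \<open>n < ramsey_number k k - 1\<close> cliques of size 0 are admitted.\<close>

definition ramsey_blowup_like :: "nat \<Rightarrow> nat \<Rightarrow> (nat set \<Rightarrow> nat) \<Rightarrow> bool" where
  "ramsey_blowup_like k n f \<longleftrightarrow>
     (let m = ramsey_number k k - 1 in
       \<exists>c<3.
         (\<exists>A. disjoint_family_on A {..<m} \<and> (\<Union>i<m. A i) = {..<n} \<and>
              (\<forall>i<m. int (card (A i)) = \<lfloor>real n / real m\<rfloor> \<or>
                     int (card (A i)) = \<lceil>real n / real m\<rceil>) \<and>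
              {e \<in> [{..<n}]\<^bsup>2\<^esup>. f e = c} = (\<Union>i<m. [A i]\<^bsup>2\<^esup>)) \<and>
         (\<forall>d<3. d \<noteq> c \<longrightarrow> \<not> monochromatic {..<n} k 2 f d))"

definition bonbon3 :: "'a set \<Rightarrow> 'a set set \<Rightarrow> bool" where
  "bonbon3 V E \<longleftrightarrow>
     connected_graph V E \<and>
     (\<exists>n\<^sub>0. \<forall>n\<ge>n\<^sub>0. \<forall>f. minimizes_mono_copies V E n f \<longrightarrow>
        ramsey_blowup_like (clique_number V E) n f)"

end

theory Submission
  imports Defs
begin

text \<open>
  Let \<open>m = r(k, k) - 1\<close>. A Ramsey blowup has about \<open>m (n/m)\<^sup>t\<close> labelled copies of \<open>H\<close>, and a monochromatic
  \<open>K\<^sub>k\<close> whose degrees in its color have geometric mean at least \<open>(1 + \<delta>) n/m\<close> (a rich clique) lies in at least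
  \<open>((1 + \<delta>/2) n/m)\<^sup>t\<^sup>-\<^sup>k\<close> copies. So for large \<open>t\<close> a minimizer has hardly any rich cliques; cloning
  vertices shows that this even holds for rich cliques through a given vertex. Consequently a
  greedy choice of vertices can avoid rich cliques. Choosing Ramsey-many vertices in this way, one
  successively finds: almost every vertex has degree below \<open>2n/m\<close> in exactly one color; this color \<open>c\<close> is
  the same for almost all vertices; by politeness every vertex has large degree in the other two
  colors; and all degrees in color \<open>c\<close> are close to \<open>n/m\<close>.

  Recoloring an edge to \<open>c\<close> cannot decrease the number of copies, so an edge of another color lies in few
  cliques of its color. This forces the \<open>c\<close>-neighborhoods of its ends to be almost disjoint, and hence the
  vertices split into at most \<open>m\<close> cliques of color \<open>c\<close>. These cliques alone contain at least as many copies of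
  \<open>H\<close> as a Ramsey blowup, by convexity, so they are balanced and there are no further copies.
\<close>

subsection \<open>Monochromatic cliques and neighborhoods\<close>

text \<open>Politeness enters twice. Two large classes with different low colors are refuted by
  choosing \<open>s\<close> vertices on each side, which contribute half of a clique in the third
  color each; so r(k, k/2) must be small against r(k, k). A vertex joined to almost everything in
  one color is refuted by r(k, k - 1) of its neighbors, hence the second inequality; the fourth root
  \<open>z\<close> leaves room for errors of order \<open>s * \<mu>\<close>.

  Products of degrees are used because the pendant vertices may hang anywhere: averaging over cyclic
  shifts of the core shows that some placement does as well as the geometric mean. Products also let
  one vertex of huge degree compensate for slight deficits of the other \<open>k - 1\<close>.

  Two families of cliques are avoided in turn. For the first one, light single vertices are
  available. A pair can be shown to be light only after the degrees in color \<open>c\<close> are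
  known to be near \<open>\<mu>\<close>: recoloring it to \<open>c\<close> then creates few copies,
  whereas a clique of another color has degrees of at least \<open>2 * \<mu>\<close>. The second
  family consists of cliques in the other two colors only.\<close>

definition mono_clique :: "('a set \<Rightarrow> nat) \<Rightarrow> nat \<Rightarrow> 'a set \<Rightarrow> bool" where
  "mono_clique f c Q \<longleftrightarrow> (\<forall>u\<in>Q. \<forall>v\<in>Q. u \<noteq> v \<longrightarrow> f {u, v} = c)"

text \<open>A set \<open>C\<close> of colors instead of one color, since the greedy choice below
  must sometimes avoid two colors at once and sometimes none (\<open>C = {}\<close>).\<close>

definition nbrs :: "(nat set \<Rightarrow> nat) \<Rightarrow> nat \<Rightarrow> nat set \<Rightarrow> nat \<Rightarrow> nat set" where
  "nbrs f n C v = {w \<in> {..<n}. w \<noteq> v \<and> f {v, w} \<in> C}"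

abbreviation cdeg :: "(nat set \<Rightarrow> nat) \<Rightarrow> nat \<Rightarrow> nat \<Rightarrow> nat \<Rightarrow> nat" where
  "cdeg f n c v \<equiv> card (nbrs f n {c} v)"

lemma finite_nbrs [simp]: "finite (nbrs f n C v)"
  by (simp add: nbrs_def)

lemma nbrs_subset: "nbrs f n C v \<subseteq> {..<n}"
  by (auto simp: nbrs_def)

lemma mono_clique_subset: "mono_clique f c Q \<Longrightarrow> P \<subseteq> Q \<Longrightarrow> mono_clique f c P"
  by (auto simp: mono_clique_def)

lemma mono_clique_insert:
  "mono_clique f c (insert v Q) \<longleftrightarrow> mono_clique f c Q \<and> (\<forall>u\<in>Q. u \<noteq> v \<longrightarrow> f {v, u} = c)"
  by (auto simp: mono_clique_def insert_commute)

text \<open>An \<open>N\<close>-subset of \<open>T\<close> is numbered by \<open>{..<N}\<close> and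
  the coloring is pulled back, so colors have to be bounded only on pairs inside
  \<open>T\<close>.\<close>

lemma partn_lst_mono_clique:
  assumes P: "partn_lst {..<N} qs 2" and T: "finite T" "N \<le> card T"
    and g: "\<And>u v. u \<in> T \<Longrightarrow> v \<in> T \<Longrightarrow> u \<noteq> v \<Longrightarrow> g {u, v} < length qs"
  shows "\<exists>i<length qs. \<exists>Q\<subseteq>T. card Q = qs ! i \<and> mono_clique g i Q"
proof -
  obtain T' where T': "T' \<subseteq> T" "card T' = N" "finite T'"
    using T obtain_subset_with_card_n by metis
  then obtain h where h: "bij_betw h {..<N} T'"
    by (metis bij_betw_from_nat_into_finite)
  then have inj: "inj_on h {..<N}" and im: "h ` {..<N} = T'"
    by (auto simp: bij_betw_def)
  define g' where "g' = (\<lambda>e. g (h ` e))"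
  have "g' \<in> [{..<N}]\<^bsup>2\<^esup> \<rightarrow> {..<length qs}"
  proof
    fix e assume "e \<in> [{..<N}]\<^bsup>2\<^esup>"
    then obtain x y where e: "e = {x, y}" "x < N" "y < N" "x \<noteq> y"
      by (auto elim!: nsets2_E)
    then have "h x \<in> T" "h y \<in> T" "h x \<noteq> h y"
      using im T' inj by (auto dest: inj_onD)
    then show "g' e \<in> {..<length qs}" using g e by (simp add: g'_def)
  qed
  then obtain i where i: "i < length qs" and m: "monochromatic {..<N} (qs ! i) 2 g' i"
    using P unfolding partn_lst_def by blast
  then obtain H where H: "H \<in> [{..<N}]\<^bsup>(qs ! i)\<^esup>" "g' ` [H]\<^bsup>2\<^esup> \<subseteq> {i}"
    unfolding monochromatic_def by blast
  have HN: "H \<subseteq> {..<N}" "card H = qs ! i" using H by (auto simp: nsets_def)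
  have "mono_clique g i (h ` H)"
    unfolding mono_clique_def
  proof (intro ballI impI)
    fix u v assume "u \<in> h ` H" "v \<in> h ` H" "u \<noteq> v"
    then obtain x y where "x \<in> H" "y \<in> H" "u = h x" "v = h y" "x \<noteq> y" by auto
    then have "{x, y} \<in> [H]\<^bsup>2\<^esup>" by simp
    then have "g' {x, y} = i" using H by blast
    then show "g {u, v} = i" by (simp add: g'_def \<open>u = h x\<close> \<open>v = h y\<close>)
  qed
  moreover have "card (h ` H) = qs ! i"
    using HN inj by (metis card_image inj_on_subset)
  moreover have "h ` H \<subseteq> T" using im T' HN by auto
  ultimately show ?thesis using i by blast
qed

lemma partn_lst_two_colors:
  assumes P: "partn_lst {..<N} [p, q] 2" and T: "finite T" "N \<le> card T"
    and g: "\<And>u v. u \<in> T \<Longrightarrow> v \<in> T \<Longrightarrow> u \<noteq> v \<Longrightarrow> g {u, v} = a \<or> g {u, v} = b"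
  obtains Q where "Q \<subseteq> T" "card Q = p" "mono_clique g a Q"
        | Q where "Q \<subseteq> T" "card Q = q" "mono_clique g b Q"
proof -
  define g' where "g' = (\<lambda>e. if g e = a then 0 else 1 :: nat)"
  have "g' {u, v} < length [p, q]" for u v
    by (simp add: g'_def)
  then obtain i Q where iQ: "i < 2" "Q \<subseteq> T" "card Q = [p, q] ! i" "mono_clique g' i Q"
    using partn_lst_mono_clique[OF P T, of g'] by (auto simp: numeral_2_eq_2)
  consider "i = 0" | "i = 1" using iQ by linarith
  then show ?thesis
  proof cases
    case 1
    then have "mono_clique g a Q"
      using iQ unfolding mono_clique_def g'_def by (metis zero_neq_one)
    then show ?thesis using that(1) iQ 1 by auto
  next
    case 2
    then have "mono_clique g b Q"
      using iQ g unfolding mono_clique_def g'_def by (metis subsetD zero_neq_one)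
    then show ?thesis using that(2) iQ 2 by auto
  qed
qed

lemma partn_lst_three_colors:
  assumes P: "partn_lst {..<N} [k, k, k] 2" and T: "finite T" "N \<le> card T"
    and g: "\<And>u v. u \<in> T \<Longrightarrow> v \<in> T \<Longrightarrow> u \<noteq> v \<Longrightarrow> g {u, v} < (3::nat)"
  obtains c Q where "c < 3" "Q \<subseteq> T" "card Q = k" "mono_clique g c Q"
proof -
  obtain i Q where "i < 3" "Q \<subseteq> T" "card Q = [k, k, k] ! i" "mono_clique g i Q"
    using partn_lst_mono_clique[OF P T, of g] g by (auto simp: eval_nat_numeral)
  moreover from \<open>i < 3\<close> have "[k, k, k] ! i = k"
    by (auto simp: less_Suc_eq eval_nat_numeral)
  ultimately show ?thesis using that by metis
qed

subsection \<open>Greedy choice of vertices inside a family of light sets\<close>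

text \<open>\<open>lgt\<close> stays abstract because it is instantiated with two families of
  cliques. \<open>B\<close> bounds the size of the sets that can still be extended,
  \<open>\<delta> * n\<close> the number of vertices that cannot be added.\<close>

locale light_family =
  fixes n :: nat and f :: "nat set \<Rightarrow> nat" and lgt :: "nat set \<Rightarrow> bool" and B :: nat and \<delta> :: real
  assumes light_extend: "lgt T \<Longrightarrow> T \<subseteq> {..<n} \<Longrightarrow> card T \<le> B \<Longrightarrow>
      real (card {w \<in> {..<n}. w \<in> T \<or> \<not> lgt (insert w T)}) \<le> \<delta> * n"
    and col: "\<And>u v. u < n \<Longrightarrow> v < n \<Longrightarrow> u \<noteq> v \<Longrightarrow> f {u, v} < 3"
begin

abbreviation nb :: "nat set \<Rightarrow> nat \<Rightarrow> nat set" where "nb \<equiv> nbrs f n"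
abbreviation dg :: "nat \<Rightarrow> nat \<Rightarrow> nat" where "dg \<equiv> cdeg f n"

text \<open>Each chosen vertex excludes at most \<open>D\<close> later candidates, and lightness
  excludes \<open>\<delta> * n\<close> more. The last chosen vertex excludes nobody, so
  \<open>j - 1\<close> times \<open>D\<close> suffices; \<open>big\<close> adds \<open>D\<close> on
  the left to avoid a truncated subtraction. The saved \<open>D\<close> is decisive where
  \<open>j * D\<close> is about \<open>n\<close>.\<close>

lemma greedy:
  assumes T0: "lgt T0" "T0 \<subseteq> {..<n}" "card T0 + j \<le> B" and X: "X \<subseteq> {..<n}"
    and D: "0 \<le> D" "\<And>w. w \<in> X \<Longrightarrow> real (card (nb C w)) \<le> D"
    and X0: "\<And>v w. v \<in> T0 \<Longrightarrow> w \<in> X \<Longrightarrow> w \<notin> nb C v"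
    and big: "real (card X) + D > j * D + \<delta> * n"
  shows "\<exists>W\<subseteq>X. card W = j \<and> W \<inter> T0 = {} \<and> lgt (T0 \<union> W) \<and>
           (\<forall>u\<in>W. \<forall>v\<in>T0 \<union> W. u \<noteq> v \<longrightarrow> f {u, v} \<notin> C)"
  using T0(3) big
proof (induction j)
  case 0
  then show ?case using T0 by (intro exI[of _ "{}"]) auto
next
  case (Suc j)
  have "real (card X) + D > j * D + \<delta> * n"
    using Suc.prems D(1) by (simp add: algebra_simps)
  then obtain W where W: "W \<subseteq> X" "card W = j" "W \<inter> T0 = {}" "lgt (T0 \<union> W)"
      and Wc: "\<forall>u\<in>W. \<forall>v\<in>T0 \<union> W. u \<noteq> v \<longrightarrow> f {u, v} \<notin> C"
    using Suc by auto
  have fin: "finite X" "finite W" "finite T0"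
    using finite_subset[OF X] finite_subset[OF W(1)] finite_subset[OF T0(2)] by auto
  define bad where "bad = {w \<in> {..<n}. w \<in> T0 \<union> W \<or> \<not> lgt (insert w (T0 \<union> W))}"
  have "card (T0 \<union> W) \<le> B"
    using card_Un_le[of T0 W] W Suc.prems by linarith
  then have bad: "real (card bad) \<le> \<delta> * n"
    unfolding bad_def using W T0 X by (intro light_extend) auto
  define N where "N = (\<Union>w\<in>W. nb C w)"
  define Y where "Y = X - N"
  have "card N \<le> (\<Sum>w\<in>W. card (nb C w))"
    unfolding N_def by (rule card_UN_le[OF fin(2)])
  then have "real (card N) \<le> (\<Sum>w\<in>W. real (card (nb C w)))"
    by (metis of_nat_le_iff of_nat_sum)
  also have "\<dots> \<le> (\<Sum>w\<in>W. D)"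
    using W(1) D(2) by (intro sum_mono) auto
  finally have "real (card N) \<le> j * D"
    using W by simp
  moreover have "card X - card N \<le> card Y"
    unfolding Y_def using fin by (intro diff_card_le_card_Diff) (auto simp: N_def)
  ultimately have "real (card Y) > \<delta> * n"
    using Suc.prems by (simp add: algebra_simps le_diff_conv)
  with bad have "card bad < card Y" by linarith
  then have "\<not> Y \<subseteq> bad"
    using card_mono[of bad Y] by (auto simp: bad_def)
  then obtain w where w: "w \<in> Y" "w \<notin> bad" by blast
  then have wX: "w \<in> X" "w < n" and w2: "w \<notin> T0" "w \<notin> W" "lgt (insert w (T0 \<union> W))"
    using X by (auto simp: Y_def bad_def)
  have wc: "f {w, v} \<notin> C" if "v \<in> T0 \<union> W" for v
  proof -
    have "w \<notin> nb C v"
      using that w X0 wX by (auto simp: Y_def N_def)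
    then show ?thesis
      using that w2 wX by (auto simp: nbrs_def insert_commute)
  qed
  have "\<forall>u\<in>insert w W. \<forall>v\<in>T0 \<union> insert w W. u \<noteq> v \<longrightarrow> f {u, v} \<notin> C"
    using Wc wc by (auto simp: insert_commute)
  then show ?case
    using wX w2 W fin by (intro exI[of _ "insert w W"]) auto
qed

lemma greedy_free:
  assumes "lgt T0" "T0 \<subseteq> {..<n}" "card T0 + j \<le> B" "X \<subseteq> {..<n}" "real (card X) > \<delta> * n"
  obtains W where "W \<subseteq> X" "card W = j" "W \<inter> T0 = {}" "lgt (T0 \<union> W)"
  using greedy[OF assms(1-4), of 0 "{}"] assms(5) by (auto simp: nbrs_def)

lemma dg_sum:
  assumes "{a, b, c} = {..<3}" "v < n"
  shows "dg a v + dg b v + dg c v = n - 1"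
proof -
  have dist: "a \<noteq> b" "b \<noteq> c" "a \<noteq> c"
  proof -
    have "card {a, b, c} = 3" using assms by simp
    moreover have "card {x, y} \<noteq> 3" for x y :: nat
      by (simp add: card_insert_if)
    ultimately show "a \<noteq> b" "b \<noteq> c" "a \<noteq> c" by (metis insert_absorb2 insert_commute)+
  qed
  have "{..<n} - {v} = nb {a} v \<union> nb {b} v \<union> nb {c} v"
  proof -
    have "f {v, w} \<in> {a, b, c}" if "w < n" "w \<noteq> v" for w
      using col[OF assms(2) that(1)] that assms(1) by auto
    then show ?thesis by (auto simp: nbrs_def)
  qed
  moreover have "card (nb {a} v \<union> nb {b} v \<union> nb {c} v) = dg a v + dg b v + dg c v"
    using dist by (subst card_Un_disjoint; (subst card_Un_disjoint)?) (auto simp: nbrs_def)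
  moreover have "card ({..<n} - {v}) = n - 1" using assms by simp
  ultimately show ?thesis by metis
qed

end

subsection \<open>The special color\<close>

text \<open>Ramsey numbers enter through their partition property and a few inequalities:
  \<open>r\<close>, \<open>s\<close>, \<open>p\<close> stand for r(k, k), r(k, h), r(k, k - 1), and
  \<open>R\<close> for a three-color number. \<open>pz\<close> is the second politeness inequality.
  \<open>z\<close> is the fourth root of \<open>s / r\<close>, at most 1/128 as 2^(-31) is below
  128^(-4). \<open>zk\<close> rests on the exponential growth of r(k, k).\<close>

locale polite_constants =
  fixes k h r s p R m :: nat and z :: real
  assumes partn_r: "partn_lst {..<r} [k, k] 2"
    and partn_s: "partn_lst {..<s} [k, h] 2" and h: "k \<le> 2 * h"
    and partn_p: "partn_lst {..<p} [k, k - 1] 2"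
    and partn_R: "partn_lst {..<R} [k, k, k] 2"
    and k2: "2 \<le> k"
    and r_eq: "r = Suc m" and m1: "100 \<le> m"
    and z: "0 < z" "z \<le> 1 / 128" "real s = z ^ 4 * r"
    and ks: "k \<le> s"
    and pz: "p * (1 + 25 * z) \<le> m"
    and zk: "2 \<le> 10 * z * m * (9 / 10) ^ (k - 1)"

text \<open>\<open>\<mu>\<close> is the ideal clique size in a blowup. \<open>light_single\<close>
  holds for every vertex, not only for most, and this is what later bounds the degrees of all
  vertices.\<close>

locale ramsey_light = light_family n f lgt B \<delta> + polite_constants k h r s p R m z
  for n :: nat and f :: "nat set \<Rightarrow> nat" and lgt :: "nat set \<Rightarrow> bool" and B :: nat and \<delta> :: real
    and k h r s p R m :: nat and z :: real +
  fixes \<mu> :: real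
  assumes B: "R + 1 \<le> B" "2 * s \<le> B" "r + 1 \<le> B" "p + 1 \<le> B" "k \<le> B"
    and \<mu>: "\<mu> * m = n" and \<mu>_ge: "100 \<le> \<mu>"
    and \<delta>_pos: "0 < \<delta>" and \<delta>km: "k * m * \<delta> \<le> 1 / 1000"
    and light_empty: "lgt {}"
    and light_single: "\<And>v. v < n \<Longrightarrow> lgt {v}"
    and not_rich: "\<And>T Q c. lgt T \<Longrightarrow> T \<subseteq> {..<n} \<Longrightarrow> Q \<subseteq> T \<Longrightarrow> card Q = k \<Longrightarrow> c < 3 \<Longrightarrow>
        mono_clique f c Q \<Longrightarrow> (\<Prod>v\<in>Q. real (dg c v)) < ((1 + \<delta>) * \<mu>) ^ k"
begin

lemma \<mu>_pos: "0 < \<mu>" using \<mu>_ge by simp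

text \<open>\<open>1 - k * \<delta>\<close> is at most \<open>(1 - \<delta>) ^ k\<close> by
  Bernoulli, so its product with the left side is at most 1, while its product with the right side
  is at least 1.\<close>

lemma power_\<delta>: "(1 + \<delta>) ^ k \<le> 1 + 2 * k * \<delta>"
proof -
  have "k * \<delta> * 1 \<le> k * \<delta> * m"
    using \<delta>_pos m1 by (intro mult_left_mono) auto
  then have k\<delta>: "k * \<delta> \<le> 1 / 1000" using \<delta>km by (simp add: mult_ac)
  have "1 * \<delta> \<le> k * \<delta>" using k2 \<delta>_pos by (intro mult_right_mono) auto
  then have "-1 \<le> - \<delta>" using k\<delta> by simp
  then have "1 - k * \<delta> \<le> (1 - \<delta>) ^ k"
    using Bernoulli_inequality[of "- \<delta>" k] by simp
  then have "(1 + \<delta>) ^ k * (1 - k * \<delta>) \<le> (1 + \<delta>) ^ k * (1 - \<delta>) ^ k"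
    using \<delta>_pos by (intro mult_left_mono) auto
  also have "\<dots> = (1 - \<delta>\<^sup>2) ^ k"
    by (simp flip: power_mult_distrib add: power2_eq_square algebra_simps)
  also have "\<dots> \<le> 1"
  proof -
    have "\<delta> * \<delta> \<le> 1 * 1"
      using k\<delta> \<open>1 * \<delta> \<le> k * \<delta>\<close> \<delta>_pos by (intro mult_mono) linarith+
    then show ?thesis by (intro power_le_one) (auto simp: power2_eq_square)
  qed
  also have "1 \<le> (1 + 2 * k * \<delta>) * (1 - k * \<delta>)"
  proof -
    have "k * \<delta> * (k * \<delta>) \<le> k * \<delta> * (1 / 2)"
      using k\<delta> \<delta>_pos by (intro mult_left_mono) auto
    then show ?thesis by (simp add: algebra_simps)
  qed
  finally show ?thesis using k\<delta> by (simp add: mult_le_cancel_right)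
qed

lemma \<delta>: "0 < \<delta>" "\<delta> * m \<le> 1 / 100" "(1 + \<delta>) ^ k \<le> 2"
proof -
  have "1 * (m * \<delta>) \<le> k * (m * \<delta>)" using k2 \<delta>_pos by (intro mult_right_mono) auto
  then show "\<delta> * m \<le> 1 / 100" using \<delta>km by (simp add: mult_ac)
  have "k * \<delta> * 1 \<le> k * \<delta> * m"
    using \<delta>_pos m1 by (intro mult_left_mono) auto
  then have "k * \<delta> \<le> 1 / 1000" using \<delta>km by (simp add: mult_ac)
  then show "(1 + \<delta>) ^ k \<le> 2" using power_\<delta> by simp
qed (rule \<delta>_pos)

lemma \<delta>n: "\<delta> * n \<le> \<mu> / 100"
proof -
  have "\<delta> * n = \<delta> * m * \<mu>" using \<mu> by (simp add: mult.commute)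
  also have "\<dots> \<le> 1 / 100 * \<mu>" using \<delta> \<mu>_pos by (intro mult_right_mono) auto
  finally show ?thesis by simp
qed

lemma \<delta>_le: "\<delta> \<le> 1 / 10000"
proof -
  have "\<delta> * 100 \<le> \<delta> * m" using m1 \<delta> by (intro mult_left_mono) auto
  then show ?thesis using \<delta> by linarith
qed

lemma not_all_high:
  assumes "lgt T" "T \<subseteq> {..<n}" "Q \<subseteq> T" "card Q = k" "c < 3" "mono_clique f c Q"
    and "\<And>v. v \<in> Q \<Longrightarrow> (1 + \<delta>) * \<mu> \<le> dg c v"
  shows False
proof -
  have "((1 + \<delta>) * \<mu>) ^ k = (\<Prod>v\<in>Q. (1 + \<delta>) * \<mu>)"
    using assms by simp
  also have "\<dots> \<le> (\<Prod>v\<in>Q. real (dg c v))"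
    using assms \<mu>_pos \<delta> by (intro prod_mono) auto
  finally show False using not_rich[OF assms(1-6)] by linarith
qed

text \<open>A single vertex \<open>v\<close> of very large degree may pay for \<open>k - 1\<close>
  vertices whose degrees fall slightly short; here the product in \<open>not_rich\<close> beats a
  condition on the minimum degree.\<close>

lemma not_insert_high:
  fixes x :: real
  assumes "lgt T" "T \<subseteq> {..<n}" "insert v Q \<subseteq> T" "v \<notin> Q" "card Q = k - 1" "c < 3"
    and "mono_clique f c Q" "Q \<subseteq> nb {c} v"
    and Q: "\<And>u. u \<in> Q \<Longrightarrow> x \<le> dg c u" "0 \<le> x"
    and v: "((1 + \<delta>) * \<mu>) ^ k \<le> dg c v * x ^ (k - 1)"
  shows False
proof -
  have fin: "finite Q" using assms(8) by (rule finite_subset) simp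
  have "(\<Prod>u\<in>insert v Q. real (dg c u)) = dg c v * (\<Prod>u\<in>Q. real (dg c u))"
    using fin assms(4) by simp
  moreover have "real (dg c v) * (\<Prod>u\<in>Q. x) \<le> dg c v * (\<Prod>u\<in>Q. real (dg c u))"
    using Q by (intro mult_left_mono prod_mono) auto
  ultimately have "((1 + \<delta>) * \<mu>) ^ k \<le> (\<Prod>u\<in>insert v Q. real (dg c u))"
    using v assms(5) by simp
  moreover have "mono_clique f c (insert v Q)"
    using assms(7,8) by (auto simp: mono_clique_insert nbrs_def)
  moreover have "card (insert v Q) = k"
    using fin assms(4,5) k2 by simp
  ultimately show False using not_rich[OF assms(1-3) _ assms(6)] by force
qed

text \<open>Among \<open>R\<close> greedily chosen vertices there is a monochromatic
  \<open>k\<close>-set, and it is rich whatever its color.\<close>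

lemma high_in_all_colors:
  assumes X: "X \<subseteq> {..<n}" and high: "\<And>v c. v \<in> X \<Longrightarrow> c < 3 \<Longrightarrow> (1 + \<delta>) * \<mu> \<le> dg c v"
  shows "card X \<le> \<delta> * n"
proof (rule ccontr)
  assume "\<not> ?thesis"
  then obtain W where W: "W \<subseteq> X" "card W = R" "lgt W"
    using greedy_free[OF light_empty, of R X] B X by auto
  have Wn: "W \<subseteq> {..<n}" using W X by simp
  then have "finite W" by (rule finite_subset) simp
  then show False
  proof (rule partn_lst_three_colors[OF partn_R, of W f])
    show "R \<le> card W" using W by simp
    show "f {u, v} < 3" if "u \<in> W" "v \<in> W" "u \<noteq> v" for u v
      using that Wn by (intro col) auto
    show False if cQ: "c < 3" "Q \<subseteq> W" "card Q = k" "mono_clique f c Q" for c Q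
    proof -
      have "(1 + \<delta>) * \<mu> \<le> dg c v" if "v \<in> Q" for v
        using that cQ W by (intro high) auto
      then show False
        using not_all_high[OF W(3) Wn cQ(2,3,1,4)] by blast
    qed
  qed
qed

text \<open>Greedily avoiding both \<open>a\<close> and \<open>b\<close> leaves a clique of color
  \<open>c\<close>, whose vertices have nearly full degree in \<open>c\<close>. Each choice excludes
  at most \<open>4 * \<mu>\<close> others.\<close>

lemma two_low:
  assumes abc: "{a, b, c} = {..<3}"
  shows "card {v \<in> {..<n}. dg a v < 2 * \<mu> \<and> dg b v < 2 * \<mu>} \<le> 4 * k * \<mu>"
proof (rule ccontr)
  define X where "X = {v \<in> {..<n}. dg a v < 2 * \<mu> \<and> dg b v < 2 * \<mu>}"
  assume "\<not> ?thesis"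
  then have big: "real (card X) > 4 * k * \<mu>" by (simp add: X_def)
  have "card (nb {a, b} w) \<le> 4 * \<mu>" if "w \<in> X" for w
  proof -
    have "nb {a, b} w \<subseteq> nb {a} w \<union> nb {b} w" by (auto simp: nbrs_def)
    then have "card (nb {a, b} w) \<le> card (nb {a} w \<union> nb {b} w)"
      by (intro card_mono) auto
    also have "\<dots> \<le> dg a w + dg b w" by (rule card_Un_le)
    finally show ?thesis using that by (simp add: X_def)
  qed
  moreover have "real (card X) + 4 * \<mu> > k * (4 * \<mu>) + \<delta> * n"
    using big \<delta>n \<mu>_pos by linarith
  ultimately obtain W where W: "W \<subseteq> X" "card W = k" "lgt W"
      and Wc: "\<forall>u\<in>W. \<forall>v\<in>W. u \<noteq> v \<longrightarrow> f {u, v} \<notin> {a, b}"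
    using greedy[OF light_empty, of k X "4 * \<mu>" "{a, b}"] \<mu>_pos B by (auto simp: X_def)
  have Wn: "W \<subseteq> {..<n}" using W X_def by auto
  have "f {u, v} = c" if "u \<in> W" "v \<in> W" "u \<noteq> v" for u v
  proof -
    have "f {u, v} \<in> {a, b, c}" using col[of u v] that Wn abc by auto
    then show ?thesis using Wc that by blast
  qed
  then have "mono_clique f c W" by (simp add: mono_clique_def)
  moreover have "(1 + \<delta>) * \<mu> \<le> dg c v" if "v \<in> W" for v
  proof -
    have v: "dg a v < 2 * \<mu>" "dg b v < 2 * \<mu>" "v < n" using W that by (auto simp: X_def)
    have "real (dg a v) + dg b v + dg c v = real n - 1"
      using dg_sum[OF abc v(3)] v(3) by linarith
    moreover have "\<mu> * 100 \<le> n"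
      using \<mu> m1 \<mu>_pos by (metis mult_left_mono less_imp_le of_nat_le_iff of_nat_numeral)
    moreover have "(1 + \<delta>) * \<mu> \<le> 2 * \<mu>"
      using \<delta>_le \<mu>_pos by (intro mult_right_mono) auto
    ultimately show ?thesis using v \<mu>_ge by linarith
  qed
  moreover have "c < 3" using abc by auto
  ultimately show False
    using not_all_high[of W W c] W Wn by blast
qed

definition low_in :: "nat \<Rightarrow> nat set" where
  "low_in c = {v \<in> {..<n}. dg c v < 2 * \<mu> \<and> (\<forall>a<3. a \<noteq> c \<longrightarrow> 2 * \<mu> \<le> dg a v)}"

lemma high_2: "(1 + \<delta>) * \<mu> \<le> x" if "2 * \<mu> \<le> x"
proof -
  have "(1 + \<delta>) * \<mu> \<le> 2 * \<mu>"
    using \<delta>_le \<mu>_pos by (intro mult_right_mono) auto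
  then show ?thesis using that by linarith
qed

text \<open>\<open>s\<close> is \<open>z ^ 4 * r\<close>, so three spare factors \<open>z\<close>
  absorb the constant; 361 is the sum of 31 from \<open>compl_U\<close> and 330 from
  \<open>low_U\<close>.\<close>

lemma s_m: "361 * real s \<le> z * m / 2"
proof -
  have "z ^ 3 \<le> (1 / 128) ^ 3"
    using z by (intro power_mono) auto
  then have "z * z ^ 3 \<le> z * (1 / 128) ^ 3"
    using z by (intro mult_left_mono) auto
  then have "z ^ 4 \<le> z / 2000000" using z
    by (simp add: eval_nat_numeral)
  then have "z ^ 4 * r \<le> z / 2000000 * r" by (intro mult_right_mono) auto
  also have "\<dots> \<le> z / 2000000 * (2 * m)" using z r_eq m1 by (intro mult_left_mono) auto
  finally show ?thesis using z by simp
qed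

text \<open>In the larger class one avoids vertices with many edges of color \<open>b\<close> into the smaller one.
  Then \<open>s\<close> vertices on each side have only color \<open>c\<close> in between, and \<open>c\<close> is frequent everywhere.\<close>

lemma two_classes_aux:
  assumes abc: "{a, b, c} = {..<3}" and dist: "a \<noteq> b" "b \<noteq> c" "a \<noteq> c"
    and big: "9 * s * \<mu> \<le> card (low_in b)" and le: "card (low_in b) \<le> card (low_in a)"
  shows False
proof -
  have c3: "a < 3" "b < 3" "c < 3" using abc by auto
  have s1: "1 \<le> s" using ks k2 by simp
  have s\<mu>: "\<mu> \<le> s * \<mu>" using s1 \<mu>_pos by simp
  define Ua Ub where "Ua = low_in a" and "Ub = low_in b"
  have fin: "finite Ua" "finite Ub" and sub: "Ua \<subseteq> {..<n}" "Ub \<subseteq> {..<n}"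
    by (auto simp: Ua_def Ub_def low_in_def)
  \<comment> \<open>Counted from the side of \<open>Ub\<close>, at most
    \<open>2 * \<mu> * card Ub\<close> pairs of color \<open>b\<close> join the classes, so by
    Markov and \<open>le\<close> at least half of \<open>Ua\<close> survives in
    \<open>X\<close>.\<close>
  define X where "X = {v \<in> Ua. card (nb {b} v \<inter> Ub) \<le> 4 * \<mu>}"
  have "(\<Sum>v\<in>Ua. card (nb {b} v \<inter> Ub)) = card {(v, w) \<in> Ua \<times> Ub. w \<in> nb {b} v}"
  proof -
    have "{(v, w) \<in> Ua \<times> Ub. w \<in> nb {b} v} = Sigma Ua (\<lambda>v. nb {b} v \<inter> Ub)" by auto
    then show ?thesis using fin by (simp add: card_SigmaI)
  qed
  also have "\<dots> = card {(w, v) \<in> Ub \<times> Ua. v \<in> nb {b} w}"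
  proof (rule bij_betw_same_card[of prod.swap])
    show "bij_betw prod.swap {(v, w) \<in> Ua \<times> Ub. w \<in> nb {b} v} {(w, v) \<in> Ub \<times> Ua. v \<in> nb {b} w}"
      using sub by (intro bij_betwI[of _ _ _ prod.swap]) (auto simp: nbrs_def insert_commute)
  qed
  also have "\<dots> = (\<Sum>w\<in>Ub. card (nb {b} w \<inter> Ua))"
  proof -
    have "{(w, v) \<in> Ub \<times> Ua. v \<in> nb {b} w} = Sigma Ub (\<lambda>w. nb {b} w \<inter> Ua)" by auto
    then show ?thesis using fin by (simp add: card_SigmaI)
  qed
  finally have "real (\<Sum>v\<in>Ua. card (nb {b} v \<inter> Ub)) = real (\<Sum>w\<in>Ub. card (nb {b} w \<inter> Ua))"
    by simp
  also have "\<dots> \<le> (\<Sum>w\<in>Ub. 2 * \<mu>)"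
    unfolding of_nat_sum
  proof (intro sum_mono)
    fix w assume "w \<in> Ub"
    then have "dg b w < 2 * \<mu>" by (simp add: Ub_def low_in_def)
    moreover have "card (nb {b} w \<inter> Ua) \<le> dg b w" by (intro card_mono) auto
    ultimately show "card (nb {b} w \<inter> Ua) \<le> 2 * \<mu>" by linarith
  qed
  finally have e1: "real (\<Sum>v\<in>Ua. card (nb {b} v \<inter> Ub)) \<le> card Ub * (2 * \<mu>)" by simp
  have "card (Ua - X) * (4 * \<mu>) = (\<Sum>v\<in>Ua - X. 4 * \<mu>)" by simp
  also have "\<dots> \<le> (\<Sum>v\<in>Ua - X. real (card (nb {b} v \<inter> Ub)))"
    by (intro sum_mono) (auto simp: X_def)
  also have "\<dots> \<le> (\<Sum>v\<in>Ua. real (card (nb {b} v \<inter> Ub)))"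
    using fin by (intro sum_mono2) auto
  also have "\<dots> \<le> card Ub * (2 * \<mu>)" using e1 by simp
  also have "\<dots> \<le> card Ua * (2 * \<mu>)"
    using le \<mu>_pos by (intro mult_right_mono) (auto simp: Ua_def Ub_def)
  finally have "real (card (Ua - X)) * 2 \<le> card Ua" using \<mu>_pos by simp
  moreover have "card (Ua - X) = card Ua - card X"
    by (intro card_Diff_subset) (use fin in \<open>auto simp: X_def\<close>)
  ultimately have "real (card X) * 2 \<ge> card Ua" by linarith
  then have cX: "2 * real (card X) \<ge> 9 * s * \<mu>" using big le by (simp add: Ua_def)
  have X: "X \<subseteq> Ua" by (auto simp: X_def)
  have "dg a w \<le> 2 * \<mu>" if "w \<in> X" for w
    using that X by (auto simp: Ua_def low_in_def)
  moreover have "real (card X) + 2 * \<mu> > s * (2 * \<mu>) + \<delta> * n"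
    using cX \<delta>n s\<mu> \<mu>_pos by linarith
  ultimately obtain S where S: "S \<subseteq> X" "card S = s" "lgt S"
      and Sc: "\<forall>u\<in>S. \<forall>v\<in>S. u \<noteq> v \<longrightarrow> f {u, v} \<notin> {a}"
    using greedy[OF light_empty, of s X "2 * \<mu>" "{a}"] \<mu>_pos B X sub by auto
  have finS: "finite S" using S X fin by (meson finite_subset)
  \<comment> \<open>A vertex of \<open>S\<close> excludes at most \<open>2 * \<mu>\<close> vertices
    through \<open>a\<close> and \<open>4 * \<mu>\<close> through \<open>b\<close>; of
    \<open>9 * s * \<mu>\<close> vertices at least a third is left.\<close>
  define Y where "Y = Ub - (\<Union>v\<in>S. nb {a, b} v \<inter> Ub)"
  have "real (card (nb {a, b} v \<inter> Ub)) \<le> 6 * \<mu>" if "v \<in> S" for v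
  proof -
    have "nb {a, b} v \<inter> Ub \<subseteq> nb {a} v \<union> (nb {b} v \<inter> Ub)" by (auto simp: nbrs_def)
    then have "card (nb {a, b} v \<inter> Ub) \<le> card (nb {a} v \<union> (nb {b} v \<inter> Ub))"
      by (intro card_mono) auto
    also have "\<dots> \<le> dg a v + card (nb {b} v \<inter> Ub)" by (rule card_Un_le)
    finally show ?thesis using that S by (auto simp: X_def Ua_def low_in_def)
  qed
  then have "(\<Sum>v\<in>S. real (card (nb {a, b} v \<inter> Ub))) \<le> (\<Sum>v\<in>S. 6 * \<mu>)"
    by (intro sum_mono)
  then have "real (\<Sum>v\<in>S. card (nb {a, b} v \<inter> Ub)) \<le> s * (6 * \<mu>)"
    using S by simp
  moreover have "card (\<Union>v\<in>S. nb {a, b} v \<inter> Ub) \<le> (\<Sum>v\<in>S. card (nb {a, b} v \<inter> Ub))"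
    by (rule card_UN_le[OF finS])
  ultimately have "real (card (\<Union>v\<in>S. nb {a, b} v \<inter> Ub)) \<le> s * (6 * \<mu>)"
    by linarith
  moreover have "card Ub - card (\<Union>v\<in>S. nb {a, b} v \<inter> Ub) \<le> card Y"
    unfolding Y_def using finS by (intro diff_card_le_card_Diff) auto
  ultimately have cY: "real (card Y) \<ge> 3 * s * \<mu>"
    using big by (simp add: Ub_def)
  have Y: "Y \<subseteq> Ub" by (auto simp: Y_def)
  have "dg b w \<le> 2 * \<mu>" if "w \<in> Y" for w
  proof -
    have "w \<in> low_in b" using that Y by (auto simp: Ub_def)
    then show ?thesis by (simp add: low_in_def)
  qed
  moreover have "real (card Y) + 2 * \<mu> > s * (2 * \<mu>) + \<delta> * n"
    using cY \<delta>n s\<mu> \<mu>_pos by linarith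
  moreover have "w \<notin> nb {b} v" if "v \<in> S" "w \<in> Y" for v w
    using that unfolding Y_def by (auto simp: nbrs_def)
  moreover have Sn: "S \<subseteq> {..<n}" "Y \<subseteq> {..<n}" using S X sub Y by auto
  ultimately obtain T where T: "T \<subseteq> Y" "card T = s" "T \<inter> S = {}" "lgt (S \<union> T)"
      and Tc: "\<forall>u\<in>T. \<forall>v\<in>S \<union> T. u \<noteq> v \<longrightarrow> f {u, v} \<notin> {b}"
    using greedy[OF S(3), of s Y "2 * \<mu>" "{b}"] \<mu>_pos B S by auto
  have ST: "S \<union> T \<subseteq> {..<n}" using Sn T by auto
  have finT: "finite T" using T Y fin by (meson finite_subset)
  have cases: "f {u, v} = a \<or> f {u, v} = b \<or> f {u, v} = c"
    if "u \<in> S \<union> T" "v \<in> S \<union> T" "u \<noteq> v" for u v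
  proof -
    have "f {u, v} \<in> {a, b, c}" using col[of u v] that ST abc by auto
    then show ?thesis by blast
  qed
  have dS: "2 * \<mu> \<le> dg b v" "2 * \<mu> \<le> dg c v" if "v \<in> S" for v
    using that S X dist c3 by (auto simp: Ua_def low_in_def)
  have dT: "2 * \<mu> \<le> dg a v" "2 * \<mu> \<le> dg c v" if "v \<in> T" for v
    using that T Y dist c3 by (auto simp: Ub_def low_in_def)
  \<comment> \<open>No edge inside \<open>S\<close> has color \<open>a\<close>, and a
    \<open>k\<close>-clique of color \<open>b\<close> would be rich since \<open>b\<close> is
    frequent on \<open>S\<close>. This leaves a clique of color \<open>c\<close> on \<open>h\<close>
    vertices; together with its partner in \<open>T\<close> it has \<open>2 * h\<close> vertices, at
    least \<open>k\<close>.\<close>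
  have "\<exists>Q\<subseteq>S. card Q = h \<and> mono_clique f c Q"
  proof (rule partn_lst_two_colors[OF partn_s finS, of f b c])
    show "s \<le> card S" using S by simp
    show "f {u, v} = b \<or> f {u, v} = c" if "u \<in> S" "v \<in> S" "u \<noteq> v" for u v
      using cases[of u v] Sc that by auto
    show ?thesis if Q: "Q \<subseteq> S" "card Q = k" "mono_clique f b Q" for Q
    proof -
      have "(1 + \<delta>) * \<mu> \<le> dg b v" if "v \<in> Q" for v
        using that Q by (intro high_2 dS) auto
      then show ?thesis
        using not_all_high[OF T(4) ST _ Q(2) _ Q(3)] Q(1) c3 by auto
    qed
  qed blast
  then obtain P where P: "P \<subseteq> S" "card P = h" "mono_clique f c P" by blast
  have "\<exists>Q\<subseteq>T. card Q = h \<and> mono_clique f c Q"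
  proof (rule partn_lst_two_colors[OF partn_s finT, of f a c])
    show "s \<le> card T" using T by simp
    show "f {u, v} = a \<or> f {u, v} = c" if "u \<in> T" "v \<in> T" "u \<noteq> v" for u v
      using cases[of u v] Tc that by auto
    show ?thesis if Q: "Q \<subseteq> T" "card Q = k" "mono_clique f a Q" for Q
    proof -
      have "(1 + \<delta>) * \<mu> \<le> dg a v" if "v \<in> Q" for v
        using that Q by (intro high_2 dT) auto
      then show ?thesis
        using not_all_high[OF T(4) ST _ Q(2) _ Q(3)] Q(1) c3 by auto
    qed
  qed blast
  then obtain Q where Q: "Q \<subseteq> T" "card Q = h" "mono_clique f c Q" by blast
  have cross: "f {u, v} = c" if "u \<in> S" "v \<in> T" for u v
  proof -
    have ne: "u \<noteq> v" using that T by auto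
    have "v \<notin> nb {a, b} u" using that T Y_def by auto
    then have "f {u, v} \<notin> {a, b}" using that ST ne by (auto simp: nbrs_def)
    then show ?thesis using cases[of u v] that ne by auto
  qed
  have "mono_clique f c (P \<union> Q)"
    unfolding mono_clique_def
  proof (intro ballI impI)
    fix u v assume "u \<in> P \<union> Q" "v \<in> P \<union> Q" "u \<noteq> v"
    then show "f {u, v} = c"
      using P Q cross[of u v] cross[of v u] by (auto simp: mono_clique_def insert_commute)
  qed
  moreover have "card (P \<union> Q) = card P + card Q"
    using P Q T finS finT by (intro card_Un_disjoint) (auto dest: finite_subset)
  then have "k \<le> card (P \<union> Q)" using P Q h by simp
  then obtain K where "K \<subseteq> P \<union> Q" "card K = k"
    using obtain_subset_with_card_n by metis
  ultimately have K: "K \<subseteq> S \<union> T" "card K = k" "mono_clique f c K"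
    using P Q mono_clique_subset by blast+
  have "(1 + \<delta>) * \<mu> \<le> dg c v" if "v \<in> K" for v
    using that K dS dT by (intro high_2) auto
  then show False
    using not_all_high[OF T(4) ST K(1,2) c3(3) K(3)] by blast
qed

lemma two_classes:
  assumes abc: "{a, b, c} = {..<3}" and dist: "a \<noteq> b" "b \<noteq> c" "a \<noteq> c"
  shows "card (low_in a) < 9 * s * \<mu> \<or> card (low_in b) < 9 * s * \<mu>"
proof (rule ccontr)
  assume neg: "\<not> ?thesis"
  have bac: "{b, a, c} = {..<3}" using abc by auto
  show False
  proof (cases "card (low_in b) \<le> card (low_in a)")
    case True
    then show ?thesis using two_classes_aux[OF abc dist] neg by simp
  next
    case False
    then show ?thesis using two_classes_aux[OF bac dist(1)[symmetric] dist(3,2)] neg by simp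
  qed
qed

text \<open>A vertex outside \<open>low_in c\<close> lies in another class, has two low colors, or
  is high in all three. The constant 30 is 9 + 9 for the classes and 3 times 4 for the pairs of low
  colors, using \<open>k \<le> s\<close>; the last kind gives \<open>\<mu> / 100\<close>.\<close>

lemma compl_low_in:
  assumes abc: "{a, b, c} = {..<3}" and small: "card (low_in a) < 9 * s * \<mu>" "card (low_in b) < 9 * s * \<mu>"
  shows "card ({..<n} - low_in c) \<le> 30 * s * \<mu> + \<mu> / 100"
proof -
  define L where "L = (\<lambda>x y. {v \<in> {..<n}. dg x v < 2 * \<mu> \<and> dg y v < 2 * \<mu>})"
  define A where "A = {v \<in> {..<n}. \<forall>c<3. (1 + \<delta>) * \<mu> \<le> dg c v}"
  have "{..<n} - low_in c \<subseteq> low_in a \<union> low_in b \<union> (L a b \<union> L a c \<union> L b c) \<union> A"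
  proof
    fix v assume v: "v \<in> {..<n} - low_in c"
    have "x < 3 \<longleftrightarrow> x = a \<or> x = b \<or> x = c" for x
      using abc by (metis insert_iff lessThan_iff singletonD)
    then have 3: "(\<forall>x<3. P x) \<longleftrightarrow> P a \<and> P b \<and> P c" for P
      by metis
    have A: "v \<in> A" if "2 * \<mu> \<le> dg a v" "2 * \<mu> \<le> dg b v" "2 * \<mu> \<le> dg c v"
      using that[THEN high_2] v by (simp add: A_def 3)
    show "v \<in> low_in a \<union> low_in b \<union> (L a b \<union> L a c \<union> L b c) \<union> A"
      using v A unfolding low_in_def L_def 3 by (simp only: Un_iff Diff_iff mem_Collect_eq not_less[symmetric]) argo
  qed
  then have "card ({..<n} - low_in c) \<le> card (low_in a \<union> low_in b \<union> (L a b \<union> L a c \<union> L b c) \<union> A)"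
    by (intro card_mono) (auto simp: low_in_def L_def A_def)
  also have "\<dots> \<le> card (low_in a) + card (low_in b) + (card (L a b) + card (L a c) + card (L b c)) + card A"
    by (intro order_trans[OF card_Un_le] add_mono order_refl)
  finally have "card ({..<n} - low_in c)
      \<le> card (low_in a) + card (low_in b) + (card (L a b) + card (L a c) + card (L b c)) + card A" .
  moreover have "{a, c, b} = {..<3}" "{b, c, a} = {..<3}"
    unfolding abc[symmetric] by blast+
  then have "card (L a b) \<le> 4 * k * \<mu>" "card (L a c) \<le> 4 * k * \<mu>" "card (L b c) \<le> 4 * k * \<mu>"
    unfolding L_def using two_low abc by blast+
  moreover have "card A \<le> \<delta> * n"
    by (rule high_in_all_colors) (auto simp: A_def)
  moreover have "4 * k * \<mu> \<le> 4 * s * \<mu>"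
    using ks \<mu>_pos by (intro mult_right_mono) auto
  ultimately show ?thesis using small \<delta>n by linarith
qed

end

section \<open>Degrees when one color \<open>c\<close> is rare at almost every vertex\<close>

locale special_color = ramsey_light +
  fixes a b c :: nat
  assumes abc: "{a, b, c} = {..<3}" and dist: "a \<noteq> b" "b \<noteq> c" "a \<noteq> c"
    and compl_low: "card ({..<n} - low_in c) \<le> 30 * s * \<mu> + \<mu> / 100"
begin

lemma lt3: "x < 3 \<longleftrightarrow> x = a \<or> x = b \<or> x = c"
  using abc by (metis insert_iff lessThan_iff singletonD)

text \<open>The assumptions are symmetric in \<open>a\<close> and \<open>b\<close>, so a bound
  proved for one of them transfers to the other.\<close>

lemma swap: "special_color n f lgt B \<delta> k h r s p R m z \<mu> b a c"
proof unfold_locales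
  show "{b, a, c} = {..<3}" unfolding abc[symmetric] by blast
qed (use dist compl_low in auto)

lemma s1: "1 \<le> real s" "\<mu> \<le> s * \<mu>"
  using ks k2 \<mu>_pos by auto

text \<open>The typical vertices: cliques of color \<open>a\<close> or \<open>b\<close> among them
  are rich, and each excludes barely more than \<open>\<mu>\<close> candidates when \<open>c\<close>
  is avoided.\<close>

definition U :: "nat set" where "U = {v \<in> low_in c. dg c v < (1 + \<delta>) * \<mu>}"

lemma U_subset: "U \<subseteq> {..<n}" by (auto simp: U_def low_in_def)

lemma U_high: "v \<in> U \<Longrightarrow> 2 * \<mu> \<le> dg a v" "v \<in> U \<Longrightarrow> 2 * \<mu> \<le> dg b v"
  using dist lt3 by (auto simp: U_def low_in_def)

lemma compl_U: "card ({..<n} - U) \<le> 31 * s * \<mu>"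
proof -
  define X where "X = low_in c - U"
  have "card X \<le> \<delta> * n"
  proof (rule high_in_all_colors)
    show "X \<subseteq> {..<n}" by (auto simp: X_def low_in_def)
    show "(1 + \<delta>) * \<mu> \<le> dg d v" if "v \<in> X" "d < 3" for v d
      using that high_2 by (cases "d = c") (auto simp: X_def U_def low_in_def)
  qed
  moreover have "card ({..<n} - U) \<le> card ({..<n} - low_in c) + card X"
  proof -
    have "{..<n} - U \<subseteq> ({..<n} - low_in c) \<union> X" by (auto simp: X_def)
    then have "card ({..<n} - U) \<le> card (({..<n} - low_in c) \<union> X)"
      by (intro card_mono) (auto simp: X_def low_in_def)
    then show ?thesis using card_Un_le order_trans by blast
  qed
  ultimately show ?thesis using compl_low \<delta>n s1 by linarith
qed

text \<open>Without \<open>c\<close> two colors remain, and \<open>r\<close> vertices contain a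
  \<open>k\<close>-clique of color \<open>a\<close> or \<open>b\<close>, which is rich by
  \<open>high\<close>.\<close>

lemma no_c_free:
  assumes Z: "lgt Z" "Z \<subseteq> {..<n}" "r \<le> card Z"
    and high: "\<And>v. v \<in> Z \<Longrightarrow> (1 + \<delta>) * \<mu> \<le> dg a v" "\<And>v. v \<in> Z \<Longrightarrow> (1 + \<delta>) * \<mu> \<le> dg b v"
    and free: "\<And>u v. u \<in> Z \<Longrightarrow> v \<in> Z \<Longrightarrow> u \<noteq> v \<Longrightarrow> f {u, v} \<noteq> c"
  shows False
proof (rule partn_lst_two_colors[OF partn_r, of Z f a b])
  show "finite Z" using Z finite_subset by blast
  show "f {u, v} = a \<or> f {u, v} = b" if "u \<in> Z" "v \<in> Z" "u \<noteq> v" for u v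
    using col[of u v] that Z free lt3 by blast
  show False if "Q \<subseteq> Z" "card Q = k" "mono_clique f a Q" for Q
    using not_all_high[of Z Q a] that Z high lt3 by blast
  show False if "Q \<subseteq> Z" "card Q = k" "mono_clique f b Q" for Q
    using not_all_high[of Z Q b] that Z high lt3 by blast
qed (rule Z)

text \<open>Many vertices of too small degree could be packed too densely: \<open>r\<close> vertices
  without color \<open>c\<close> would fit, although \<open>n / \<mu>\<close> is only
  \<open>m\<close>.\<close>

lemma low_U: "card {v \<in> U. dg c v < 9 / 10 * \<mu>} \<le> 330 * s * \<mu>"
proof (rule ccontr)
  define W where "W = {v \<in> U. dg c v < 9 / 10 * \<mu>}"
  assume "\<not> ?thesis"
  then have big: "real (card W) > 330 * s * \<mu>" by (simp add: W_def)
  have WU: "W \<subseteq> U" by (auto simp: W_def)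
  have Wn: "W \<subseteq> {..<n}" using WU U_subset by simp
  \<comment> \<open>Each of these vertices excludes a tenth of \<open>\<mu>\<close> less than usual.
    For \<open>311 * s\<close> of them the saving is \<open>31.1 * s * \<mu>\<close>, just more than
    the \<open>31 * s * \<mu>\<close> vertices that may lie outside \<open>U\<close>.\<close>
  define j where "j = 311 * s"
  have "z * m \<le> 1 * real m" using z by (intro mult_right_mono) auto
  then have jm: "j \<le> m" using s_m unfolding j_def by linarith
  have D: "dg c w \<le> 9 / 10 * \<mu>" if "w \<in> W" for w using that by (simp add: W_def)
  have "real (card W) + 9 / 10 * \<mu> > j * (9 / 10 * \<mu>) + \<delta> * n"
    using big \<delta>n s1(2) \<mu>_pos by (simp add: j_def)
  then obtain T where T: "T \<subseteq> W" "card T = j" "lgt T"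
      and Tc: "\<forall>u\<in>T. \<forall>v\<in>T. u \<noteq> v \<longrightarrow> f {u, v} \<notin> {c}"
    using greedy[OF light_empty _ _ Wn _ D, of j] \<mu>_pos B jm r_eq by auto
  have Tn: "T \<subseteq> {..<n}" using T Wn by simp
  then have finT: "finite T" by (rule finite_subset) simp
  define N where "N = (\<Union>v\<in>T. nb {c} v)"
  define X where "X = U - N"
  have "card N \<le> (\<Sum>v\<in>T. dg c v)"
    unfolding N_def by (rule card_UN_le[OF finT])
  then have "real (card N) \<le> (\<Sum>v\<in>T. real (dg c v))"
    by (metis of_nat_le_iff of_nat_sum)
  also have "\<dots> \<le> (\<Sum>v\<in>T. 9 / 10 * \<mu>)"
    using T by (intro sum_mono) (auto simp: W_def)
  finally have cN: "real (card N) \<le> j * (9 / 10 * \<mu>)" using T by simp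
  have "card U - card N \<le> card X"
    unfolding X_def using finT by (intro diff_card_le_card_Diff) (auto simp: N_def)
  moreover have "card {..<n} - card U \<le> card ({..<n} - U)"
    using finite_subset[OF U_subset] by (intro diff_card_le_card_Diff) auto
  ultimately have cX: "real (card X) \<ge> m * \<mu> - 310.9 * s * \<mu>"
    using compl_U cN \<mu> by (simp add: j_def mult.commute)
  have XU: "X \<subseteq> U" by (auto simp: X_def)
  have Xn: "X \<subseteq> {..<n}" using XU U_subset by simp
  have D': "dg c w \<le> (1 + \<delta>) * \<mu>" if "w \<in> X" for w using that XU by (auto simp: U_def)
  have "real (r - j) = real m + 1 - 311 * s" using jm r_eq by (simp add: j_def of_nat_diff)
  then have rj: "real (r - j) = (real m - 311 * s) + 1" by simp
  have "(r - j) * ((1 + \<delta>) * \<mu>) = (real m - 311 * s) * \<mu> + (real m - 311 * s) * \<delta> * \<mu> + (1 + \<delta>) * \<mu>"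
    unfolding rj by (simp add: algebra_simps)
  moreover have "(real m - 311 * s) * \<delta> * \<mu> \<le> \<delta> * m * \<mu>"
    using \<delta> \<mu>_pos by (intro mult_right_mono) (auto simp: algebra_simps)
  moreover have "\<delta> * m * \<mu> = \<delta> * n" using \<mu> by (simp add: mult.commute)
  moreover have "(real m - 311 * s) * \<mu> = m * \<mu> - 311 * s * \<mu>" by (simp add: algebra_simps)
  ultimately have "real (card X) + (1 + \<delta>) * \<mu> > (r - j) * ((1 + \<delta>) * \<mu>) + \<delta> * n"
    using cX \<delta>n s1 \<mu>_pos by linarith
  moreover have "card T + (r - j) \<le> B" using T jm r_eq B by simp
  moreover have "w \<notin> nb {c} v" if "v \<in> T" "w \<in> X" for v w
    using that by (auto simp: X_def N_def)
  ultimately obtain S where S: "S \<subseteq> X" "card S = r - j" "S \<inter> T = {}" "lgt (T \<union> S)"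
      and Sc: "\<forall>u\<in>S. \<forall>v\<in>T \<union> S. u \<noteq> v \<longrightarrow> f {u, v} \<notin> {c}"
    using greedy[OF T(3) Tn _ Xn _ D', of "r - j"] \<mu>_pos \<delta> by auto
  show False
  proof (rule no_c_free[OF S(4)])
    show "T \<union> S \<subseteq> {..<n}" using Tn S Xn by auto
    then have "finite S" using finite_subset by auto
    then have "card (T \<union> S) = card T + card S"
      using finT S by (intro card_Un_disjoint) auto
    then show "r \<le> card (T \<union> S)" using T S jm r_eq by simp
    show "(1 + \<delta>) * \<mu> \<le> dg a v" "(1 + \<delta>) * \<mu> \<le> dg b v" if "v \<in> T \<union> S" for v
      using that T WU S XU by (auto intro!: high_2 U_high)
    show "f {u, v} \<noteq> c" if "u \<in> T \<union> S" "v \<in> T \<union> S" "u \<noteq> v" for u v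
      using that Tc Sc by (metis Un_iff insert_commute singletonI)
  qed
qed

lemma zm: "361 * s * \<mu> \<le> z * n / 2" "50 * \<mu> \<le> z * n"
proof -
  have "361 * real s * \<mu> \<le> z * m / 2 * \<mu>"
    using s_m \<mu>_pos by (intro mult_right_mono) auto
  also have "\<dots> = z * n / 2" using \<mu> by (simp add: mult.assoc mult.commute[of \<mu>])
  finally show "361 * s * \<mu> \<le> z * n / 2" by simp
  then show "50 * \<mu> \<le> z * n" using s1 \<mu>_pos by linarith
qed

text \<open>If \<open>v\<close> had nearly full degree in \<open>a\<close>, then by
  \<open>pz\<close> its neighbors in \<open>U\<close> would leave room for \<open>p\<close> vertices
  without color \<open>c\<close>. They span a \<open>k\<close>-clique of color \<open>b\<close>, or
  a clique of color \<open>a\<close> on \<open>k - 1\<close> vertices that \<open>v\<close>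
  completes.\<close>

lemma degree_a_le:
  assumes v: "v < n"
  shows "dg a v \<le> (1 - 19 * z) * n"
proof (rule ccontr)
  assume "\<not> ?thesis"
  then have big: "dg a v > (1 - 19 * z) * n" by simp
  define X where "X = nb {a} v \<inter> U"
  have Xn: "X \<subseteq> {..<n}" and XU: "X \<subseteq> U" using U_subset by (auto simp: X_def)
  have "dg a v \<le> card X + card ({..<n} - U)"
  proof -
    have "nb {a} v \<subseteq> X \<union> ({..<n} - U)" by (auto simp: X_def nbrs_def)
    then have "dg a v \<le> card (X \<union> ({..<n} - U))"
      by (intro card_mono) (auto simp: X_def)
    then show ?thesis using card_Un_le order_trans by blast
  qed
  then have cX: "card X \<ge> n - 19 * (z * n) - 31 * s * \<mu>"
    using big compl_U by (simp add: algebra_simps)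
  \<comment> \<open>Turns \<open>pz\<close> into \<open>p \<le> (1 - 20 * z) * m\<close>; the
    difference \<open>z * n\<close> to \<open>(1 - 19 * z) * n\<close> pays for the vertices outside
    \<open>U\<close> and for lightness.\<close>
  have "1 \<le> (1 - 20 * z) * (1 + 25 * z)"
  proof -
    have "z * z \<le> z * (1 / 128)" using z by (intro mult_left_mono) auto
    then show ?thesis using z by (simp add: algebra_simps)
  qed
  then have "real p * 1 \<le> p * ((1 - 20 * z) * (1 + 25 * z))"
    by (intro mult_left_mono) auto
  also have "\<dots> = (p * (1 + 25 * z)) * (1 - 20 * z)" by (simp add: mult_ac)
  also have "\<dots> \<le> m * (1 - 20 * z)" using pz z by (intro mult_right_mono) auto
  finally have "p * ((1 + \<delta>) * \<mu>) \<le> m * (1 - 20 * z) * ((1 + \<delta>) * \<mu>)"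
    using \<mu>_pos \<delta> by (intro mult_right_mono) auto
  also have "\<dots> = (1 - 20 * z) * n + (1 - 20 * z) * (\<delta> * n)"
    unfolding \<mu>[symmetric] by (simp add: algebra_simps)
  also have "\<dots> \<le> (1 - 20 * z) * n + 1 * (\<delta> * n)"
    using z \<delta> by (intro add_left_mono mult_right_mono) auto
  finally have "real (card X) + (1 + \<delta>) * \<mu> > p * ((1 + \<delta>) * \<mu>) + \<delta> * n"
    using cX \<delta>n zm s1(2) \<mu>_pos mult_pos_pos[OF \<delta>(1) \<mu>_pos] by (simp add: algebra_simps)
  moreover have D: "dg c w \<le> (1 + \<delta>) * \<mu>" if "w \<in> X" for w using that XU by (auto simp: U_def)
  moreover have "w \<notin> nb {c} v" if "w \<in> X" for w
    using that dist by (auto simp: X_def nbrs_def)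
  ultimately obtain W where W: "W \<subseteq> X" "card W = p" "v \<notin> W" "lgt ({v} \<union> W)"
      and Wc: "\<forall>u\<in>W. \<forall>w\<in>{v} \<union> W. u \<noteq> w \<longrightarrow> f {u, w} \<notin> {c}"
    using greedy[OF light_single[OF v] _ _ Xn _ D, of p] \<mu>_pos \<delta> v B by auto
  have vW: "{v} \<union> W \<subseteq> {..<n}" using v W Xn by auto
  show False
  proof (rule partn_lst_two_colors[OF partn_p, of W f b a])
    show "finite W" "p \<le> card W" using vW finite_subset W by auto
    show "f {u, w} = b \<or> f {u, w} = a" if "u \<in> W" "w \<in> W" "u \<noteq> w" for u w
      using col[of u w] that vW Wc lt3 by auto
    show False if Q: "Q \<subseteq> W" "card Q = k" "mono_clique f b Q" for Q
    proof -
      have "(1 + \<delta>) * \<mu> \<le> dg b u" if "u \<in> Q" for u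
        using that Q W XU by (intro high_2 U_high) auto
      then show False
        using not_all_high[OF W(4) vW _ Q(2) _ Q(3)] Q(1) lt3 by auto
    qed
    show False if Q: "Q \<subseteq> W" "card Q = k - 1" "mono_clique f a Q" for Q
    proof (rule not_insert_high[OF W(4) vW _ _ Q(2) _ Q(3)])
      show "insert v Q \<subseteq> {v} \<union> W" "v \<notin> Q" "Q \<subseteq> nb {a} v" "a < 3"
        using Q W lt3 by (auto simp: X_def)
      show "(1 + \<delta>) * \<mu> \<le> dg a u" if "u \<in> Q" for u
        using that Q W XU by (intro high_2 U_high) auto
      show "0 \<le> (1 + \<delta>) * \<mu>" using \<delta> \<mu>_pos by simp
      have "real n * (1 / 2) \<le> (1 - 19 * z) * n"
        unfolding mult.commute[of _ "real n"] using z by (intro mult_left_mono) auto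
      moreover have "100 * \<mu> \<le> n" using \<mu> m1 \<mu>_pos
        by (metis mult.commute mult_right_mono less_imp_le of_nat_le_iff of_nat_numeral)
      ultimately have "2 * \<mu> \<le> dg a v" using big \<mu>_pos by linarith
      then have "(1 + \<delta>) * \<mu> * ((1 + \<delta>) * \<mu>) ^ (k - 1) \<le> dg a v * ((1 + \<delta>) * \<mu>) ^ (k - 1)"
        using \<delta> \<mu>_pos by (intro mult_right_mono high_2) auto
      then show "((1 + \<delta>) * \<mu>) ^ k \<le> dg a v * ((1 + \<delta>) * \<mu>) ^ (k - 1)"
        using k2 by (cases k) auto
    qed
  qed
qed

text \<open>Among \<open>R\<close> vertices of \<open>X\<close> some \<open>k\<close>-clique is
  monochromatic. In colors \<open>a\<close> and \<open>b\<close> it is rich by itself; in color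
  \<open>c\<close> one of its vertices is exchanged for \<open>v\<close>, whose large degree makes
  the new clique rich.\<close>

lemma no_rich_star:
  fixes x :: real
  assumes v: "v < n" and X: "X \<subseteq> nb {c} v" "\<delta> * n < card X"
    and high: "\<And>u. u \<in> X \<Longrightarrow> 2 * \<mu> \<le> dg a u" "\<And>u. u \<in> X \<Longrightarrow> 2 * \<mu> \<le> dg b u"
    and x: "\<And>u. u \<in> X \<Longrightarrow> x \<le> dg c u" "0 \<le> x"
    and rich: "((1 + \<delta>) * \<mu>) ^ k \<le> dg c v * x ^ (k - 1)"
  shows False
proof -
  have Xn: "X \<subseteq> {..<n}" using X nbrs_subset by blast
  obtain W where W: "W \<subseteq> X" "card W = R" "v \<notin> W" "lgt ({v} \<union> W)"
    using greedy_free[OF light_single[OF v] _ _ Xn X(2), of R] v B by auto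
  have vW: "{v} \<union> W \<subseteq> {..<n}" using v W Xn by auto
  show False
  proof (rule partn_lst_three_colors[OF partn_R, of W f])
    show "finite W" "R \<le> card W" using vW finite_subset W by auto
    show "f {u, w} < 3" if "u \<in> W" "w \<in> W" "u \<noteq> w" for u w
      using that vW by (intro col) auto
    show False if Q: "d < 3" "Q \<subseteq> W" "card Q = k" "mono_clique f d Q" for d Q
    proof (cases "d = c")
      case False
      have "(1 + \<delta>) * \<mu> \<le> dg d u" if "u \<in> Q" for u
        using that Q W False lt3 high by (intro high_2) auto
      then show False
        using not_all_high[OF W(4) vW _ Q(3,1,4)] Q(2) by auto
    next
      case True
      obtain P where P: "P \<subseteq> Q" "card P = k - 1"
        using obtain_subset_with_card_n[of "k - 1" Q] Q by (metis diff_le_self)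
      show False
      proof (rule not_insert_high[OF W(4) vW _ _ P(2) _ _ _ x(1) x(2)])
        show "insert v P \<subseteq> {v} \<union> W" "v \<notin> P" "P \<subseteq> nb {c} v" "c < 3"
          using P Q W X lt3 by auto
        show "mono_clique f c P" using P Q True mono_clique_subset by blast
        show "u \<in> X" if "u \<in> P" for u using that P Q W by auto
      qed (rule rich)
    qed
  qed
qed

text \<open>A first crude bound. All but few neighbors have degree at least
  \<open>9 / 10 * \<mu>\<close> in \<open>c\<close>; the loss \<open>(9 / 10) ^ (k - 1)\<close> is
  outweighed by the degree of \<open>v\<close>, which exceeds \<open>\<mu>\<close> by the factor
  \<open>10 * z * m\<close>. This is the purpose of \<open>zk\<close>.\<close>

lemma degree_c_le:
  assumes v: "v < n"
  shows "dg c v \<le> 10 * z * n"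
proof (rule ccontr)
  assume "\<not> ?thesis"
  then have big: "dg c v > 10 * z * n" by simp
  define X where "X = (nb {c} v \<inter> U) - {u \<in> U. dg c u < 9 / 10 * \<mu>}"
  have "dg c v \<le> card X + (card ({..<n} - U) + card {u \<in> U. dg c u < 9 / 10 * \<mu>})"
  proof -
    have "nb {c} v \<subseteq> X \<union> (({..<n} - U) \<union> {u \<in> U. dg c u < 9 / 10 * \<mu>})"
      by (auto simp: X_def nbrs_def)
    then have "dg c v \<le> card (X \<union> (({..<n} - U) \<union> {u \<in> U. dg c u < 9 / 10 * \<mu>}))"
      using finite_subset[OF U_subset] by (intro card_mono) (auto simp: X_def)
    also have "\<dots> \<le> card X + (card ({..<n} - U) + card {u \<in> U. dg c u < 9 / 10 * \<mu>})"
      by (intro order_trans[OF card_Un_le] add_left_mono card_Un_le)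
    finally show ?thesis .
  qed
  then have "card X \<ge> 10 * (z * n) - 31 * s * \<mu> - 330 * s * \<mu>"
    using big compl_U low_U by (simp add: algebra_simps)
  then have cX: "\<delta> * n < card X"
    using zm \<delta>n s1 \<mu>_pos by linarith
  show False
  proof (rule no_rich_star[OF v _ cX])
    show "X \<subseteq> nb {c} v" by (auto simp: X_def)
    show "2 * \<mu> \<le> dg a u" "2 * \<mu> \<le> dg b u" "9 / 10 * \<mu> \<le> dg c u" if "u \<in> X" for u
      using that U_high by (auto simp: X_def)
    show "0 \<le> 9 / 10 * \<mu>" using \<mu>_pos by simp
    have "((1 + \<delta>) * \<mu>) ^ k = (1 + \<delta>) ^ k * \<mu> ^ k" by (rule power_mult_distrib)
    also have "\<dots> \<le> 2 * \<mu> ^ k" using \<delta> \<mu>_pos by (intro mult_right_mono) auto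
    also have "\<dots> \<le> 10 * z * m * (9 / 10) ^ (k - 1) * \<mu> ^ k"
      using zk \<mu>_pos by (intro mult_right_mono) auto
    also have "\<dots> = 10 * z * (\<mu> * m) * (9 / 10 * \<mu>) ^ (k - 1)"
      using k2 by (cases k) (auto simp: power_mult_distrib simp del: times_divide_eq_left)
    also have "\<dots> \<le> dg c v * (9 / 10 * \<mu>) ^ (k - 1)"
      using big \<mu>_pos \<mu> by (intro mult_right_mono) auto
    finally show "((1 + \<delta>) * \<mu>) ^ k \<le> dg c v * (9 / 10 * \<mu>) ^ (k - 1)" .
  qed
qed

text \<open>About \<open>19 * z * n\<close> or more edges at \<open>v\<close> avoid
  \<open>a\<close>, at most \<open>10 * z * n\<close> of them have color \<open>c\<close>, and the
  rest far exceeds \<open>2 * \<mu>\<close>.\<close>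

lemma degree_b_ge:
  assumes v: "v < n"
  shows "2 * \<mu> \<le> dg b v"
proof -
  have "real (dg a v) + dg b v + dg c v = real n - 1"
    using dg_sum[OF abc v] v by linarith
  moreover have "1 \<le> \<mu>" using \<mu>_ge by simp
  ultimately show ?thesis
    using degree_a_le[OF v] degree_c_le[OF v] zm(2) by (simp add: algebra_simps)
qed

lemma degree_a_ge:
  assumes v: "v < n"
  shows "2 * \<mu> \<le> dg a v"
proof -
  interpret sw: special_color n f lgt B \<delta> k h r s p R m z \<mu> b a c by (rule swap)
  show ?thesis using sw.degree_b_ge[OF v] .
qed

text \<open>Every vertex is now high in \<open>a\<close> and \<open>b\<close>, so at most
  \<open>\<delta> * n\<close> vertices have degree \<open>(1 + \<delta>) * \<mu>\<close> or more in
  \<open>c\<close>. If the degree of \<open>v\<close> is too small, then \<open>m\<close> vertices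
  outside its neighborhood join it to form \<open>r\<close> vertices without
  \<open>c\<close>.\<close>

lemma degree_c_ge:
  assumes v: "v < n"
  shows "(1 - 4 * m * \<delta>) * \<mu> \<le> dg c v"
proof (rule ccontr)
  assume "\<not> ?thesis"
  then have small: "dg c v < (1 - 4 * m * \<delta>) * \<mu>" by simp
  define Y where "Y = {u \<in> {..<n}. (1 + \<delta>) * \<mu> \<le> dg c u}"
  have cY: "card Y \<le> \<delta> * n"
    by (rule high_in_all_colors) (auto simp: Y_def lt3 intro: high_2 degree_a_ge degree_b_ge)
  define X where "X = {..<n} - (Y \<union> nb {c} v)"
  have Xn: "X \<subseteq> {..<n}" by (auto simp: X_def)
  have "card {..<n} - card (Y \<union> nb {c} v) \<le> card X"
    unfolding X_def by (intro diff_card_le_card_Diff) (auto simp: Y_def)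
  moreover have "card (Y \<union> nb {c} v) \<le> card Y + dg c v" by (rule card_Un_le)
  ultimately have "real (card X) \<ge> n - \<delta> * n - dg c v" using cY by simp
  moreover have "\<delta> * n = m * \<delta> * \<mu>" using \<mu> by (simp add: mult.commute)
  moreover have "real n = m * \<mu>" using \<mu> by (simp add: mult.commute)
  moreover have "0 < m * \<delta> * \<mu>" "0 < \<delta> * \<mu>" using \<delta> \<mu>_pos m1 by auto
  \<comment> \<open>Three terms \<open>m * \<delta> * \<mu>\<close> have to be covered: the set
    \<open>Y\<close>, the vertices excluded by lightness, and the excess degrees of the chosen
    vertices. The factor 4 of the claim suffices.\<close>
  ultimately have "real (card X) + (1 + \<delta>) * \<mu> > m * ((1 + \<delta>) * \<mu>) + \<delta> * n"
    using small by (simp add: algebra_simps)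
  moreover have D: "dg c w \<le> (1 + \<delta>) * \<mu>" if "w \<in> X" for w using that by (auto simp: X_def Y_def)
  moreover have "w \<notin> nb {c} v" if "w \<in> X" for w
    using that by (auto simp: X_def)
  ultimately obtain W where W: "W \<subseteq> X" "card W = m" "v \<notin> W" "lgt ({v} \<union> W)"
      and Wc: "\<forall>u\<in>W. \<forall>w\<in>{v} \<union> W. u \<noteq> w \<longrightarrow> f {u, w} \<notin> {c}"
    using greedy[OF light_single[OF v] _ _ Xn _ D, of m] \<mu>_pos \<delta> v B r_eq by auto
  show False
  proof (rule no_c_free[OF W(4)])
    show vW: "{v} \<union> W \<subseteq> {..<n}" using v W Xn by auto
    then have "finite W" using finite_subset by auto
    then show "r \<le> card ({v} \<union> W)" using W r_eq by simp
    show "(1 + \<delta>) * \<mu> \<le> dg a u" "(1 + \<delta>) * \<mu> \<le> dg b u" if "u \<in> {v} \<union> W" for u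
      using that vW by (auto intro!: high_2 degree_a_ge degree_b_ge)
    show "f {u, w} \<noteq> c" if "u \<in> {v} \<union> W" "w \<in> {v} \<union> W" "u \<noteq> w" for u w
      using that Wc by (metis Un_iff insert_commute singletonD singletonI)
  qed
qed

text \<open>The star argument again, now with the sharp lower bound for all neighbors, so that the
  product loses only about \<open>4 * k * m * \<delta>\<close>; the factor 32 leaves room.\<close>

lemma degree_c_le':
  assumes v: "v < n"
  shows "dg c v \<le> (1 + 32 * k * m * \<delta>) * \<mu>"
proof (rule ccontr)
  assume "\<not> ?thesis"
  then have big: "dg c v > (1 + 32 * k * m * \<delta>) * \<mu>" by simp
  define e where "e = k * m * \<delta>"
  have e: "0 \<le> e" "e \<le> 1 / 1000" using \<delta>km \<delta> by (auto simp: e_def)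
  have me: "m * \<delta> \<le> e"
  proof -
    have "1 * (m * \<delta>) \<le> k * (m * \<delta>)" using k2 \<delta> by (intro mult_right_mono) auto
    then show ?thesis by (simp add: e_def mult_ac)
  qed
  show False
  proof (rule no_rich_star[OF v order_refl, where x = "(1 - 4 * m * \<delta>) * \<mu>"])
    have "1 * \<mu> \<le> (1 + 32 * k * m * \<delta>) * \<mu>" using \<mu>_pos \<delta> by (intro mult_right_mono) auto
    then show "\<delta> * n < dg c v" using big \<delta>n \<mu>_pos by linarith
    show "2 * \<mu> \<le> dg a u" "2 * \<mu> \<le> dg b u" "(1 - 4 * m * \<delta>) * \<mu> \<le> dg c u" if "u \<in> nb {c} v" for u
      using that degree_a_ge degree_b_ge degree_c_ge nbrs_subset by blast+
    show "0 \<le> (1 - 4 * m * \<delta>) * \<mu>" using me e \<mu>_pos by simp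
    have "k * \<delta> * 1 \<le> k * \<delta> * m"
      using \<delta> m1 by (intro mult_left_mono) auto
    then have "(1 + \<delta>) ^ k \<le> 1 + 2 * e" using power_\<delta> by (simp add: e_def mult_ac)
    also have "\<dots> \<le> (1 + 32 * e) * (1 - 4 * e)"
    proof -
      have "e * e \<le> e * (1 / 1000)" using e by (intro mult_left_mono) auto
      then show ?thesis using e by (simp add: algebra_simps)
    qed
    also have "\<dots> \<le> (1 + 32 * e) * (1 - 4 * m * \<delta>) ^ (k - 1)"
    proof (intro mult_left_mono)
      have "1 + real (k - 1) * (- (4 * m * \<delta>)) \<le> (1 + (- (4 * m * \<delta>))) ^ (k - 1)"
        using me e by (intro Bernoulli_inequality) auto
      moreover have "real (k - 1) * (4 * m * \<delta>) \<le> k * (4 * m * \<delta>)"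
        using \<delta> by (intro mult_right_mono) auto
      ultimately show "1 - 4 * e \<le> (1 - 4 * m * \<delta>) ^ (k - 1)" by (simp add: e_def)
    qed (use e in auto)
    finally have "(1 + \<delta>) ^ k * \<mu> ^ k \<le> (1 + 32 * e) * (1 - 4 * m * \<delta>) ^ (k - 1) * \<mu> ^ k"
      using \<mu>_pos by (intro mult_right_mono) auto
    also have "\<dots> = ((1 + 32 * e) * \<mu>) * ((1 - 4 * m * \<delta>) * \<mu>) ^ (k - 1)"
      using k2 by (cases k) (auto simp: power_mult_distrib)
    also have "\<dots> \<le> dg c v * ((1 - 4 * m * \<delta>) * \<mu>) ^ (k - 1)"
      using big me e \<mu>_pos by (intro mult_right_mono) (auto simp: e_def mult_ac)
    finally show "((1 + \<delta>) * \<mu>) ^ k \<le> dg c v * ((1 - 4 * m * \<delta>) * \<mu>) ^ (k - 1)"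
      by (simp add: power_mult_distrib)
  qed
qed

end

context ramsey_light
begin

text \<open>By \<open>two_classes\<close> two of the three classes \<open>low_in\<close> are small;
  the remaining color is the special one.\<close>

theorem special_color_degrees:
  obtains a b c where "{a, b, c} = {..<3::nat}" "a \<noteq> b" "b \<noteq> c" "a \<noteq> c"
    "\<And>v. v < n \<Longrightarrow> 2 * \<mu> \<le> dg a v" "\<And>v. v < n \<Longrightarrow> 2 * \<mu> \<le> dg b v"
    "\<And>v. v < n \<Longrightarrow> (1 - 4 * m * \<delta>) * \<mu> \<le> dg c v"
    "\<And>v. v < n \<Longrightarrow> dg c v \<le> (1 + 32 * k * m * \<delta>) * \<mu>"
proof -
  note th = that
  have ex: thesis if abc: "{a, b, c} = {..<3}" "a \<noteq> b" "b \<noteq> c" "a \<noteq> c"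
    and "card (low_in a) < 9 * s * \<mu>" "card (low_in b) < 9 * s * \<mu>" for a b c
  proof -
    interpret special_color n f lgt B \<delta> k h r s p R m z \<mu> a b c
      using that compl_low_in[OF abc(1)] by unfold_locales auto
    show thesis
      by (rule th[OF abc]) (fact dist degree_a_ge degree_b_ge degree_c_ge degree_c_le' abc)+
  qed
  have 3: "{..<3} = {0, 1, 2::nat}" by auto
  have "card (low_in 0) < 9 * s * \<mu> \<or> card (low_in 1) < 9 * s * \<mu>"
    "card (low_in 0) < 9 * s * \<mu> \<or> card (low_in 2) < 9 * s * \<mu>"
    "card (low_in 1) < 9 * s * \<mu> \<or> card (low_in 2) < 9 * s * \<mu>"
    by (rule two_classes[of _ _ 2] two_classes[of _ _ 1] two_classes[of _ _ 0]; auto simp: 3)+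
  then show thesis
    using ex[of 0 1 2] ex[of 0 2 1] ex[of 1 2 0] by (auto simp: 3)
qed

end

subsection \<open>Partition into cliques of the special color\<close>

lemma sum_card_swap:
  assumes "finite A" "finite B"
  shows "(\<Sum>x\<in>A. card {y \<in> B. P x y}) = (\<Sum>y\<in>B. card {x \<in> A. P x y})"
proof -
  have "(\<Sum>x\<in>A. card {y \<in> B. P x y}) = (\<Sum>x\<in>A. \<Sum>y\<in>B. if P x y then 1 else 0)"
    using assms by (intro sum.cong) (auto simp: sum.If_cases Int_def)
  also have "\<dots> = (\<Sum>y\<in>B. \<Sum>x\<in>A. if P x y then 1 else 0)"
    by (rule sum.swap)
  also have "\<dots> = (\<Sum>y\<in>B. card {x \<in> A. P x y})"
    using assms by (intro sum.cong) (auto simp: sum.If_cases Int_def)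
  finally show ?thesis .
qed

text \<open>Here no light set contains any \<open>k\<close>-clique of a color other than
  \<open>c\<close>, whatever its degrees, and a pair is light unless its color is \<open>c\<close>:
  the greedy choice now starts from such an edge.\<close>

locale light_pairs = light_family n f lgt B \<delta>
  for n :: nat and f :: "nat set \<Rightarrow> nat" and lgt :: "nat set \<Rightarrow> bool" and B :: nat and \<delta> :: real +
  fixes k r m a b c :: nat and \<mu> e :: real
  assumes abc: "{a, b, c} = {..<3}"
    and partn_r: "partn_lst {..<r} [k, k] 2"
    and r_eq: "r = Suc m" and B: "r \<le> B" and m1: "100 \<le> m"
    and \<mu>: "\<mu> * m = n" and \<mu>_ge: "100 \<le> \<mu>"
    and e: "0 < e" "\<delta> * m \<le> e" "128 * real r ^ 4 * e \<le> 1"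
    and light_pair: "\<And>u v. u < n \<Longrightarrow> v < n \<Longrightarrow> u \<noteq> v \<Longrightarrow> f {u, v} \<noteq> c \<Longrightarrow> lgt {u, v}"
    and no_mono: "\<And>T Q d. lgt T \<Longrightarrow> T \<subseteq> {..<n} \<Longrightarrow> Q \<subseteq> T \<Longrightarrow> card Q = k \<Longrightarrow> d < 3 \<Longrightarrow> d \<noteq> c \<Longrightarrow>
        \<not> mono_clique f d Q"
    and ac: "a \<noteq> c" "b \<noteq> c"
    and dg_ge: "\<And>v. v < n \<Longrightarrow> (1 - e) * \<mu> \<le> dg c v"
    and dg_le: "\<And>v. v < n \<Longrightarrow> dg c v \<le> (1 + e) * \<mu>"
begin

abbreviation N :: "nat \<Rightarrow> nat set" where "N \<equiv> nb {c}"

definition ov :: "nat \<Rightarrow> nat \<Rightarrow> nat" where "ov u v = card (N u \<inter> N v)"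

lemma \<mu>_pos: "0 < \<mu>" using \<mu>_ge by simp

lemma N_lt: "u \<in> N v \<Longrightarrow> u < n" by (auto simp: nbrs_def)

lemma ov_sym: "ov u v = ov v u" by (simp add: ov_def Int_commute)

text \<open>Overlapping neighborhoods exclude fewer candidates. With a large overlap
  \<open>m - 1\<close> further vertices fit, which together with \<open>u\<close> and
  \<open>v\<close> are \<open>r\<close> vertices without color \<open>c\<close>.\<close>

lemma ov_light:
  assumes uv: "u < n" "v < n" "u \<noteq> v" "f {u, v} \<noteq> c"
  shows "ov u v \<le> 2 * m * e * \<mu>"
proof (rule ccontr)
  assume "\<not> ?thesis"
  then have big: "ov u v > 2 * m * e * \<mu>" by simp
  define X where "X = {..<n} - (N u \<union> N v)"
  have Xn: "X \<subseteq> {..<n}" by (auto simp: X_def)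
  have "card {..<n} - card (N u \<union> N v) \<le> card X"
    unfolding X_def by (intro diff_card_le_card_Diff) auto
  moreover have "card (N u \<union> N v) + ov u v = dg c u + dg c v"
    unfolding ov_def by (intro card_Un_Int[symmetric]) auto
  ultimately have "real (card X) \<ge> real n - (real (dg c u) + dg c v) + ov u v"
    unfolding card_lessThan by linarith
  moreover have "real (dg c u) + dg c v \<le> (1 + e) * \<mu> + (1 + e) * \<mu>"
    using dg_le[OF uv(1)] dg_le[OF uv(2)] by linarith
  moreover have "real n = m * \<mu>" using \<mu> by (simp add: mult.commute)
  ultimately have cX: "real (card X) > m * \<mu> - 2 * (1 + e) * \<mu> + 2 * m * e * \<mu>"
    using big by (simp add: algebra_simps)
  have "\<delta> * n = \<delta> * m * \<mu>" using \<mu> by (simp add: mult.commute)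
  also have "\<dots> \<le> e * \<mu>" using e \<mu>_pos by (intro mult_right_mono) auto
  finally have "\<delta> * n \<le> e * \<mu>" .
  moreover have "e * \<mu> * 1 \<le> e * \<mu> * m" using e \<mu>_pos m1 by (intro mult_left_mono) auto
  moreover have "real (m - 1) = real m - 1" using m1 by simp
  then have "(m - 1) * ((1 + e) * \<mu>) = m * \<mu> + m * e * \<mu> - (1 + e) * \<mu>"
    by (simp add: algebra_simps)
  ultimately have "real (card X) + (1 + e) * \<mu> > (m - 1) * ((1 + e) * \<mu>) + \<delta> * n"
    using cX by (simp add: algebra_simps)
  moreover have D: "dg c w \<le> (1 + e) * \<mu>" if "w \<in> X" for w using that Xn by (intro dg_le) auto
  moreover have "w \<notin> N x" if "x \<in> {u, v}" "w \<in> X" for w x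
    using that by (auto simp: X_def)
  moreover have "{u, v} \<subseteq> {..<n}" "card {u, v} + (m - 1) \<le> B" "0 \<le> (1 + e) * \<mu>"
    using uv B r_eq m1 e \<mu>_pos by auto
  ultimately obtain W where W: "W \<subseteq> X" "card W = m - 1" "W \<inter> {u, v} = {}" "lgt ({u, v} \<union> W)"
      and Wc: "\<forall>x\<in>W. \<forall>w\<in>{u, v} \<union> W. x \<noteq> w \<longrightarrow> f {x, w} \<notin> {c}"
    using greedy[OF light_pair[OF uv] _ _ Xn _ D, of "m - 1"] by blast
  define Z where "Z = {u, v} \<union> W"
  have Zn: "Z \<subseteq> {..<n}" using uv W Xn by (auto simp: Z_def)
  then have fin: "finite Z" using finite_subset by blast
  have "card Z = card {u, v} + card W"
    unfolding Z_def using fin W by (intro card_Un_disjoint) (auto simp: Z_def)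
  then have cZ: "r \<le> card Z" using W uv r_eq m1 by simp
  have free: "f {x, w} \<noteq> c" if "x \<in> Z" "w \<in> Z" "x \<noteq> w" for x w
  proof (cases "x \<in> W \<or> w \<in> W")
    case True
    then show ?thesis using Wc that by (auto simp: Z_def insert_commute)
  next
    case False
    then have "{x, w} = {u, v}" using that by (auto simp: Z_def)
    then show ?thesis using uv by simp
  qed
  have lt3: "x < 3 \<longleftrightarrow> x = a \<or> x = b \<or> x = c" for x
    using abc by (metis insert_iff lessThan_iff singletonD)
  show False
  proof (rule partn_lst_two_colors[OF partn_r fin cZ, of f a b])
    show "f {x, w} = a \<or> f {x, w} = b" if "x \<in> Z" "w \<in> Z" "x \<noteq> w" for x w
      using free[OF that] col[of x w] that Zn lt3 by blast
    show False if "Q \<subseteq> Z" "card Q = k" "mono_clique f a Q" for Q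
      using no_mono[of Z Q a] W Zn that lt3 ac by (auto simp: Z_def)
    show False if "Q \<subseteq> Z" "card Q = k" "mono_clique f b Q" for Q
      using no_mono[of Z Q b] W Zn that lt3 ac by (auto simp: Z_def)
  qed
qed

definition out :: "nat \<Rightarrow> nat \<Rightarrow> nat" where "out v x = card (N x - insert v (N v))"

text \<open>Pairs of color \<open>c\<close> between \<open>N v\<close> and the outside are counted
  from their outer end \<open>w\<close>, to which \<open>ov_light\<close> applies because
  \<open>w\<close> and \<open>v\<close> are not joined by \<open>c\<close>.\<close>

lemma sum_out:
  assumes "v < n"
  shows "(\<Sum>x\<in>N v. real (out v x)) \<le> n * (2 * m * e * \<mu>)"
proof -
  define Y where "Y = {..<n} - insert v (N v)"
  have "(\<Sum>x\<in>N v. out v x) = (\<Sum>x\<in>N v. card {w \<in> Y. w \<in> N x})"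
    unfolding out_def Y_def
    by (intro sum.cong refl arg_cong[of _ _ card]) (auto simp: nbrs_def)
  also have "\<dots> = (\<Sum>w\<in>Y. card {x \<in> N v. w \<in> N x})"
    by (rule sum_card_swap) (auto simp: Y_def)
  also have "\<dots> = (\<Sum>w\<in>Y. ov w v)"
    unfolding ov_def Y_def
    by (intro sum.cong refl arg_cong[of _ _ card]) (auto simp: nbrs_def insert_commute)
  finally have "(\<Sum>x\<in>N v. real (out v x)) = (\<Sum>w\<in>Y. real (ov w v))"
    by (metis of_nat_sum)
  also have "\<dots> \<le> (\<Sum>w\<in>Y. 2 * m * e * \<mu>)"
  proof (intro sum_mono)
    fix w assume "w \<in> Y"
    then have "w < n" "w \<noteq> v" "f {w, v} \<noteq> c"
      by (auto simp: Y_def nbrs_def insert_commute)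
    then show "ov w v \<le> 2 * m * e * \<mu>" using assms by (intro ov_light) auto
  qed
  also have "\<dots> = card Y * (2 * m * e * \<mu>)" by simp
  also have "card Y \<le> card {..<n}" unfolding Y_def by (intro card_mono) auto
  then have "card Y * (2 * m * e * \<mu>) \<le> n * (2 * m * e * \<mu>)"
    using e \<mu>_pos by (intro mult_right_mono) auto
  finally show ?thesis .
qed

lemma re: "real r * e \<le> 1 / 128" "e \<le> 1 / 128" "4 * real r ^ 3 * e < 1" "real r ^ 4 * e \<le> 1 / 128"
proof -
  have r: "1 \<le> real r" using r_eq by simp
  show 4: "real r ^ 4 * e \<le> 1 / 128" using e by simp
  have "real r ^ 1 * e \<le> real r ^ 4 * e" using e r by (intro mult_right_mono power_increasing) auto
  then show "real r * e \<le> 1 / 128" using 4 by simp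
  have "1 * e \<le> real r * e" using e r by (intro mult_right_mono) auto
  then show "e \<le> 1 / 128" using \<open>real r * e \<le> 1 / 128\<close> by simp
  have "real r ^ 3 * e \<le> real r ^ 4 * e" using e r by (intro mult_right_mono power_increasing) auto
  then show "4 * real r ^ 3 * e < 1" using 4 by simp
qed

text \<open>Overlaps are either tiny or nearly complete: a common neighbor sends almost all of its
  edges of color \<open>c\<close> into both neighborhoods.\<close>

lemma ov_dichotomy:
  assumes uv: "u < n" "v < n" and ov: "\<mu> / (2 * r ^ 2) \<le> ov u v"
  shows "7 / 8 * \<mu> \<le> ov u v"
proof -
  define I where "I = N u \<inter> N v"
  \<comment> \<open>Otherwise the sum over \<open>I\<close> would be at least
    \<open>\<mu> * \<mu> / (32 * r ^ 2)\<close>, while \<open>sum_out\<close> bounds it by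
    \<open>4 * m ^ 2 * e * \<mu> * \<mu>\<close>. The assumption on \<open>128 * r ^ 4 * e\<close>
    is made to exclude this.\<close>
  have "\<exists>x\<in>I. out u x + out v x \<le> \<mu> / 16"
  proof (rule ccontr)
    assume "\<not> ?thesis"
    then have "(\<Sum>x\<in>I. \<mu> / 16) \<le> (\<Sum>x\<in>I. real (out u x) + out v x)"
      by (intro sum_mono) (auto simp: not_le less_imp_le)
    also have "\<dots> = (\<Sum>x\<in>I. real (out u x)) + (\<Sum>x\<in>I. real (out v x))" by (rule sum.distrib)
    also have "\<dots> \<le> (\<Sum>x\<in>N u. real (out u x)) + (\<Sum>x\<in>N v. real (out v x))"
      by (intro add_mono sum_mono2) (auto simp: I_def)
    also have "\<dots> \<le> n * (2 * m * e * \<mu>) + n * (2 * m * e * \<mu>)"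
      using uv by (intro add_mono sum_out)
    finally have le: "ov u v * (\<mu> / 16) \<le> 4 * n * m * e * \<mu>"
      by (simp add: I_def ov_def mult_ac)
    have "\<mu> / (2 * r ^ 2) * (\<mu> / 16) \<le> ov u v * (\<mu> / 16)"
      using ov \<mu>_pos by (intro mult_right_mono) auto
    also note le
    also have "4 * n * m * e * \<mu> = 4 * (\<mu> * m) * m * e * \<mu>" by (simp add: \<mu>)
    finally have "\<mu> * \<mu> / (32 * r ^ 2) \<le> \<mu> * \<mu> * (4 * m ^ 2 * e)"
      by (simp add: power2_eq_square mult_ac)
    then have "\<mu> * \<mu> * (1 / (32 * r ^ 2)) \<le> \<mu> * \<mu> * (4 * m ^ 2 * e)" by simp
    then have "1 / (32 * r ^ 2) \<le> 4 * real m ^ 2 * e"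
      using \<mu>_pos by (subst (asm) mult_le_cancel_left) auto
    then have "1 \<le> 128 * (real r ^ 2 * real m ^ 2 * e)"
      using r_eq by (simp add: field_simps)
    also have "\<dots> < 128 * (real r ^ 2 * real r ^ 2 * e)"
      using r_eq m1 e by (intro mult_strict_left_mono mult_strict_right_mono power_strict_mono) auto
    also have "\<dots> = 128 * real r ^ 4 * e" by (simp add: eval_nat_numeral)
    finally show False using e by simp
  qed
  then obtain x where x: "x \<in> N u" "x \<in> N v" "out u x + out v x \<le> \<mu> / 16"
    by (auto simp: I_def)
  have "N x \<subseteq> I \<union> ({u, v} \<union> ((N x - insert u (N u)) \<union> (N x - insert v (N v))))"
    by (auto simp: I_def)
  then have "dg c x \<le> card (I \<union> ({u, v} \<union> ((N x - insert u (N u)) \<union> (N x - insert v (N v)))))"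
    by (intro card_mono) (auto simp: I_def)
  also have "\<dots> \<le> card I + (card {u, v} + (out u x + out v x))"
    unfolding out_def by (intro order_trans[OF card_Un_le] add_mono order_refl)
  also have "card {u, v} \<le> 2" by (simp add: card_insert_if)
  finally have "dg c x \<le> ov u v + 2 + (out u x + out v x)" by (simp add: I_def ov_def)
  moreover have "(1 - e) * \<mu> \<le> dg c x" using x N_lt by (intro dg_ge)
  moreover have "e * \<mu> \<le> 1 / 128 * \<mu>" using re \<mu>_pos by (intro mult_right_mono) auto
  ultimately show ?thesis using x(3) \<mu>_ge unfolding left_diff_distrib by linarith
qed

text \<open>The threshold is low enough to be summed over \<open>r\<close> vertices in
  \<open>card_independent\<close>; by \<open>ov_dichotomy\<close> it is equivalent to one near
  \<open>\<mu>\<close>, which gives transitivity.\<close>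

definition same :: "(nat \<times> nat) set" where
  "same = {(u, v). u < n \<and> v < n \<and> \<mu> / (2 * r ^ 2) \<le> ov u v}"

lemma \<theta>_le: "\<mu> / (2 * r ^ 2) \<le> \<mu> / 2"
proof -
  have "1 \<le> real r ^ 2" using r_eq by simp
  then show ?thesis using \<mu>_pos using r_eq by (intro divide_left_mono) auto
qed

lemma equiv_same: "equiv {..<n} same"
proof (rule equivI)
  show "same \<subseteq> {..<n} \<times> {..<n}" by (auto simp: same_def)
  show "refl_on {..<n} same"
  proof (rule refl_onI)
    fix v assume "v \<in> {..<n}"
    then have v: "v < n" by simp
    have "e * \<mu> \<le> 1 / 128 * \<mu>" using re \<mu>_pos by (intro mult_right_mono) auto
    then have "\<mu> / 2 \<le> ov v v"
      using dg_ge[OF v] \<mu>_pos unfolding ov_def Int_absorb left_diff_distrib by linarith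
    then show "(v, v) \<in> same" using v \<theta>_le by (auto simp: same_def)
  qed
  show "sym same" by (auto simp: sym_def same_def ov_sym)
  \<comment> \<open>Two parts of \<open>N v\<close> with \<open>7 / 8 * \<mu>\<close> elements each
    overlap in about \<open>3 / 4 * \<mu>\<close>, since \<open>N v\<close> has hardly more than
    \<open>\<mu>\<close> elements.\<close>
  show "trans same"
  proof (rule transI)
    fix u v w assume "(u, v) \<in> same" "(v, w) \<in> same"
    then have uvw: "u < n" "v < n" "w < n" and "\<mu> / (2 * r ^ 2) \<le> ov u v" "\<mu> / (2 * r ^ 2) \<le> ov v w"
      by (auto simp: same_def)
    then have o: "7 / 8 * \<mu> \<le> ov u v" "7 / 8 * \<mu> \<le> ov v w" by (blast intro: ov_dichotomy)+
    have "ov u v + ov v w = card ((N u \<inter> N v) \<union> (N v \<inter> N w)) + card ((N u \<inter> N v) \<inter> (N v \<inter> N w))"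
      unfolding ov_def by (intro card_Un_Int) auto
    moreover have "card ((N u \<inter> N v) \<union> (N v \<inter> N w)) \<le> dg c v"
      "card ((N u \<inter> N v) \<inter> (N v \<inter> N w)) \<le> ov u w"
      unfolding ov_def by (intro card_mono; auto)+
    ultimately have "ov u v + ov v w \<le> dg c v + ov u w" by linarith
    moreover have "dg c v \<le> (1 + e) * \<mu>" using uvw by (intro dg_le)
    moreover have "e * \<mu> \<le> 1 / 128 * \<mu>" using re \<mu>_pos by (intro mult_right_mono) auto
    ultimately have "\<mu> / 2 \<le> ov u w" using o by (simp add: algebra_simps)
    then show "(u, w) \<in> same" using uvw \<theta>_le by (auto simp: same_def)
  qed
qed

lemma same_color:
  assumes "(u, v) \<in> same" "u \<noteq> v"
  shows "f {u, v} = c"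
proof (rule ccontr)
  assume "f {u, v} \<noteq> c"
  then have "ov u v \<le> 2 * m * e * \<mu>" using assms by (intro ov_light) (auto simp: same_def)
  then have "\<mu> * (1 / (2 * r ^ 2)) \<le> \<mu> * (2 * m * e)"
    using assms by (simp add: same_def mult_ac)
  then have "1 / (2 * r ^ 2) \<le> 2 * m * e" using \<mu>_pos by (subst (asm) mult_le_cancel_left) auto
  then have "1 \<le> 4 * (real r ^ 2 * m * e)" using r_eq by (simp add: field_simps)
  also have "\<dots> \<le> 4 * (real r ^ 2 * r * e)"
    using r_eq e by (intro mult_left_mono mult_right_mono) auto
  also have "\<dots> = 4 * real r ^ 3 * e" by (simp add: eval_nat_numeral)
  finally show False using re by simp
qed

text \<open>The neighborhoods of \<open>r\<close> such vertices are disjoint after removing at most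
  \<open>\<mu> / 2\<close> elements in total, and each has nearly \<open>\<mu>\<close> elements:
  together more than \<open>m * \<mu>\<close>, which is \<open>n\<close>.\<close>

lemma card_independent:
  assumes P: "P \<subseteq> {..<n}" and indep: "\<And>u v. u \<in> P \<Longrightarrow> v \<in> P \<Longrightarrow> u \<noteq> v \<Longrightarrow> (u, v) \<notin> same"
  shows "card P < r"
proof (rule ccontr)
  assume "\<not> ?thesis"
  then obtain S where S: "S \<subseteq> P" "card S = r" "finite S"
    using obtain_subset_with_card_n[of r P] by (metis not_less)
  have Sn: "S \<subseteq> {..<n}" using S P by simp
  define A where "A = (\<lambda>v. N v - (\<Union>u\<in>S - {v}. N u \<inter> N v))"
  have "card (\<Union>v\<in>S. A v) = (\<Sum>v\<in>S. card (A v))"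
    using S(3) by (intro card_UN_disjoint) (auto simp: A_def)
  moreover have "(\<Union>v\<in>S. A v) \<subseteq> {..<n}" by (auto simp: A_def nbrs_def)
  then have "card (\<Union>v\<in>S. A v) \<le> card {..<n}" by (intro card_mono) auto
  ultimately have "(\<Sum>v\<in>S. card (A v)) \<le> n" by simp
  then have "(\<Sum>v\<in>S. real (card (A v))) \<le> n" by (metis of_nat_le_iff of_nat_sum)
  moreover have "(\<Sum>v\<in>S. (1 - e) * \<mu> - \<mu> / (2 * r)) \<le> (\<Sum>v\<in>S. real (card (A v)))"
  proof (intro sum_mono)
    fix v assume v: "v \<in> S"
    have "card (\<Union>u\<in>S - {v}. N u \<inter> N v) \<le> (\<Sum>u\<in>S - {v}. ov u v)"
      unfolding ov_def using S by (intro card_UN_le) auto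
    then have "real (card (\<Union>u\<in>S - {v}. N u \<inter> N v)) \<le> (\<Sum>u\<in>S - {v}. real (ov u v))"
      by (metis of_nat_le_iff of_nat_sum)
    also have "\<dots> \<le> (\<Sum>u\<in>S - {v}. \<mu> / (2 * r ^ 2))"
    proof (intro sum_mono)
      fix u assume "u \<in> S - {v}"
      then have "u \<in> P" "v \<in> P" "u \<noteq> v" using S(1) v by auto
      then have "(u, v) \<notin> same" "u < n" "v < n" using indep P by auto
      then show "ov u v \<le> \<mu> / (2 * r ^ 2)" by (auto simp: same_def)
    qed
    also have "\<dots> \<le> r * (\<mu> / (2 * r ^ 2))"
      unfolding sum_constant using S v \<mu>_pos by (intro mult_right_mono) auto
    also have "\<dots> = \<mu> / (2 * r)" by (simp add: power2_eq_square)
    finally have "real (card (\<Union>u\<in>S - {v}. N u \<inter> N v)) \<le> \<mu> / (2 * r)" .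
    moreover have "dg c v - card (\<Union>u\<in>S - {v}. N u \<inter> N v) \<le> card (A v)"
      unfolding A_def using S by (intro diff_card_le_card_Diff) auto
    moreover have "(1 - e) * \<mu> \<le> dg c v" using v Sn by (intro dg_ge) auto
    ultimately show "(1 - e) * \<mu> - \<mu> / (2 * r) \<le> card (A v)" by linarith
  qed
  ultimately have "r * ((1 - e) * \<mu> - \<mu> / (2 * r)) \<le> n" using S by simp
  moreover have "r * ((1 - e) * \<mu> - \<mu> / (2 * r)) = (r - r * e - 1 / 2) * \<mu>"
    using r_eq by (simp add: field_simps)
  moreover have "real n = m * \<mu>" using \<mu> by (simp add: mult.commute)
  ultimately have "r - r * e - 1 / 2 \<le> m" using \<mu>_pos by simp
  then show False using re r_eq by simp
qed

theorem clique_partition: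
  obtains A where "disjoint_family_on A {..<m}" "(\<Union>i<m. A i) = {..<n}"
    "\<And>i. i < m \<Longrightarrow> mono_clique f c (A i)"
proof -
  define Q where "Q = {..<n} // same"
  have fin: "finite Q" unfolding Q_def using equiv_same
    by (simp add: finite_quotient equiv_def same_def refl_on_def)
  have "card Q < r"
  proof -
    define rep where "rep = (\<lambda>C :: nat set. SOME v. v \<in> C)"
    have rep: "rep C \<in> C" if "C \<in> Q" for C
      unfolding rep_def using that in_quotient_imp_non_empty[OF equiv_same]
      by (metis Q_def ex_in_conv someI_ex)
    have sub: "C \<subseteq> {..<n}" if "C \<in> Q" for C
      using that in_quotient_imp_subset[OF equiv_same] by (simp add: Q_def)
    have ns: "C = D" if "C \<in> Q" "D \<in> Q" "(rep C, rep D) \<in> same" for C D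
      using quotient_eqI[OF equiv_same _ _ rep rep] that by (simp add: Q_def)
    have "inj_on rep Q"
    proof (rule inj_onI)
      fix C D assume CD: "C \<in> Q" "D \<in> Q" "rep C = rep D"
      then have "(rep C, rep D) \<in> same"
        using equiv_same rep[OF CD(1)] sub[OF CD(1)] by (auto simp: equiv_def refl_on_def)
      then show "C = D" using ns CD by blast
    qed
    then have "card Q = card (rep ` Q)" by (simp add: card_image)
    also have "\<dots> < r"
      by (rule card_independent) (use rep sub ns in blast)+
    finally show ?thesis .
  qed
  then have cQ: "card Q \<le> m" using r_eq by simp
  obtain h where h: "bij_betw h {..<card Q} Q"
    using bij_betw_from_nat_into_finite[OF fin] by blast
  then have inj: "inj_on h {..<card Q}" and im: "h ` {..<card Q} = Q" by (auto simp: bij_betw_def)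
  \<comment> \<open>There may be fewer than \<open>m\<close> classes; the remaining indices get the
    empty set.\<close>
  define A where "A = (\<lambda>i. if i < card Q then h i else {})"
  have AQ: "A i \<in> Q" if "i < card Q" for i using im that by (auto simp: A_def)
  show thesis
  proof
    show "disjoint_family_on A {..<m}"
    proof (unfold disjoint_family_on_def, intro ballI impI)
      fix i j assume ij: "i \<in> {..<m}" "j \<in> {..<m}" "i \<noteq> j"
      show "A i \<inter> A j = {}"
      proof (cases "i < card Q \<and> j < card Q")
        case True
        then have "A i \<noteq> A j" using inj ij by (auto simp: A_def dest: inj_onD)
        then show ?thesis
          using quotient_disj[OF equiv_same] AQ True unfolding Q_def by blast
      qed (auto simp: A_def)
    qed
    have "(\<Union>i<m. A i) = (\<Union>i<card Q. h i)"
      using cQ by (force simp: A_def split: if_splits)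
    also have "\<dots> = \<Union>Q" using im by auto
    also have "\<dots> = {..<n}" unfolding Q_def by (rule Union_quotient[OF equiv_same])
    finally show "(\<Union>i<m. A i) = {..<n}" .
    show "mono_clique f c (A i)" if "i < m" for i
    proof (cases "i < card Q")
      case True
      show ?thesis
        unfolding mono_clique_def
      proof (intro ballI impI)
        fix u v assume "u \<in> A i" "v \<in> A i" "u \<noteq> v"
        moreover from this have "(u, v) \<in> same"
          using quotient_eq_iff[OF equiv_same, of "A i" "A i" u v] AQ[OF True] by (simp add: Q_def)
        ultimately show "f {u, v} = c" using same_color by blast
      qed
    qed (auto simp: A_def mono_clique_def)
  qed
qed

end

section \<open>Counting embeddings of a clique with pendant edges\<close>

locale clique_pendants =
  fixes k :: nat and V K :: "'a set" and E :: "'a set set" and par :: "'a \<Rightarrow> 'a"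
  assumes finV: "finite V" and KV: "K \<subseteq> V" and cardK: "card K = k" and k2: "2 \<le> k"
    and par: "\<And>p. p \<in> V - K \<Longrightarrow> par p \<in> K"
    and E_eq: "E = [K]\<^bsup>2\<^esup> \<union> (\<lambda>p. {p, par p}) ` (V - K)"
begin

abbreviation "t \<equiv> card V"
abbreviation "q \<equiv> card (V - K)"

text \<open>Labelled copies, as extensional functions so that they can be counted; with labels,
  attaching pendant vertices becomes a product.\<close>

definition emb :: "nat \<Rightarrow> (nat set \<Rightarrow> nat) \<Rightarrow> nat \<Rightarrow> ('a \<Rightarrow> nat) set" where
  "emb n f c = {\<phi> \<in> V \<rightarrow>\<^sub>E {..<n}. inj_on \<phi> V \<and> (\<forall>e\<in>E. f (\<phi> ` e) = c)}"

definition embs :: "nat \<Rightarrow> (nat set \<Rightarrow> nat) \<Rightarrow> ('a \<Rightarrow> nat) set" where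
  "embs n f = (\<Union>c<3. emb n f c)"

lemma finK: "finite K" using KV finV by (rule finite_subset)

lemma t_eq: "t = k + q"
  using card_Un_disjoint[of K "V - K"] finV finK KV cardK by (simp add: Un_absorb1)

lemma finite_emb [simp]: "finite (emb n f c)"
  unfolding emb_def using finite_PiE[OF finV, of "\<lambda>_. {..<n}"] by simp

lemma finite_embs [simp]: "finite (embs n f)"
  by (simp add: embs_def)

lemma E_subset: "e \<in> E \<Longrightarrow> e \<subseteq> V"
  using KV par by (auto simp: E_eq nsets_def)

lemma E_card: "e \<in> E \<Longrightarrow> card e = 2"
proof -
  assume "e \<in> E"
  moreover have "card {p, par p} = 2" if "p \<in> V - K" for p
    using par[OF that] that by (auto simp: card_insert_if)
  ultimately show ?thesis by (auto simp: E_eq nsets_def)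
qed

lemma emb_iff:
  "\<phi> \<in> emb n f c \<longleftrightarrow> \<phi> \<in> V \<rightarrow>\<^sub>E {..<n} \<and> inj_on \<phi> V \<and>
     (\<forall>x\<in>K. \<forall>y\<in>K. x \<noteq> y \<longrightarrow> f {\<phi> x, \<phi> y} = c) \<and> (\<forall>p\<in>V - K. f {\<phi> p, \<phi> (par p)} = c)"
proof -
  have "(\<forall>e\<in>E. f (\<phi> ` e) = c) \<longleftrightarrow> (\<forall>e\<in>[K]\<^bsup>2\<^esup>. f (\<phi> ` e) = c) \<and> (\<forall>p\<in>V - K. f {\<phi> p, \<phi> (par p)} = c)"
    unfolding E_eq by (simp add: ball_Un)
  also have "(\<forall>e\<in>[K]\<^bsup>2\<^esup>. f (\<phi> ` e) = c) \<longleftrightarrow> (\<forall>x\<in>K. \<forall>y\<in>K. x \<noteq> y \<longrightarrow> f {\<phi> x, \<phi> y} = c)"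
    unfolding nsets_2_eq by auto
  finally show ?thesis by (auto simp: emb_def)
qed

lemma emb_mono_clique: "\<phi> \<in> emb n f c \<Longrightarrow> mono_clique f c (\<phi> ` K)"
  by (auto simp: emb_iff mono_clique_def)

lemma emb_image: "\<phi> \<in> emb n f c \<Longrightarrow> \<phi> ` V \<subseteq> {..<n}"
  by (auto simp: emb_def)

subsection \<open>Labelled and unlabelled copies\<close>

text \<open>The factor is the number of automorphisms of the graph: composing one embedding with
  them yields all embeddings with the same image graph. So minimizing copies and minimizing
  embeddings is the same.\<close>

lemma card_embs:
  obtains a where "0 < a" "\<And>n f. card (embs n f) = a * card (mono_copies V E n f)"
proof
  define Aut where "Aut = {\<psi> \<in> V \<rightarrow>\<^sub>E V. bij_betw \<psi> V V \<and> (`) \<psi> ` E = E}"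
  have fA: "finite Aut" unfolding Aut_def using finite_PiE[OF finV, of "\<lambda>_. V"] finV by simp
  have "(\<lambda>e. (\<lambda>x\<in>V. x) ` e) ` E = (\<lambda>e. e) ` E"
    by (intro image_cong refl) (use E_subset in force)
  then have "(\<lambda>x\<in>V. x) \<in> Aut"
    by (auto simp: Aut_def bij_betw_def inj_on_def)
  then show "0 < card Aut" using fA card_gt_0_iff by blast
  fix n f
  define \<Phi> where "\<Phi> = (\<lambda>\<phi> :: 'a \<Rightarrow> nat. (\<phi> ` V, (`) \<phi> ` E))"
  have finc: "finite (mono_copies V E n f)"
  proof (rule finite_subset)
    show "mono_copies V E n f \<subseteq> Pow {..<n} \<times> Pow (Pow {..<n})"
      by (auto simp: mono_copies_def nsets_def)
  qed simp
  have into: "\<Phi> \<phi> \<in> mono_copies V E n f" if \<phi>: "\<phi> \<in> embs n f" for \<phi>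
  proof -
    obtain c where c: "c < 3" "\<phi> \<in> emb n f c" using \<phi> by (auto simp: embs_def)
    then have inj: "inj_on \<phi> V" and col: "\<forall>e\<in>E. f (\<phi> ` e) = c" by (auto simp: emb_def)
    have "\<phi> ` e \<in> [\<phi> ` V]\<^bsup>2\<^esup>" if "e \<in> E" for e
    proof -
      have "card (\<phi> ` e) = 2"
        using E_card[OF that] E_subset[OF that] inj by (metis card_image inj_on_subset)
      then show ?thesis using E_subset[OF that] by (auto simp: nsets_def card_ge_0_finite)
    qed
    moreover have "graph_iso V E (\<phi> ` V) ((`) \<phi> ` E)"
      unfolding graph_iso_def using inj inj_on_imp_bij_betw by blast
    ultimately show ?thesis
      unfolding \<Phi>_def mono_copies_def using c col emb_image[OF c(2)] by blast
  qed
  have fiber: "card {\<phi> \<in> embs n f. \<Phi> \<phi> = (W, F)} = card Aut" if WF: "(W, F) \<in> mono_copies V E n f" for W F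
  proof -
    obtain \<phi>0 where \<phi>0: "bij_betw \<phi>0 V W" "F = (`) \<phi>0 ` E"
      using WF by (auto simp: mono_copies_def graph_iso_def)
    obtain c where c: "c < 3" "\<forall>e\<in>F. f e = c" "W \<subseteq> {..<n}" using WF by (auto simp: mono_copies_def)
    have inj0: "inj_on \<phi>0 V" and im0: "\<phi>0 ` V = W" using \<phi>0 by (auto simp: bij_betw_def)
    define h where "h = inv_into V \<phi>0"
    have h: "h (\<phi>0 x) = x" if "x \<in> V" for x using that inj0 by (simp add: h_def)
    have h': "h w \<in> V" "\<phi>0 (h w) = w" if "w \<in> W" for w
      using that im0 by (auto simp: h_def inv_into_into f_inv_into_f)
    have "bij_betw (\<lambda>\<psi>. \<lambda>x\<in>V. \<phi>0 (\<psi> x)) Aut {\<phi> \<in> embs n f. \<Phi> \<phi> = (W, F)}"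
    proof (rule bij_betwI[of _ _ _ "\<lambda>\<phi>. \<lambda>x\<in>V. h (\<phi> x)"])
      show "(\<lambda>\<psi>. \<lambda>x\<in>V. \<phi>0 (\<psi> x)) \<in> Aut \<rightarrow> {\<phi> \<in> embs n f. \<Phi> \<phi> = (W, F)}"
      proof
        fix \<psi> assume "\<psi> \<in> Aut"
        then have \<psi>: "\<psi> \<in> V \<rightarrow>\<^sub>E V" "inj_on \<psi> V" "\<psi> ` V = V" "(`) \<psi> ` E = E"
          by (auto simp: Aut_def bij_betw_def)
        let ?\<phi> = "\<lambda>x\<in>V. \<phi>0 (\<psi> x)"
        have im: "?\<phi> ` e = \<phi>0 ` (\<psi> ` e)" if "e \<subseteq> V" for e using that by (force simp: image_image)
        have "?\<phi> ` V = W" using im[of V] \<psi> im0 by simp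
        moreover have "(`) ?\<phi> ` E = (\<lambda>e. \<phi>0 ` (\<psi> ` e)) ` E"
          by (rule image_cong[OF refl]) (rule im[OF E_subset])
        then have "(`) ?\<phi> ` E = (`) \<phi>0 ` ((`) \<psi> ` E)"
          by (simp only: image_image)
        then have F: "(`) ?\<phi> ` E = F" using \<psi> \<phi>0 by simp
        moreover have "?\<phi> \<in> emb n f c"
        proof -
          have "inj_on ?\<phi> V"
          proof (rule inj_onI)
            fix x y assume "x \<in> V" "y \<in> V" "?\<phi> x = ?\<phi> y"
            moreover from this have "\<psi> x \<in> V" "\<psi> y \<in> V" using \<psi>(1) by auto
            ultimately show "x = y" using inj_onD[OF inj0] inj_onD[OF \<psi>(2)] by simp
          qed
          moreover have "f (?\<phi> ` e) = c" if "e \<in> E" for e using c(2) F that by blast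
          moreover have "?\<phi> \<in> V \<rightarrow>\<^sub>E {..<n}" using \<open>?\<phi> ` V = W\<close> c(3) by auto
          ultimately show ?thesis by (auto simp: emb_def)
        qed
        ultimately show "?\<phi> \<in> {\<phi> \<in> embs n f. \<Phi> \<phi> = (W, F)}"
          using c(1) unfolding \<Phi>_def embs_def by blast
      qed
      show "(\<lambda>\<phi>. \<lambda>x\<in>V. h (\<phi> x)) \<in> {\<phi> \<in> embs n f. \<Phi> \<phi> = (W, F)} \<rightarrow> Aut"
      proof
        fix \<phi> assume "\<phi> \<in> {\<phi> \<in> embs n f. \<Phi> \<phi> = (W, F)}"
        then have \<phi>: "\<phi> \<in> V \<rightarrow>\<^sub>E {..<n}" "inj_on \<phi> V" "\<phi> ` V = W" "(`) \<phi> ` E = F"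
          by (auto simp: embs_def emb_def \<Phi>_def)
        let ?\<psi> = "\<lambda>x\<in>V. h (\<phi> x)"
        have im: "?\<psi> ` e = h ` (\<phi> ` e)" if "e \<subseteq> V" for e using that by (force simp: image_image)
        have "h ` W = V" using im0 h by (force simp: image_iff)
        then have "?\<psi> ` V = V" using im[of V] \<phi> by simp
        moreover have "inj_on ?\<psi> V"
        proof (rule inj_onI)
          fix x y assume "x \<in> V" "y \<in> V" "?\<psi> x = ?\<psi> y"
          then have "\<phi>0 (h (\<phi> x)) = \<phi>0 (h (\<phi> y))" by simp
          then have "\<phi> x = \<phi> y" using h'(2) \<phi>(3) \<open>x \<in> V\<close> \<open>y \<in> V\<close> by (metis imageI)
          then show "x = y" using \<phi>(2) \<open>x \<in> V\<close> \<open>y \<in> V\<close> by (auto dest: inj_onD)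
        qed
        moreover have "(`) ?\<psi> ` E = E"
        proof -
          have "(`) ?\<psi> ` E = (\<lambda>e. h ` (\<phi> ` e)) ` E"
            by (rule image_cong[OF refl]) (rule im[OF E_subset])
          also have "\<dots> = (`) h ` ((`) \<phi> ` E)" by (simp only: image_image)
          also have "\<dots> = (`) h ` ((`) \<phi>0 ` E)" using \<phi>(4) \<phi>0(2) by simp
          also have "\<dots> = (\<lambda>e. e) ` E"
            unfolding image_image
          proof (intro image_cong refl)
            fix e assume "e \<in> E"
            then have "e \<subseteq> V" by (rule E_subset)
            then show "(\<lambda>x. h (\<phi>0 x)) ` e = e" using h by force
          qed
          finally show ?thesis by simp
        qed
        moreover have "?\<psi> \<in> V \<rightarrow>\<^sub>E V" using \<open>?\<psi> ` V = V\<close> by auto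
        ultimately show "?\<psi> \<in> Aut" by (auto simp: Aut_def bij_betw_def)
      qed
      show "(\<lambda>x\<in>V. h ((\<lambda>x\<in>V. \<phi>0 (\<psi> x)) x)) = \<psi>" if "\<psi> \<in> Aut" for \<psi>
      proof -
        have "\<psi> \<in> V \<rightarrow>\<^sub>E V" using that by (simp add: Aut_def)
        then show ?thesis using h by (intro ext) (auto simp: restrict_def PiE_def extensional_def)
      qed
      show "(\<lambda>x\<in>V. \<phi>0 ((\<lambda>x\<in>V. h (\<phi> x)) x)) = \<phi>" if "\<phi> \<in> {\<phi> \<in> embs n f. \<Phi> \<phi> = (W, F)}" for \<phi>
      proof -
        have "\<phi> \<in> V \<rightarrow>\<^sub>E {..<n}" "\<phi> ` V = W" using that by (auto simp: embs_def emb_def \<Phi>_def)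
        then show ?thesis using h' by (intro ext) (auto simp: restrict_def PiE_def extensional_def)
      qed
    qed
    then show ?thesis by (rule bij_betw_same_card[symmetric])
  qed
  have "card (embs n f) = (\<Sum>\<phi>\<in>embs n f. 1)" by simp
  also have "\<dots> = (\<Sum>y\<in>mono_copies V E n f. \<Sum>\<phi>\<in>{\<phi> \<in> embs n f. \<Phi> \<phi> = y}. 1)"
    using into finc by (intro sum.group[symmetric]) auto
  also have "\<dots> = (\<Sum>y\<in>mono_copies V E n f. card Aut)"
    using fiber by (intro sum.cong refl) auto
  finally show "card (embs n f) = card Aut * card (mono_copies V E n f)" by simp
qed

subsection \<open>Monochromatic cliques with large degrees extend to many copies\<close>

text \<open>Values are chosen one point at a time, avoiding \<open>Q\<close> and the earlier values,
  at most \<open>s\<close> in all. Truncated subtraction keeps the bound valid where some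
  \<open>N p\<close> is small.\<close>

lemma card_injective_choices:
  fixes N :: "'b \<Rightarrow> 'c set"
  assumes "finite P" "finite Q" "\<And>p. p \<in> P \<Longrightarrow> finite (N p)" "card Q + card P \<le> s"
  shows "(\<Prod>p\<in>P. card (N p) - s) \<le> card {g \<in> Pi\<^sub>E P N. inj_on g P \<and> g ` P \<inter> Q = {}}"
  using assms
proof (induction P)
  case empty
  have "{g \<in> Pi\<^sub>E {} N. inj_on g {} \<and> g ` {} \<inter> Q = {}} = {\<lambda>x. undefined}" by auto
  then show ?case by simp
next
  case (insert p P)
  define G where "G = {g \<in> Pi\<^sub>E P N. inj_on g P \<and> g ` P \<inter> Q = {}}"
  define G' where "G' = {g \<in> Pi\<^sub>E (insert p P) N. inj_on g (insert p P) \<and> g ` insert p P \<inter> Q = {}}"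
  have IH: "(\<Prod>p\<in>P. card (N p) - s) \<le> card G"
    using insert unfolding G_def by auto
  have finG: "finite G" "finite G'"
  proof -
    have "finite (Pi\<^sub>E P N)" "finite (Pi\<^sub>E (insert p P) N)"
      using insert by (intro finite_PiE; auto)+
    then show "finite G" "finite G'" by (auto simp: G_def G'_def)
  qed
  define S where "S = Sigma G (\<lambda>g. N p - (Q \<union> g ` P))"
  have "card G * (card (N p) - s) = (\<Sum>g\<in>G. card (N p) - s)" by simp
  also have "\<dots> \<le> (\<Sum>g\<in>G. card (N p - (Q \<union> g ` P)))"
  proof (intro sum_mono)
    fix g assume "g \<in> G"
    have "card (Q \<union> g ` P) \<le> card Q + card (g ` P)" by (rule card_Un_le)
    also have "\<dots> \<le> card Q + card P" using insert by (simp add: card_image_le)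
    also have "\<dots> \<le> s" using insert by simp
    finally show "card (N p) - s \<le> card (N p - (Q \<union> g ` P))"
      using diff_card_le_card_Diff[of "Q \<union> g ` P" "N p"] insert by simp
  qed
  also have "\<dots> = card S"
    unfolding S_def using finG insert by (intro card_SigmaI[symmetric]) auto
  also have "\<dots> \<le> card G'"
  proof (rule card_inj_on_le[of "\<lambda>(g, w). g(p := w)"])
    show "inj_on (\<lambda>(g, w). g(p := w)) S"
    proof (rule inj_onI, clarify)
      fix g w g' w'
      assume *: "(g, w) \<in> S" "(g', w') \<in> S" "g(p := w) = g'(p := w')"
      have "g \<in> Pi\<^sub>E P N" "g' \<in> Pi\<^sub>E P N" using * by (auto simp: S_def G_def)
      then have "g p = undefined" "g' p = undefined" using insert by (auto simp: PiE_def extensional_def)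
      then have "g = g'" using *(3) by (metis fun_upd_triv fun_upd_upd)
      moreover have "w = w'" using *(3) by (metis fun_upd_same)
      ultimately show "g = g' \<and> w = w'" by simp
    qed
    show "(\<lambda>(g, w). g(p := w)) ` S \<subseteq> G'"
    proof (rule image_subsetI, clarify)
      fix g w assume "(g, w) \<in> S"
      then have g: "g \<in> Pi\<^sub>E P N" "inj_on g P" "g ` P \<inter> Q = {}" and w: "w \<in> N p" "w \<notin> Q" "w \<notin> g ` P"
        by (auto simp: S_def G_def)
      have im: "(g(p := w)) ` P = g ` P" using insert(2) by auto
      have "inj_on (g(p := w)) (insert p P)"
        using g w insert(2) by (auto simp: inj_on_def)
      moreover have "g(p := w) \<in> Pi\<^sub>E (insert p P) N" using g w by (intro PiE_fun_upd) auto
      moreover have "(g(p := w)) ` insert p P \<inter> Q = {}"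
        unfolding image_insert im using g w by simp
      ultimately show "g(p := w) \<in> G'" unfolding G'_def by blast
    qed
  qed (rule finG)
  finally have "card G * (card (N p) - s) \<le> card G'" .
  moreover have "(\<Prod>p\<in>P. card (N p) - s) * (card (N p) - s) \<le> card G * (card (N p) - s)"
    using IH by (rule mult_le_mono1)
  ultimately have "(\<Prod>p\<in>P. card (N p) - s) * (card (N p) - s) \<le> card G'" by linarith
  then show ?case
    unfolding prod.insert[OF insert(1,2)] G'_def[symmetric] mult.commute[of "card (N p) - s"] .
qed

text \<open>Each pendant vertex picks a neighbor of the image of its parent; core and pendant values
  together are \<open>t\<close>, which is why \<open>t\<close> is subtracted.\<close>

lemma extend_clique:
  assumes \<sigma>: "bij_betw \<sigma> K Q" and Q: "Q \<subseteq> {..<n}" "mono_clique f c Q"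
  shows "(\<Prod>p\<in>V - K. cdeg f n c (\<sigma> (par p)) - t) \<le> card {\<phi> \<in> emb n f c. \<forall>x\<in>K. \<phi> x = \<sigma> x}"
proof -
  define G where "G = {g \<in> Pi\<^sub>E (V - K) (\<lambda>p. nbrs f n {c} (\<sigma> (par p))). inj_on g (V - K) \<and> g ` (V - K) \<inter> Q = {}}"
  have cQ: "card Q = k" "finite Q" using \<sigma> cardK finK bij_betw_same_card bij_betw_finite by metis+
  have inj: "inj_on \<sigma> K" and im: "\<sigma> ` K = Q" using \<sigma> by (auto simp: bij_betw_def)
  have "(\<Prod>p\<in>V - K. cdeg f n c (\<sigma> (par p)) - t) \<le> card G"
    unfolding G_def using finV cQ t_eq by (intro card_injective_choices) auto
  also have "\<dots> \<le> card {\<phi> \<in> emb n f c. \<forall>x\<in>K. \<phi> x = \<sigma> x}"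
  proof (rule card_inj_on_le[of "\<lambda>g x. if x \<in> K then \<sigma> x else g x"])
    show "inj_on (\<lambda>g x. if x \<in> K then \<sigma> x else g x) G"
    proof (rule inj_onI, rule ext)
      fix g g' x
      assume *: "g \<in> G" "g' \<in> G" "(\<lambda>x. if x \<in> K then \<sigma> x else g x) = (\<lambda>x. if x \<in> K then \<sigma> x else g' x)"
      show "g x = g' x"
      proof (cases "x \<in> V - K")
        case True
        then show ?thesis using fun_cong[OF *(3), of x] by simp
      next
        case False
        then show ?thesis using * by (auto simp: G_def PiE_def extensional_def)
      qed
    qed
    show "(\<lambda>g x. if x \<in> K then \<sigma> x else g x) ` G \<subseteq> {\<phi> \<in> emb n f c. \<forall>x\<in>K. \<phi> x = \<sigma> x}"
    proof (rule image_subsetI)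
      fix g assume "g \<in> G"
      then have g: "g \<in> Pi\<^sub>E (V - K) (\<lambda>p. nbrs f n {c} (\<sigma> (par p)))" "inj_on g (V - K)" "g ` (V - K) \<inter> Q = {}"
        by (auto simp: G_def)
      let ?\<phi> = "\<lambda>x. if x \<in> K then \<sigma> x else g x"
      have gp: "g p < n" "f {\<sigma> (par p), g p} = c" if "p \<in> V - K" for p
        using PiE_mem[OF g(1) that] by (auto simp: nbrs_def)
      have "?\<phi> \<in> V \<rightarrow>\<^sub>E {..<n}"
      proof (rule PiE_I)
        show "?\<phi> x \<in> {..<n}" if "x \<in> V" for x using that gp im Q by auto
        show "?\<phi> x = undefined" if "x \<notin> V" for x
          using that KV g(1) by (auto simp: PiE_def extensional_def)
      qed
      moreover have "inj_on ?\<phi> V"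
      proof (rule inj_onI)
        fix x y assume xy: "x \<in> V" "y \<in> V" "?\<phi> x = ?\<phi> y"
        have ne: "\<sigma> u \<noteq> g w" if "u \<in> K" "w \<in> V - K" for u w
          using g(3) im that by (metis disjoint_iff imageI)
        show "x = y"
          using xy ne[of x y] ne[of y x] inj g(2) by (auto simp: inj_on_def split: if_splits)
      qed
      moreover have "f {?\<phi> x, ?\<phi> y} = c" if "x \<in> K" "y \<in> K" "x \<noteq> y" for x y
        using that Q(2) im inj by (auto simp: mono_clique_def inj_on_def)
      moreover have "f {?\<phi> p, ?\<phi> (par p)} = c" if "p \<in> V - K" for p
        using that gp[OF that] par[OF that] by (simp add: insert_commute)
      ultimately show "?\<phi> \<in> {\<phi> \<in> emb n f c. \<forall>x\<in>K. \<phi> x = \<sigma> x}"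
        by (simp add: emb_iff)
    qed
  qed simp
  finally show ?thesis .
qed

lemma bij_shift: "bij_betw (\<lambda>j. (i + j) mod k) {..<k} {..<k}"
proof -
  have "inj_on (\<lambda>j. (i + j) mod k) {..<k}"
  proof (rule inj_onI)
    have le: "y \<le> x" if "x < k" "y < k" "(i + x) mod k = (i + y) mod k" for x y
    proof (rule ccontr)
      assume "\<not> y \<le> x"
      then have "k dvd y - x" using that mod_eq_dvd_iff_nat[of "i + x" "i + y" k] by simp
      then show False using \<open>\<not> y \<le> x\<close> that by (auto dest: dvd_imp_le)
    qed
    fix x y assume "x \<in> {..<k}" "y \<in> {..<k}" "(i + x) mod k = (i + y) mod k"
    then show "x = y" using le[of x y] le[of y x] by simp
  qed
  moreover have "(\<lambda>j. (i + j) mod k) ` {..<k} \<subseteq> {..<k}" using k2 by auto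
  ultimately show ?thesis
    by (simp add: bij_betw_def endo_inj_surj)
qed

text \<open>The product of the weights over all \<open>k\<close> cyclic shifts of an identification of \<open>K\<close> with \<open>Q\<close>
  is the \<open>q\<close>-th power of the product over \<open>Q\<close>, so some shift is at least the geometric mean.\<close>

lemma shift_exists:
  fixes y :: "nat \<Rightarrow> real"
  assumes Q: "finite Q" "card Q = k" and y: "\<And>v. v \<in> Q \<Longrightarrow> 0 \<le> y v"
    and M: "M ^ k \<le> (\<Prod>v\<in>Q. y v) ^ q" "0 < M"
  shows "\<exists>\<sigma>. bij_betw \<sigma> K Q \<and> M \<le> (\<Prod>p\<in>V - K. y (\<sigma> (par p)))"
proof -
  obtain \<kappa> where \<kappa>: "bij_betw \<kappa> K {..<k}"
    using finK cardK by (metis bij_betw_inv_into bij_betw_from_nat_into_finite)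
  obtain \<theta> where \<theta>: "bij_betw \<theta> {..<k} Q"
    using Q by (metis bij_betw_from_nat_into_finite)
  define \<sigma> where "\<sigma> = (\<lambda>j x. \<theta> ((\<kappa> x + j) mod k))"
  have \<sigma>: "bij_betw (\<sigma> j) K Q" for j
  proof -
    have "bij_betw (\<theta> \<circ> ((\<lambda>i. (j + i) mod k) \<circ> \<kappa>)) K Q"
      using \<kappa> \<theta> bij_shift by (blast intro: bij_betw_trans)
    moreover have "\<theta> \<circ> ((\<lambda>i. (j + i) mod k) \<circ> \<kappa>) = \<sigma> j" by (auto simp: \<sigma>_def add.commute)
    ultimately show ?thesis by simp
  qed
  have "\<exists>j<k. M \<le> (\<Prod>p\<in>V - K. y (\<sigma> j (par p)))"
  proof (rule ccontr)
    assume neg: "\<not> ?thesis"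
    have in_Q: "\<sigma> j (par p) \<in> Q" if "p \<in> V - K" for j p
      using \<sigma>[of j] par[OF that] by (auto simp: bij_betw_def)
    have "(\<Prod>j<k. \<Prod>p\<in>V - K. y (\<sigma> j (par p))) < (\<Prod>j<k. M)"
      using neg k2 M(2) y in_Q
      by (intro prod_mono_strict[of 0]) (auto intro!: prod_nonneg simp: not_le less_imp_le)
    also have "\<dots> \<le> (\<Prod>v\<in>Q. y v) ^ q" using M by simp
    also have "\<dots> = (\<Prod>p\<in>V - K. \<Prod>v\<in>Q. y v)" by simp
    also have "\<dots> = (\<Prod>p\<in>V - K. \<Prod>j<k. y (\<sigma> j (par p)))"
    proof (rule prod.cong[OF refl])
      fix p
      have "bij_betw (\<theta> \<circ> (\<lambda>j. (\<kappa> (par p) + j) mod k)) {..<k} Q"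
        using bij_shift \<theta> by (rule bij_betw_trans)
      then have "bij_betw (\<lambda>j. \<sigma> j (par p)) {..<k} Q" by (simp add: \<sigma>_def comp_def)
      then show "(\<Prod>v\<in>Q. y v) = (\<Prod>j<k. y (\<sigma> j (par p)))"
        by (rule prod.reindex_bij_betw[symmetric])
    qed
    also have "\<dots> = (\<Prod>j<k. \<Prod>p\<in>V - K. y (\<sigma> j (par p)))" by (rule prod.swap)
    finally show False by simp
  qed
  then show ?thesis using \<sigma> by blast
qed

text \<open>The largest admissible \<open>M\<close> is the \<open>q\<close>-th power of the
  geometric mean of the reduced degrees; the assumption expresses this without roots.\<close>

lemma clique_embs:
  assumes Q: "Q \<subseteq> {..<n}" "card Q = k" "mono_clique f c Q"
    and M: "M ^ k \<le> (\<Prod>v\<in>Q. real (cdeg f n c v - t)) ^ q" "0 < M"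
  shows "M \<le> card {\<phi> \<in> emb n f c. \<phi> ` K = Q}"
proof -
  have finQ: "finite Q" using Q(1) by (rule finite_subset) simp
  obtain \<sigma> where \<sigma>: "bij_betw \<sigma> K Q" "M \<le> (\<Prod>p\<in>V - K. real (cdeg f n c (\<sigma> (par p)) - t))"
    using shift_exists[OF finQ Q(2) _ M] by auto
  have "M \<le> real (\<Prod>p\<in>V - K. cdeg f n c (\<sigma> (par p)) - t)" using \<sigma>(2) by simp
  also have "\<dots> \<le> card {\<phi> \<in> emb n f c. \<forall>x\<in>K. \<phi> x = \<sigma> x}"
    using extend_clique[OF \<sigma>(1) Q(1,3)] by (rule of_nat_mono)
  also have "\<dots> \<le> card {\<phi> \<in> emb n f c. \<phi> ` K = Q}"
  proof (intro of_nat_mono card_mono)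
    show "{\<phi> \<in> emb n f c. \<forall>x\<in>K. \<phi> x = \<sigma> x} \<subseteq> {\<phi> \<in> emb n f c. \<phi> ` K = Q}"
    proof clarify
      fix \<phi> assume "\<forall>x\<in>K. \<phi> x = \<sigma> x"
      then have "\<phi> ` K = \<sigma> ` K" by (intro image_cong) auto
      then show "\<phi> ` K = Q" using \<sigma>(1) by (simp add: bij_betw_def)
    qed
  qed simp
  finally show ?thesis .
qed

text \<open>No factor can be tiny: all are at most \<open>n\<close> and the product is at least
  \<open>(n / m) ^ k\<close>, so each is at least \<open>n / m ^ k\<close>. Subtracting
  \<open>t\<close> then costs only a factor \<open>1 - \<zeta>\<close>.\<close>

lemma prod_diff_ge:
  fixes d :: "nat \<Rightarrow> nat" and m n :: nat and \<mu> x \<zeta> :: real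
  assumes Q: "finite Q" "card Q = k" and d: "\<And>v. v \<in> Q \<Longrightarrow> d v \<le> n"
    and \<mu>: "0 < \<mu>" "\<mu> * m = real n" and x: "\<mu> \<le> x"
    and prod: "x ^ k \<le> (\<Prod>v\<in>Q. real (d v))"
    and \<zeta>: "t * m ^ k \<le> \<zeta> * n" "0 \<le> \<zeta>" "\<zeta> \<le> 1" and m: "0 < m"
  shows "((1 - \<zeta>) * x) ^ k \<le> (\<Prod>v\<in>Q. real (d v - t))"
proof -
  have n: "0 < real n" using \<mu> m by (metis mult_pos_pos of_nat_0_less_iff)
  have "(1 - \<zeta>) * d v \<le> real (d v - t)" if v: "v \<in> Q" for v
  proof -
    have "n * (real n ^ (k - 1)) = (\<mu> * m) ^ k" using \<mu> k2 by (cases k) auto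
    also have "\<dots> = \<mu> ^ k * m ^ k" by (simp add: power_mult_distrib)
    also have "\<dots> \<le> x ^ k * m ^ k" using x \<mu> by (intro mult_right_mono power_mono) auto
    also have "\<dots> \<le> (\<Prod>v\<in>Q. real (d v)) * m ^ k" using prod by (intro mult_right_mono) auto
    also have "(\<Prod>v\<in>Q. real (d v)) = d v * (\<Prod>v\<in>Q - {v}. real (d v))"
      using Q v by (simp add: prod.remove)
    also have "\<dots> * m ^ k \<le> d v * (\<Prod>v\<in>Q - {v}. real n) * m ^ k"
      using d by (intro mult_right_mono mult_left_mono prod_mono) auto
    also have "\<dots> = (d v * m ^ k) * (real n ^ (k - 1))" using Q v by simp
    finally have "real n \<le> d v * m ^ k"
      using n by (subst (asm) mult_le_cancel_right) auto
    then have "\<zeta> * n \<le> \<zeta> * (d v * m ^ k)" using \<zeta> by (intro mult_left_mono) auto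
    then have "real t * m ^ k \<le> (\<zeta> * d v) * m ^ k" using \<zeta> by (simp add: mult_ac)
    then have "real t \<le> \<zeta> * d v" using m by (subst (asm) mult_le_cancel_right) auto
    then show ?thesis by (simp add: algebra_simps)
  qed
  then have "(\<Prod>v\<in>Q. (1 - \<zeta>) * d v) \<le> (\<Prod>v\<in>Q. real (d v - t))"
    using \<zeta> by (intro prod_mono) auto
  moreover have "(\<Prod>v\<in>Q. (1 - \<zeta>) * d v) = (1 - \<zeta>) ^ k * (\<Prod>v\<in>Q. real (d v))"
    using Q by (simp add: prod.distrib)
  moreover have "((1 - \<zeta>) * x) ^ k \<le> (1 - \<zeta>) ^ k * (\<Prod>v\<in>Q. real (d v))"
    unfolding power_mult_distrib using prod \<zeta> by (intro mult_left_mono) auto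
  ultimately show ?thesis by linarith
qed

text \<open>Colors and threshold are parameters because two families are used: all colors at
  \<open>(1 + dlt) * \<mu>\<close>, and two colors at \<open>2 * \<mu>\<close>.\<close>

definition rich :: "nat \<Rightarrow> (nat set \<Rightarrow> nat) \<Rightarrow> nat set \<Rightarrow> real \<Rightarrow> nat set set" where
  "rich n f C x = {Q. Q \<subseteq> {..<n} \<and> card Q = k \<and>
     (\<exists>c\<in>C. mono_clique f c Q \<and> x ^ k \<le> (\<Prod>v\<in>Q. real (cdeg f n c v)))}"

lemma finite_rich [simp]: "finite (rich n f C x)"
  by (rule finite_subset[of _ "Pow {..<n}"]) (auto simp: rich_def)

text \<open>Embeddings with different core images are different, so the bounds for single cliques
  add up. \<open>S\<close> is a parameter because lightness of the empty set, of a vertex and of an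
  edge all rest on this count.\<close>

lemma card_rich_le:
  fixes m n :: nat and \<mu> x \<zeta> :: real
  assumes \<mu>: "0 < \<mu>" "\<mu> * m = real n" and x: "\<mu> \<le> x"
    and \<zeta>: "t * m ^ k \<le> \<zeta> * n" "0 \<le> \<zeta>" "\<zeta> < 1" and m: "0 < m"
    and C: "finite C"
  shows "card {Q \<in> rich n f C x. S \<subseteq> Q} * ((1 - \<zeta>) * x) ^ q
    \<le> card {\<phi> \<in> (\<Union>c\<in>C. emb n f c). S \<subseteq> \<phi> ` K}"
proof -
  define \<Q> where "\<Q> = {Q \<in> rich n f C x. S \<subseteq> Q}"
  define F where "F = (\<lambda>Q. {\<phi> \<in> (\<Union>c\<in>C. emb n f c). \<phi> ` K = Q})"
  have finF: "finite (\<Union>c\<in>C. emb n f c)" using C by simp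
  have finFQ: "finite (F Q)" for Q by (rule finite_subset[OF _ finF]) (auto simp: F_def)
  have fin\<Q>: "finite \<Q>" by (simp add: \<Q>_def)
  have x0: "0 < (1 - \<zeta>) * x" using x \<mu> \<zeta> by simp
  have "((1 - \<zeta>) * x) ^ q \<le> card (F Q)" if Q: "Q \<in> \<Q>" for Q
  proof -
    obtain c where c: "c \<in> C" "Q \<subseteq> {..<n}" "card Q = k" "mono_clique f c Q"
      "x ^ k \<le> (\<Prod>v\<in>Q. real (cdeg f n c v))"
      using Q by (auto simp: \<Q>_def rich_def)
    have finQ: "finite Q" using c(2) by (rule finite_subset) simp
    have "((1 - \<zeta>) * x) ^ k \<le> (\<Prod>v\<in>Q. real (cdeg f n c v - t))"
      using \<mu> x c(5) \<zeta> m card_mono[OF _ nbrs_subset]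
      by (intro prod_diff_ge[OF finQ c(3), where m = m and n = n and \<mu> = \<mu>]) fastforce+
    then have "(((1 - \<zeta>) * x) ^ k) ^ q \<le> (\<Prod>v\<in>Q. real (cdeg f n c v - t)) ^ q"
      using x0 by (intro power_mono) auto
    then have "(((1 - \<zeta>) * x) ^ q) ^ k \<le> (\<Prod>v\<in>Q. real (cdeg f n c v - t)) ^ q"
      by (simp flip: power_mult add: mult.commute)
    then have "((1 - \<zeta>) * x) ^ q \<le> card {\<phi> \<in> emb n f c. \<phi> ` K = Q}"
      using x0 by (intro clique_embs c) auto
    also have "\<dots> \<le> card (F Q)"
      using c(1) by (intro of_nat_mono card_mono finFQ) (auto simp: F_def)
    finally show ?thesis .
  qed
  then have "(\<Sum>Q\<in>\<Q>. ((1 - \<zeta>) * x) ^ q) \<le> (\<Sum>Q\<in>\<Q>. real (card (F Q)))"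
    by (intro sum_mono)
  also have "\<dots> = real (\<Sum>Q\<in>\<Q>. card (F Q))" by simp
  also have "(\<Sum>Q\<in>\<Q>. card (F Q)) = card (\<Union>Q\<in>\<Q>. F Q)"
    using fin\<Q> finFQ by (intro card_UN_disjoint[symmetric]) (auto simp: F_def)
  also have "\<dots> \<le> card {\<phi> \<in> (\<Union>c\<in>C. emb n f c). S \<subseteq> \<phi> ` K}"
    by (intro card_mono finite_subset[OF _ finF]) (auto simp: F_def \<Q>_def)
  finally show ?thesis by (simp add: \<Q>_def)
qed

subsection \<open>Cloning a vertex\<close>

definition minimizer :: "nat \<Rightarrow> (nat set \<Rightarrow> nat) \<Rightarrow> bool" where
  "minimizer n f \<longleftrightarrow> f \<in> colorings3 n \<and> (\<forall>g\<in>colorings3 n. card (embs n f) \<le> card (embs n g))"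

lemma card_pairs_le:
  assumes "Y \<subseteq> (\<Union>(a, b)\<in>{(a, b) \<in> V \<times> V. a \<noteq> b}. X a b)"
    and X: "\<And>a b. a \<in> V \<Longrightarrow> b \<in> V \<Longrightarrow> a \<noteq> b \<Longrightarrow> finite (X a b) \<and> card (X a b) \<le> c"
  shows "card Y \<le> t * t * c"
proof -
  define I where "I = {(a, b) \<in> V \<times> V. a \<noteq> b}"
  have finI: "finite I" unfolding I_def using finV by (auto intro: finite_subset[of _ "V \<times> V"])
  have X': "finite (case p of (a, b) \<Rightarrow> X a b)" "card (case p of (a, b) \<Rightarrow> X a b) \<le> c" if "p \<in> I" for p
    using that X by (auto simp: I_def)
  have "card Y \<le> card (\<Union>p\<in>I. case p of (a, b) \<Rightarrow> X a b)"
    using assms(1) finI X' by (intro card_mono) (auto simp: I_def)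
  also have "\<dots> \<le> (\<Sum>p\<in>I. card (case p of (a, b) \<Rightarrow> X a b))" by (rule card_UN_le[OF finI])
  also have "\<dots> \<le> card I * c" using sum_bounded_above[OF X'(2)] by simp
  also have "\<dots> \<le> card (V \<times> V) * c"
    using finV by (intro mult_right_mono card_mono) (auto simp: I_def)
  finally show ?thesis by (simp add: card_cartesian_product)
qed

lemma card_two_values:
  assumes ab: "a \<in> V" "b \<in> V" "a \<noteq> b"
  shows "card {\<phi> \<in> V \<rightarrow>\<^sub>E {..<n}. \<phi> a = u \<and> \<phi> b = v} \<le> n ^ (t - 2)"
proof -
  define N where "N = (\<lambda>x. if x = a then {u} else if x = b then {v} else {..<n})"
  have finN: "\<And>x. finite (N x)" by (simp add: N_def)
  have "{\<phi> \<in> V \<rightarrow>\<^sub>E {..<n}. \<phi> a = u \<and> \<phi> b = v} \<subseteq> Pi\<^sub>E V N"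
    by (auto simp: N_def PiE_iff extensional_def)
  then have "card {\<phi> \<in> V \<rightarrow>\<^sub>E {..<n}. \<phi> a = u \<and> \<phi> b = v} \<le> card (Pi\<^sub>E V N)"
    using finV finN by (intro card_mono finite_PiE) auto
  also have "\<dots> = (\<Prod>x\<in>V. card (N x))" using finV by (rule card_PiE)
  also have "\<dots> = (\<Prod>x\<in>insert a (insert b (V - {a, b})). card (N x))"
    using ab by (intro prod.cong) auto
  also have "\<dots> = (\<Prod>x\<in>V - {a, b}. card (N x))"
    using finV ab by (simp add: N_def)
  also have "\<dots> = (\<Prod>x\<in>V - {a, b}. n)" by (intro prod.cong) (auto simp: N_def)
  also have "\<dots> = n ^ (t - 2)" using finV ab by (simp add: card_Diff_subset numeral_2_eq_2)
  finally show ?thesis .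
qed

text \<open>Some vertex \<open>v\<close> lies in at most an average number of embeddings. Turning
  \<open>u\<close> into a clone of \<open>v\<close> leaves \<open>u\<close> in no more than that,
  apart from embeddings through both, and by minimality this is no improvement.\<close>

lemma minimizer_vertex:
  assumes f: "minimizer n f" and u: "u < n"
  shows "n * card {\<phi> \<in> embs n f. u \<in> \<phi> ` V} \<le> t * card (embs n f) + n * (t * t * n ^ (t - 2))"
proof -
  define cnt where "cnt = (\<lambda>f v. card {\<phi> \<in> embs n f. v \<in> \<phi> ` V})"
  have fcol: "f \<in> colorings3 n" using f by (simp add: minimizer_def)
  have "(\<Sum>v<n. cnt f v) = (\<Sum>\<phi>\<in>embs n f. card {v \<in> {..<n}. v \<in> \<phi> ` V})"
    unfolding cnt_def by (rule sum_card_swap) auto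
  also have "\<dots> = (\<Sum>\<phi>\<in>embs n f. t)"
  proof (intro sum.cong refl)
    fix \<phi> assume "\<phi> \<in> embs n f"
    then have "inj_on \<phi> V" "\<phi> ` V \<subseteq> {..<n}" by (auto simp: embs_def emb_def)
    moreover from this have "{v \<in> {..<n}. v \<in> \<phi> ` V} = \<phi> ` V" by auto
    ultimately show "card {v \<in> {..<n}. v \<in> \<phi> ` V} = t" by (simp add: card_image)
  qed
  finally have sum: "(\<Sum>v<n. cnt f v) = t * card (embs n f)" by simp
  obtain v where v: "v < n" "n * cnt f v \<le> t * card (embs n f)"
  proof (rule ccontr)
    assume "\<not> thesis"
    with that have "t * card (embs n f) < n * cnt f v" if "v < n" for v
      using \<open>v < n\<close> by (meson not_le)
    then have "(\<Sum>v<n. t * card (embs n f)) < (\<Sum>v<n. n * cnt f v)"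
      using u by (intro sum_strict_mono) auto
    also have "\<dots> = n * (\<Sum>v<n. cnt f v)" by (simp add: sum_distrib_left)
    finally show False using sum by simp
  qed
  have "cnt f u \<le> cnt f v + t * t * n ^ (t - 2)"
  proof (cases "u = v")
    case False
    \<comment> \<open>The edge between \<open>u\<close> and its model \<open>v\<close> has no
      counterpart and gets color 0; maps using both vertices are bounded trivially through
      \<open>B\<close>.\<close>
    define g where "g = (\<lambda>e. if u \<in> e then if v \<in> e then 0 else f (insert v (e - {u})) else f e)"
    have gcol: "g \<in> colorings3 n"
      unfolding colorings3_def
    proof
      fix e assume e: "e \<in> [{..<n}]\<^bsup>2\<^esup>"
      then have "insert v (e - {u}) \<in> [{..<n}]\<^bsup>2\<^esup>" if "u \<in> e" "v \<notin> e"
        using that v by (auto simp: nsets_def card_insert_if)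
      then show "g e \<in> {..<3}" using fcol e by (auto simp: g_def colorings3_def)
    qed
    have split: "card (embs n h) = card {\<phi> \<in> embs n h. u \<notin> \<phi> ` V} + cnt h u" for h
      unfolding cnt_def
      by (subst card_Un_disjoint[symmetric]) (auto intro!: arg_cong[of _ _ card])
    have emb_eq: "\<phi> \<in> emb n f c \<longleftrightarrow> \<phi> \<in> emb n g c" if "u \<notin> \<phi> ` V" for \<phi> c
    proof -
      have "f (\<phi> ` e) = g (\<phi> ` e)" if "e \<in> E" for e
        using E_subset[OF that] \<open>u \<notin> \<phi> ` V\<close> by (auto simp: g_def)
      then show ?thesis by (auto simp: emb_def)
    qed
    have "{\<phi> \<in> embs n f. u \<notin> \<phi> ` V} = {\<phi> \<in> embs n g. u \<notin> \<phi> ` V}"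
      using emb_eq by (auto simp: embs_def)
    moreover have "card (embs n f) \<le> card (embs n g)" using f gcol by (simp add: minimizer_def)
    ultimately have "cnt f u \<le> cnt g u" using split[of f] split[of g] by simp
    define A where "A = {\<phi> \<in> embs n g. u \<in> \<phi> ` V \<and> v \<notin> \<phi> ` V}"
    define B where "B = {\<phi> \<in> V \<rightarrow>\<^sub>E {..<n}. u \<in> \<phi> ` V \<and> v \<in> \<phi> ` V}"
    have finB: "finite B" unfolding B_def using finite_PiE[OF finV, of "\<lambda>_. {..<n}"] by simp
    have finA: "finite A" by (simp add: A_def)
    have "{\<phi> \<in> embs n g. u \<in> \<phi> ` V} \<subseteq> A \<union> B"
      by (auto simp: A_def B_def embs_def emb_def)
    then have "cnt g u \<le> card (A \<union> B)"
      unfolding cnt_def using finA finB by (intro card_mono) simp_all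
    also have "\<dots> \<le> card A + card B" by (rule card_Un_le)
    finally have 1: "cnt g u \<le> card A + card B" .
    have 2: "card A \<le> cnt f v"
      unfolding cnt_def
    proof (rule card_inj_on_le[of "\<lambda>\<phi>. \<lambda>x\<in>V. if \<phi> x = u then v else \<phi> x"])
      show "inj_on (\<lambda>\<phi>. \<lambda>x\<in>V. if \<phi> x = u then v else \<phi> x) A"
      proof (rule inj_onI, rule ext)
        fix \<phi> \<psi> x assume *: "\<phi> \<in> A" "\<psi> \<in> A"
          "(\<lambda>x\<in>V. if \<phi> x = u then v else \<phi> x) = (\<lambda>x\<in>V. if \<psi> x = u then v else \<psi> x)"
        show "\<phi> x = \<psi> x"
        proof (cases "x \<in> V")
          case True
          then have "\<phi> x \<noteq> v" "\<psi> x \<noteq> v" using * by (auto simp: A_def)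
          then show ?thesis using fun_cong[OF *(3), of x] True by (auto split: if_splits)
        next
          case False
          then show ?thesis using * by (auto simp: A_def embs_def emb_def PiE_def extensional_def)
        qed
      qed
      show "(\<lambda>\<phi>. \<lambda>x\<in>V. if \<phi> x = u then v else \<phi> x) ` A \<subseteq> {\<phi> \<in> embs n f. v \<in> \<phi> ` V}"
      proof (rule image_subsetI)
        fix \<phi> assume "\<phi> \<in> A"
        then obtain c where c: "c < 3" "\<phi> \<in> emb n g c" "u \<in> \<phi> ` V" "v \<notin> \<phi> ` V"
          by (auto simp: A_def embs_def)
        then have \<phi>: "\<phi> \<in> V \<rightarrow>\<^sub>E {..<n}" "inj_on \<phi> V" "\<And>e. e \<in> E \<Longrightarrow> g (\<phi> ` e) = c"
          by (auto simp: emb_def)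
        let ?\<psi> = "\<lambda>x\<in>V. if \<phi> x = u then v else \<phi> x"
        have "?\<psi> \<in> V \<rightarrow>\<^sub>E {..<n}" using \<phi> v by auto
        moreover have "inj_on ?\<psi> V"
        proof (rule inj_onI)
          fix x y assume xy: "x \<in> V" "y \<in> V" "?\<psi> x = ?\<psi> y"
          moreover from this have "\<phi> x \<noteq> v" "\<phi> y \<noteq> v" using c by auto
          ultimately have "\<phi> x = \<phi> y" by (auto split: if_splits)
          then show "x = y" using \<phi>(2) xy by (auto dest: inj_onD)
        qed
        moreover have "f (?\<psi> ` e) = c" if e: "e \<in> E" for e
        proof (cases "u \<in> \<phi> ` e")
          case True
          have "?\<psi> ` e = (\<lambda>x. if \<phi> x = u then v else \<phi> x) ` e"
            using E_subset[OF e] by (intro image_cong) auto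
          also have "\<dots> = insert v (\<phi> ` e - {u})"
          proof
            show "insert v (\<phi> ` e - {u}) \<subseteq> (\<lambda>x. if \<phi> x = u then v else \<phi> x) ` e"
              using True by auto
          qed auto
          finally have "?\<psi> ` e = insert v (\<phi> ` e - {u})" .
          moreover have "v \<notin> \<phi> ` e" using c E_subset[OF e] by auto
          ultimately show ?thesis using \<phi>(3)[OF e] True by (simp add: g_def)
        next
          case False
          then have "?\<psi> ` e = \<phi> ` e" using E_subset[OF e] by (intro image_cong) auto
          then show ?thesis using \<phi>(3)[OF e] False by (simp add: g_def)
        qed
        ultimately have "?\<psi> \<in> embs n f" using c(1) by (auto simp: embs_def emb_def)
        moreover have "v \<in> ?\<psi> ` V" using c(3) by force
        ultimately show "?\<psi> \<in> {\<phi> \<in> embs n f. v \<in> \<phi> ` V}" by simp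
      qed
    qed simp
    have "B \<subseteq> (\<Union>(a, b)\<in>{(a, b) \<in> V \<times> V. a \<noteq> b}. {\<phi> \<in> V \<rightarrow>\<^sub>E {..<n}. \<phi> a = u \<and> \<phi> b = v})"
      using False by (auto simp: B_def)
    moreover have "finite {\<phi> \<in> V \<rightarrow>\<^sub>E {..<n}. \<phi> a = u \<and> \<phi> b = v}" for a b
      using finite_PiE[OF finV, of "\<lambda>_. {..<n}"] by simp
    ultimately have "card B \<le> t * t * n ^ (t - 2)"
      by (intro card_pairs_le) (auto intro: card_two_values)
    then show ?thesis using 1 2 \<open>cnt f u \<le> cnt g u\<close> by linarith
  qed simp
  then have "n * cnt f u \<le> n * (cnt f v + t * t * n ^ (t - 2))" by (rule mult_le_mono2)
  also have "\<dots> \<le> t * card (embs n f) + n * (t * t * n ^ (t - 2))"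
    using v(2) by (simp add: algebra_simps)
  finally show ?thesis by (simp add: cnt_def)
qed

end

subsection \<open>Convexity\<close>

text \<open>Discrete convexity: \<open>d\<close> is the forward difference of \<open>h\<close>, and
  the line is the one through the points at \<open>b\<close> and \<open>Suc b\<close>.\<close>

lemma tangent_le:
  fixes h d :: "nat \<Rightarrow> int"
  assumes h: "\<And>a. h (Suc a) = h a + d a" and d: "mono d"
  shows "h b + (int a - int b) * d b \<le> h a"
proof (cases "b \<le> a")
  case True
  then show ?thesis
  proof (induction a rule: dec_induct)
    case (step a)
    then have "d b \<le> d a" using d by (auto dest: monoD)
    then show ?case using step.IH h[of a] by (simp add: algebra_simps)
  qed simp
next
  case False
  then have "a \<le> b" by simp
  then show ?thesis
  proof (induction a rule: inc_induct)
    case (step a)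
    then have "d a \<le> d b" by (intro monoD[OF d]) simp
    then show ?case using step.IH h[of a] by (simp add: algebra_simps)
  qed simp
qed

text \<open>The line meets \<open>h\<close> at both \<open>b\<close> and \<open>Suc b\<close>; the
  slope increases strictly at each of them, so all other points lie above.\<close>

lemma tangent_less:
  fixes h d :: "nat \<Rightarrow> int"
  assumes h: "\<And>a. h (Suc a) = h a + d a" and d: "mono d"
    and b: "0 < b" "d (b - 1) < d b" "d b < d (Suc b)" and a: "a \<noteq> b" "a \<noteq> Suc b"
  shows "h b + (int a - int b) * d b < h a"
proof (cases "a < b")
  case True
  have "h (b - 1) + (int a - int (b - 1)) * d (b - 1) \<le> h a" using tangent_le[OF h d] .
  moreover have "h b = h (b - 1) + d (b - 1)" using h[of "b - 1"] b by simp
  moreover have "(int a - int b) * d b < (int a - int b) * d (b - 1)"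
    using True b by (intro mult_strict_left_mono_neg) auto
  ultimately show ?thesis using b by (simp add: algebra_simps of_nat_diff)
next
  case False
  then have "Suc b < a" using a by simp
  have "h (Suc b) + (int a - int (Suc b)) * d (Suc b) \<le> h a" using tangent_le[OF h d] .
  moreover have "(int a - int (Suc b)) * d b < (int a - int (Suc b)) * d (Suc b)"
    using \<open>Suc b < a\<close> b by (intro mult_strict_left_mono) auto
  ultimately show ?thesis using h[of b] by (simp add: algebra_simps)
qed

abbreviation rescls :: "nat \<Rightarrow> nat \<Rightarrow> nat \<Rightarrow> nat set" where
  "rescls n m i \<equiv> {x \<in> {..<n}. x mod m = i}"

lemma card_residue_class:
  assumes "i < m"
  shows "card (rescls n m i) = n div m + (if i < n mod m then 1 else 0)"
proof (induction n)
  case 0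
  then show ?case by simp
next
  case (Suc n)
  have "rescls (Suc n) m i =
      (if n mod m = i then insert n (rescls n m i) else rescls n m i)"
    by (auto simp: less_Suc_eq)
  then have "card (rescls (Suc n) m i) = card (rescls n m i) + (if n mod m = i then 1 else 0)"
    by simp
  moreover have "n mod m < m" using assms by simp
  ultimately show ?case using Suc assms by (auto simp: mod_Suc div_Suc)
qed

text \<open>Falling factorial, the number of injections of a \<open>t\<close>-set into an
  \<open>a\<close>-set. For \<open>a < t\<close> truncated subtraction produces a factor 0.\<close>

definition ffall :: "nat \<Rightarrow> nat \<Rightarrow> nat" where
  "ffall t a = (\<Prod>i<t. a - i)"

lemma ffall_Suc_Suc: "ffall (Suc t) (Suc a) = ffall (Suc t) a + Suc t * ffall t a"
proof -
  have "ffall (Suc t) (Suc a) = Suc a * ffall t a"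
    unfolding ffall_def by (subst prod.lessThan_Suc_shift) simp
  moreover have "ffall (Suc t) a = ffall t a * (a - t)" by (simp add: ffall_def)
  moreover have "ffall t a = 0" if "a < t"
    unfolding ffall_def using that by (intro prod_zero) auto
  ultimately show ?thesis by (cases "a < t") (auto simp: algebra_simps)
qed

lemma mono_ffall: "mono (ffall t)"
  unfolding ffall_def by (intro monoI prod_mono) auto

lemma ffall_strict: "0 < t \<Longrightarrow> t \<le> Suc a \<Longrightarrow> ffall t a < ffall t (Suc a)"
  unfolding ffall_def by (intro prod_mono_strict[of 0]) auto

lemma ffall_le: "ffall t a \<le> a ^ t"
proof -
  have "ffall t a \<le> (\<Prod>i<t. a)" unfolding ffall_def by (intro prod_mono) auto
  then show ?thesis by simp
qed

lemma ffall_tangent: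
  assumes t: "2 \<le> t"
  shows "int (ffall t b) + (int a - int b) * int (t * ffall (t - 1) b) \<le> int (ffall t a)"
    and "t \<le> b \<Longrightarrow> a \<noteq> b \<Longrightarrow> a \<noteq> Suc b \<Longrightarrow>
      int (ffall t b) + (int a - int b) * int (t * ffall (t - 1) b) < int (ffall t a)"
proof -
  define h d where "h = (\<lambda>a. int (ffall t a))" and "d = (\<lambda>a. int (t * ffall (t - 1) a))"
  have h: "h (Suc a) = h a + d a" for a
    using ffall_Suc_Suc[of "t - 1" a] t by (simp add: h_def d_def)
  have "ffall (t - 1) x \<le> ffall (t - 1) y" if "x \<le> y" for x y
    using mono_ffall that by (rule monoD)
  then have d: "mono d" unfolding d_def by (intro monoI of_nat_mono mult_le_mono2)
  show "int (ffall t b) + (int a - int b) * int (t * ffall (t - 1) b) \<le> int (ffall t a)"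
    using tangent_le[of h d, OF h d] by (simp add: h_def d_def)
  assume b: "t \<le> b" "a \<noteq> b" "a \<noteq> Suc b"
  have "d (b - 1) < d b" "d b < d (Suc b)"
    using ffall_strict[of "t - 1" "b - 1"] ffall_strict[of "t - 1" b] t b
    by (simp_all add: d_def del: of_nat_mult)
  then show "int (ffall t b) + (int a - int b) * int (t * ffall (t - 1) b) < int (ffall t a)"
    using tangent_less[of h d, OF h d, of b a] t b by (simp add: h_def d_def)
qed

context clique_pendants
begin

abbreviation injs :: "nat set \<Rightarrow> ('a \<Rightarrow> nat) set" where
  "injs A \<equiv> {\<phi> \<in> V \<rightarrow>\<^sub>E A. inj_on \<phi> V}"

lemma card_inj_into:
  assumes "finite A"
  shows "card (injs A) = ffall t (card A)"
  using card_inj_on_subset_funcset[OF finV assms order_refl]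
  by (simp add: ffall_def atLeast0LessThan)

lemma finite_inj_into: "finite A \<Longrightarrow> finite (injs A)"
  using finite_PiE[OF finV, of "\<lambda>_. A"] by simp

lemma t2: "2 \<le> t" using t_eq k2 by simp

text \<open>The graph is connected, so after \<open>a\<close> and \<open>b\<close> its vertices can
  be ordered such that each is adjacent to an earlier one and has at most \<open>D\<close> possible
  images. The trivial bound \<open>n ^ (t - 2)\<close> would be too weak for recoloring an
  edge.\<close>

lemma emb_two_points:
  assumes ab: "a \<in> V" "b \<in> V" "a \<noteq> b" and D: "\<And>w. w < n \<Longrightarrow> cdeg g n c w \<le> D"
  shows "card {\<phi> \<in> emb n g c. \<phi> a = u \<and> \<phi> b = v} \<le> D ^ (t - 2)"
proof -
  define X where "X = {\<phi> \<in> emb n g c. \<phi> a = u \<and> \<phi> b = v}"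
  have finX: "finite X" by (simp add: X_def)
  define R where "R = (\<lambda>S. (\<lambda>\<phi>. restrict \<phi> S) ` X)"
  have "\<exists>S. {a, b} \<subseteq> S \<and> S \<subseteq> V \<and> card S = 2 + j \<and> card (R S) \<le> D ^ j" if "j \<le> t - 2" for j
    using that
  proof (induction j)
    case 0
    have "R {a, b} \<subseteq> {\<lambda>x\<in>{a, b}. if x = a then u else v}"
      using ab by (auto simp: R_def X_def restrict_def)
    then have "card (R {a, b}) \<le> card {\<lambda>x\<in>{a, b}. if x = a then u else v}"
      by (intro card_mono) auto
    then show ?case using ab by (intro exI[of _ "{a, b}"]) auto
  next
    case (Suc j)
    then obtain S where S: "{a, b} \<subseteq> S" "S \<subseteq> V" "card S = 2 + j" "card (R S) \<le> D ^ j" by auto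
    have finS: "finite S" using S(2) finV by (rule finite_subset)
    have "S \<noteq> V" using S Suc.prems t2 by auto
    then obtain z where z: "z \<in> V" "z \<notin> S" using S by blast
    \<comment> \<open>An edge leaves \<open>S\<close>: if the core lies in \<open>S\<close>, a
      missing pendant vertex has its parent there; otherwise \<open>a\<close> leads to a missing
      core vertex directly or through its parent.\<close>
    have "\<exists>x\<in>V - S. \<exists>y\<in>S. {x, y} \<in> E"
    proof (cases "K \<subseteq> S")
      case True
      then have "z \<in> V - K" using z by auto
      then show ?thesis using par[of z] True z by (auto simp: E_eq)
    next
      case False
      then obtain x where x: "x \<in> K" "x \<notin> S" by auto
      show ?thesis
      proof (cases "a \<in> K")
        case True
        then have "{x, a} \<in> E" using x S by (auto simp: E_eq)
        then show ?thesis using x S KV by auto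
      next
        case False
        then have p: "par a \<in> K" "{par a, a} \<in> E" using ab par by (auto simp: E_eq insert_commute)
        show ?thesis
        proof (cases "par a \<in> S")
          case True
          then have "{x, par a} \<in> E" using x p by (auto simp: E_eq)
          then show ?thesis using x True KV by blast
        next
          case False
          then show ?thesis using p S KV by blast
        qed
      qed
    qed
    then obtain x y where xy: "x \<in> V" "x \<notin> S" "y \<in> S" "{x, y} \<in> E" by blast
    have finR: "finite (R S)" using finX by (simp add: R_def)
    have "card (R (insert x S)) \<le> card (Sigma (R S) (\<lambda>\<psi>. nbrs g n {c} (\<psi> y)))"
    proof (rule card_inj_on_le[of "\<lambda>\<psi>. (restrict \<psi> S, \<psi> x)"])
      show "inj_on (\<lambda>\<psi>. (restrict \<psi> S, \<psi> x)) (R (insert x S))"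
      proof (rule inj_onI, rule ext)
        fix \<psi> \<psi>' w assume *: "\<psi> \<in> R (insert x S)" "\<psi>' \<in> R (insert x S)"
          "(restrict \<psi> S, \<psi> x) = (restrict \<psi>' S, \<psi>' x)"
        show "\<psi> w = \<psi>' w"
        proof (cases "w \<in> S")
          case True
          then show ?thesis using * by (metis prod.inject restrict_apply')
        next
          case False
          then show ?thesis using * by (cases "w = x") (auto simp: R_def)
        qed
      qed
      show "(\<lambda>\<psi>. (restrict \<psi> S, \<psi> x)) ` R (insert x S) \<subseteq> Sigma (R S) (\<lambda>\<psi>. nbrs g n {c} (\<psi> y))"
      proof (rule image_subsetI)
        fix \<psi> assume "\<psi> \<in> R (insert x S)"
        then obtain \<phi> where \<phi>: "\<phi> \<in> X" "\<psi> = restrict \<phi> (insert x S)" by (auto simp: R_def)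
        have \<phi>e: "inj_on \<phi> V" "\<phi> \<in> V \<rightarrow>\<^sub>E {..<n}" "g (\<phi> ` {x, y}) = c"
          using \<phi>(1) xy(4) unfolding X_def emb_def by blast+
        have yV: "y \<in> V" "y \<noteq> x" using xy S by auto
        have "\<phi> x \<in> nbrs g n {c} (\<phi> y)"
          using \<phi>e xy(1) yV by (auto simp: nbrs_def insert_commute dest: inj_onD)
        moreover have "restrict \<psi> S = restrict \<phi> S" using \<phi>(2) by (auto simp: restrict_def)
        ultimately show "(restrict \<psi> S, \<psi> x) \<in> Sigma (R S) (\<lambda>\<psi>. nbrs g n {c} (\<psi> y))"
          using \<phi> xy(3) by (auto simp: R_def)
      qed
    qed (use finR in auto)
    also have "\<dots> = (\<Sum>\<psi>\<in>R S. cdeg g n c (\<psi> y))" using finR by (intro card_SigmaI) auto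
    also have "\<dots> \<le> (\<Sum>\<psi>\<in>R S. D)"
    proof (intro sum_mono)
      fix \<psi> assume "\<psi> \<in> R S"
      then obtain \<phi> where "\<phi> \<in> X" "\<psi> = restrict \<phi> S" by (auto simp: R_def)
      then have "\<psi> y < n" using xy S by (auto simp: X_def emb_def)
      then show "cdeg g n c (\<psi> y) \<le> D" by (rule D)
    qed
    also have "\<dots> \<le> D ^ j * D" using S(4) by simp
    finally have "card (R (insert x S)) \<le> D ^ Suc j" by (simp add: mult.commute)
    moreover have "card (insert x S) = 2 + Suc j" using finS S(3) xy by simp
    ultimately show ?case using S xy by (intro exI[of _ "insert x S"]) auto
  qed
  from this[of "t - 2"] obtain S where S: "S \<subseteq> V" "card S = t" "card (R S) \<le> D ^ (t - 2)"
    using t2 by auto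
  then have "S = V" using finV card_subset_eq by blast
  moreover have "R V = X"
  proof -
    have "restrict \<phi> V = \<phi>" if "\<phi> \<in> X" for \<phi>
      using that by (auto simp: X_def emb_def PiE_restrict)
    then show ?thesis by (force simp: R_def)
  qed
  ultimately show ?thesis using S by (simp add: X_def)
qed

text \<open>Recoloring the edge \<open>{u, v}\<close> to color \<open>c\<close> destroys all copies having \<open>{u, v}\<close> in the core.\<close>

lemma minimizer_pair:
  assumes f: "minimizer n f" and uv: "u < n" "v < n" "u \<noteq> v" and d: "f {u, v} = d" "d \<noteq> c" "c < 3"
    and k3: "3 \<le> k" and D: "\<And>w. w < n \<Longrightarrow> cdeg f n c w \<le> D"
  shows "card {\<phi> \<in> emb n f d. {u, v} \<subseteq> \<phi> ` K} \<le> t * t * (D + 1) ^ (t - 2)"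
proof -
  define g where "g = f({u, v} := c)"
  have fcol: "f \<in> colorings3 n" using f by (simp add: minimizer_def)
  then have "g \<in> colorings3 n" using d by (auto simp: g_def colorings3_def Pi_iff)
  then have le: "card (embs n f) \<le> card (embs n g)" using f by (simp add: minimizer_def)
  have d3: "d < 3"
  proof -
    have "{u, v} \<in> [{..<n}]\<^bsup>2\<^esup>" using uv by simp
    then show ?thesis using fcol d unfolding colorings3_def by blast
  qed
  define X where "X = {\<phi> \<in> emb n f d. {u, v} \<subseteq> \<phi> ` K}"
  have "X \<subseteq> embs n f - embs n g"
  proof
    fix \<phi> assume "\<phi> \<in> X"
    then have \<phi>: "\<phi> \<in> emb n f d" "u \<in> \<phi> ` K" "v \<in> \<phi> ` K" by (auto simp: X_def)
    then obtain x y where xy: "x \<in> K" "y \<in> K" "u = \<phi> x" "v = \<phi> y" by auto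
    \<comment> \<open>A third core vertex provides an edge that keeps color \<open>d\<close> while
      \<open>{u, v}\<close> now has color \<open>c\<close>, so the copy is no longer
      monochromatic.\<close>
    have "\<not> K \<subseteq> {x, y}" using cardK k3 card_mono[of "{x, y}" K] by (auto simp: card_insert_if split: if_splits)
    then obtain z where z: "z \<in> K" "z \<noteq> x" "z \<noteq> y" by auto
    have inj: "inj_on \<phi> V" using \<phi> by (simp add: emb_def)
    have "\<phi> z \<noteq> u" "\<phi> z \<noteq> v" using inj_onD[OF inj] z xy KV by auto
    then have "{\<phi> x, \<phi> z} \<noteq> {u, v}" by auto
    moreover have "x \<noteq> y" using xy uv by auto
    moreover have "f {\<phi> x, \<phi> z} = d" using \<phi>(1) xy z by (auto simp: emb_iff)
    ultimately have gz: "g {\<phi> x, \<phi> z} = d" "g {\<phi> x, \<phi> y} = c"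
      using xy by (auto simp: g_def)
    have "\<phi> \<notin> emb n g c'" for c'
    proof
      assume "\<phi> \<in> emb n g c'"
      then have gK: "g {\<phi> x, \<phi> y} = c'" if "x \<in> K" "y \<in> K" "x \<noteq> y" for x y
        using that by (simp add: emb_iff)
      show False
        using gK[OF xy(1) z(1) z(2)[symmetric]] gK[OF xy(1,2) \<open>x \<noteq> y\<close>] gz d(2) by simp
    qed
    then show "\<phi> \<in> embs n f - embs n g" using \<phi>(1) d3 by (auto simp: embs_def)
  qed
  then have "card X \<le> card (embs n f - embs n g)" by (intro card_mono) auto
  \<comment> \<open>Minimality: both differences remove the same intersection, so at least as many
    embeddings appear as disappear.\<close>
  also have "\<dots> \<le> card (embs n g - embs n f)"
  proof -
    have "card (embs n h - embs n h') = card (embs n h) - card (embs n f \<inter> embs n g)"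
      if "embs n h \<inter> embs n h' = embs n f \<inter> embs n g" for h h'
      using that card_Diff_subset_Int[of "embs n h" "embs n h'"] by simp
    from this[of f g] this[of g f] show ?thesis using le by (simp add: Int_commute)
  qed
  also have "\<dots> \<le> t * t * (D + 1) ^ (t - 2)"
  proof (rule card_pairs_le)
    show "embs n g - embs n f \<subseteq> (\<Union>(a, b)\<in>{(a, b) \<in> V \<times> V. a \<noteq> b}. {\<phi> \<in> emb n g c. \<phi> a = u \<and> \<phi> b = v})"
    proof
      fix \<phi> assume \<phi>: "\<phi> \<in> embs n g - embs n f"
      then obtain c' where c': "c' < 3" "\<phi> \<in> emb n g c'" "\<phi> \<notin> emb n f c'" by (auto simp: embs_def)
      then obtain e where e: "e \<in> E" "f (\<phi> ` e) \<noteq> c'" "g (\<phi> ` e) = c'" by (auto simp: emb_def)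
      then have im: "\<phi> ` e = {u, v}" "c' = c" by (auto simp: g_def split: if_splits)
      then obtain a b where ab: "a \<in> e" "b \<in> e" "\<phi> a = u" "\<phi> b = v"
        by (metis imageE insertCI)
      then have "a \<in> V" "b \<in> V" "a \<noteq> b" using E_subset[OF e(1)] uv by auto
      then show "\<phi> \<in> (\<Union>(a, b)\<in>{(a, b) \<in> V \<times> V. a \<noteq> b}. {\<phi> \<in> emb n g c. \<phi> a = u \<and> \<phi> b = v})"
        using ab c' im by auto
    qed
    fix a b assume ab: "a \<in> V" "b \<in> V" "a \<noteq> b"
    have "cdeg g n c w \<le> D + 1" if "w < n" for w
    proof -
      define w' where "w' = (if w = u then v else u)"
      have "nbrs g n {c} w \<subseteq> insert w' (nbrs f n {c} w)"
        by (auto simp: nbrs_def g_def w'_def doubleton_eq_iff split: if_splits)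
      then have "cdeg g n c w \<le> card (insert w' (nbrs f n {c} w))" by (intro card_mono) auto
      also have "\<dots> \<le> Suc (cdeg f n c w)" by (rule card_insert_le_m1) auto
      finally show ?thesis using D[OF that] by simp
    qed
    then show "finite {\<phi> \<in> emb n g c. \<phi> a = u \<and> \<phi> b = v} \<and>
        card {\<phi> \<in> emb n g c. \<phi> a = u \<and> \<phi> b = v} \<le> (D + 1) ^ (t - 2)"
      using ab by (intro conjI emb_two_points) auto
  qed
  finally show ?thesis by (simp add: X_def)
qed

subsection \<open>Ramsey blowups\<close>

text \<open>A 2-coloring on \<open>m\<close> vertices without monochromatic \<open>k\<close>-clique
  is blown up along residues mod \<open>m\<close>, with color 2 inside the classes. In colors 0 and
  1 a core would project to a forbidden clique; in color 2 connectedness keeps the whole embedding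
  inside one class.\<close>

lemma blowup:
  assumes m: "0 < m" and nr: "\<not> partn_lst {..<m} [k, k] 2"
  obtains g where "g \<in> colorings3 n"
    "card (embs n g) \<le> (\<Sum>i<m. ffall t (card (rescls n m i)))"
proof -
  have "[k, k] ! i = k" if "i < 2" for i
    using that by (auto simp: less_2_cases_iff)
  then obtain \<chi> :: "nat set \<Rightarrow> nat" where \<chi>: "\<chi> \<in> [{..<m}]\<^bsup>2\<^esup> \<rightarrow> {..<2}"
      "\<And>i. i < 2 \<Longrightarrow> \<not> monochromatic {..<m} k 2 \<chi> i"
    using nr unfolding partn_lst_def by (auto simp: numeral_2_eq_2)
  define \<pi> where "\<pi> = (\<lambda>x. x mod m)"
  define g where "g = (\<lambda>e. if card (\<pi> ` e) = 1 then 2 else \<chi> (\<pi> ` e))"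
  have g2: "g {x, y} = (if \<pi> x = \<pi> y then 2 else \<chi> {\<pi> x, \<pi> y})" for x y
    by (auto simp: g_def card_insert_if)
  have \<chi>2: "\<chi> {\<pi> x, \<pi> y} < 2" if "\<pi> x \<noteq> \<pi> y" for x y
    using \<chi>(1) that m by (auto simp: \<pi>_def Pi_iff)
  have gcol: "g \<in> colorings3 n"
    unfolding colorings3_def
  proof
    fix e assume "e \<in> [{..<n}]\<^bsup>2\<^esup>"
    then obtain x y where "e = {x, y}" by (auto elim: nsets2_E)
    then show "g e \<in> {..<3}" using g2[of x y] \<chi>2[of x y] by auto
  qed
  have "embs n g \<subseteq> (\<Union>i<m. injs (rescls n m i))"
  proof
    fix \<phi> assume "\<phi> \<in> embs n g"
    then obtain c where c: "c < 3" "\<phi> \<in> emb n g c" by (auto simp: embs_def)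
    then have \<phi>: "\<phi> \<in> V \<rightarrow>\<^sub>E {..<n}" "inj_on \<phi> V"
      and gK: "\<And>x y. x \<in> K \<Longrightarrow> y \<in> K \<Longrightarrow> x \<noteq> y \<Longrightarrow> g {\<phi> x, \<phi> y} = c"
      and gP: "\<And>p. p \<in> V - K \<Longrightarrow> g {\<phi> p, \<phi> (par p)} = c"
      by (auto simp: emb_iff)
    have "c = 2"
    proof (rule ccontr)
      assume c2: "c \<noteq> 2"
      have ne: "\<pi> (\<phi> x) \<noteq> \<pi> (\<phi> y)" if "x \<in> K" "y \<in> K" "x \<noteq> y" for x y
        using gK[OF that] c2 by (auto simp: g2)
      define H where "H = (\<lambda>x. \<pi> (\<phi> x)) ` K"
      have "inj_on (\<lambda>x. \<pi> (\<phi> x)) K" using ne by (auto simp: inj_on_def)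
      then have "H \<in> [{..<m}]\<^bsup>k\<^esup>"
        using m finK cardK by (auto simp: nsets_def H_def card_image \<pi>_def)
      moreover have "\<chi> ` [H]\<^bsup>2\<^esup> \<subseteq> {c}"
      proof (rule image_subsetI)
        fix e assume "e \<in> [H]\<^bsup>2\<^esup>"
        then obtain a b where "e = {a, b}" "a \<in> H" "b \<in> H" "a \<noteq> b" by (auto elim: nsets2_E)
        then obtain x y where xy: "x \<in> K" "y \<in> K" "x \<noteq> y" "e = {\<pi> (\<phi> x), \<pi> (\<phi> y)}"
          by (auto simp: H_def)
        then show "\<chi> e \<in> {c}" using gK[OF xy(1-3)] ne[OF xy(1-3)] by (simp add: g2)
      qed
      ultimately have "monochromatic {..<m} k 2 \<chi> c" unfolding monochromatic_def by blast
      then show False using \<chi>(2)[of c] c c2 by simp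
    qed
    have K2: "\<pi> (\<phi> x) = \<pi> (\<phi> y)" if "x \<in> K" "y \<in> K" for x y
      using gK[OF that] \<chi>2[of "\<phi> x" "\<phi> y"] \<open>c = 2\<close> by (cases "x = y") (auto simp: g2 split: if_splits)
    have P2: "\<pi> (\<phi> p) = \<pi> (\<phi> (par p))" if "p \<in> V - K" for p
      using gP[OF that] \<chi>2[of "\<phi> p" "\<phi> (par p)"] \<open>c = 2\<close> by (auto simp: g2 split: if_splits)
    have "K \<noteq> {}" using cardK k2 by auto
    then obtain z where z: "z \<in> K" by blast
    have all: "\<pi> (\<phi> x) = \<pi> (\<phi> z)" if "x \<in> V" for x
    proof (cases "x \<in> K")
      case True
      then show ?thesis using z by (rule K2)
    next
      case False
      then have p: "x \<in> V - K" using that by simp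
      show ?thesis using P2[OF p] K2[OF par[OF p] z] by simp
    qed
    have "\<pi> (\<phi> z) < m" using m by (simp add: \<pi>_def)
    moreover have "\<phi> \<in> V \<rightarrow>\<^sub>E rescls n m (\<pi> (\<phi> z))"
      using \<phi>(1) all by (auto simp: \<pi>_def PiE_iff)
    ultimately show "\<phi> \<in> (\<Union>i<m. injs (rescls n m i))"
      using \<phi>(2) by blast
  qed
  then have "card (embs n g) \<le> card (\<Union>i<m. injs (rescls n m i))"
    by (intro card_mono finite_UN_I finite_inj_into) simp_all
  also have "\<dots> \<le> (\<Sum>i<m. card (injs (rescls n m i)))"
    by (rule card_UN_le) simp
  also have "\<dots> = (\<Sum>i<m. ffall t (card (rescls n m i)))"
    by (simp add: card_inj_into)
  finally have "card (embs n g) \<le> (\<Sum>i<m. ffall t (card (rescls n m i)))" .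
  then show thesis using that gcol by blast
qed

end

text \<open>Since the sizes \<open>a i\<close> have a fixed sum, adding up the tangents at
  \<open>b\<close> leaves an expression in \<open>n\<close> alone; equality forces every
  \<open>a i\<close> to be one of the two contact points.\<close>

lemma sum_tangent:
  fixes a :: "nat \<Rightarrow> nat"
  assumes t: "2 \<le> t" and n: "(\<Sum>i<m. a i) = n"
  shows "int m * int (ffall t b) + (int n - int m * int b) * int (t * ffall (t - 1) b)
      \<le> int (\<Sum>i<m. ffall t (a i))"
    and "t \<le> b \<Longrightarrow> int (\<Sum>i<m. ffall t (a i))
      \<le> int m * int (ffall t b) + (int n - int m * int b) * int (t * ffall (t - 1) b) \<Longrightarrow>
      i < m \<Longrightarrow> a i = b \<or> a i = Suc b"
proof -
  define T where "T = (\<lambda>x. int (ffall t b) + (int x - int b) * int (t * ffall (t - 1) b))"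
  have "(\<Sum>i<m. T (a i)) = int m * int (ffall t b) + (\<Sum>i<m. int (a i) - int b) * int (t * ffall (t - 1) b)"
    unfolding T_def sum.distrib sum_distrib_right by simp
  also have "(\<Sum>i<m. int (a i) - int b) = int n - int m * int b"
    unfolding sum_subtractf n[symmetric] by simp
  finally have T: "(\<Sum>i<m. T (a i)) =
      int m * int (ffall t b) + (int n - int m * int b) * int (t * ffall (t - 1) b)" .
  have le: "T x \<le> int (ffall t x)" for x
    unfolding T_def by (rule ffall_tangent[OF t])
  show "int m * int (ffall t b) + (int n - int m * int b) * int (t * ffall (t - 1) b)
      \<le> int (\<Sum>i<m. ffall t (a i))"
    unfolding T[symmetric] of_nat_sum by (intro sum_mono le)
  assume b: "t \<le> b" and le': "int (\<Sum>i<m. ffall t (a i))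
      \<le> int m * int (ffall t b) + (int n - int m * int b) * int (t * ffall (t - 1) b)" and i: "i < m"
  show "a i = b \<or> a i = Suc b"
  proof (rule ccontr)
    assume "\<not> ?thesis"
    then have "T (a i) < int (ffall t (a i))"
      unfolding T_def using ffall_tangent(2)[OF t b, of "a i"] by simp
    then have "(\<Sum>i<m. T (a i)) < (\<Sum>i<m. int (ffall t (a i)))"
      using i le by (intro sum_strict_mono_ex1) auto
    then show False using le' T by simp
  qed
qed

context clique_pendants
begin

lemma clique_partition_ge:
  fixes A :: "nat \<Rightarrow> nat set"
  assumes A: "disjoint_family_on A {..<m}" "(\<Union>i<m. A i) = {..<n}" "\<And>i. i < m \<Longrightarrow> mono_clique f c (A i)"
  defines "J \<equiv> (\<Union>i<m. injs (A i))"
  shows "J \<subseteq> emb n f c" "card J = (\<Sum>i<m. ffall t (card (A i)))"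
proof -
  have An: "A i \<subseteq> {..<n}" if "i < m" for i using A(2) that by blast
  then have finA: "finite (A i)" if "i < m" for i using that finite_subset by blast
  show "J \<subseteq> emb n f c"
  proof
    fix \<phi> assume "\<phi> \<in> J"
    then obtain i where i: "i < m" and \<phi>: "\<phi> \<in> V \<rightarrow>\<^sub>E A i" "inj_on \<phi> V" by (auto simp: J_def)
    have fc: "f {\<phi> x, \<phi> y} = c" if "x \<in> V" "y \<in> V" "x \<noteq> y" for x y
    proof -
      have "\<phi> x \<in> A i" "\<phi> y \<in> A i" "\<phi> x \<noteq> \<phi> y" using \<phi> that by (auto dest: inj_onD)
      then show ?thesis using A(3)[OF i] by (simp add: mono_clique_def)
    qed
    have "\<phi> \<in> V \<rightarrow>\<^sub>E {..<n}" using \<phi>(1) An[OF i] by (auto simp: PiE_iff)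
    then show "\<phi> \<in> emb n f c"
      unfolding emb_iff
    proof (intro conjI ballI impI)
      show "f {\<phi> x, \<phi> y} = c" if "x \<in> K" "y \<in> K" "x \<noteq> y" for x y
        using that KV by (intro fc) auto
      show "f {\<phi> p, \<phi> (par p)} = c" if p: "p \<in> V - K" for p
        using par[OF p] p KV by (intro fc) auto
    qed (use \<phi>(2) in auto)
  qed
  have "card J = (\<Sum>i<m. card (injs (A i)))"
    unfolding J_def
  proof (intro card_UN_disjoint ballI impI)
    fix i j assume ij: "i \<in> {..<m}" "j \<in> {..<m}" "i \<noteq> j"
    have "V \<noteq> {}" using t2 by auto
    then obtain z where z: "z \<in> V" by blast
    have "A i \<inter> A j = {}" using A(1) ij by (auto simp: disjoint_family_on_def)
    then have "\<phi> \<notin> V \<rightarrow>\<^sub>E A i \<or> \<phi> \<notin> V \<rightarrow>\<^sub>E A j" for \<phi>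
      using PiE_mem[OF _ z] by blast
    then show "injs (A i) \<inter> injs (A j) = {}"
      by blast
  qed (simp_all add: finA finite_inj_into)
  then show "card J = (\<Sum>i<m. ffall t (card (A i)))"
    using finA by (simp add: card_inj_into)
qed

text \<open>A chain of inequalities closes up: the cliques contain at least \<open>M\<close>
  embeddings, a blowup has at most \<open>M\<close>, and \<open>f\<close> is minimal. Hence the
  sizes are balanced and no embedding lies outside the cliques; each remaining defect would produce
  one.\<close>

lemma ramsey_blowup_like_of_partition:
  fixes A :: "nat \<Rightarrow> nat set"
  assumes f: "minimizer n f" and c: "c < 3" and m: "0 < m" "ramsey_number k k = Suc m"
    and A: "disjoint_family_on A {..<m}" "(\<Union>i<m. A i) = {..<n}" "\<And>i. i < m \<Longrightarrow> mono_clique f c (A i)"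
    and high: "\<And>v d. v < n \<Longrightarrow> d < 3 \<Longrightarrow> d \<noteq> c \<Longrightarrow> t < cdeg f n d v"
    and n: "t \<le> n div m" and q: "0 < q"
  shows "ramsey_blowup_like k n f"
proof -
  define b where "b = n div m"
  \<comment> \<open>The sum of the tangents at \<open>b\<close>. Balanced classes have sizes
    \<open>b\<close> and \<open>b + 1\<close>, where the tangent is exact.\<close>
  define M where "M = int m * int (ffall t b) + (int n - int m * int b) * int (t * ffall (t - 1) b)"
  have An: "A i \<subseteq> {..<n}" if "i < m" for i using A(2) that by blast
  then have finA: "finite (A i)" if "i < m" for i using that finite_subset by blast
  have "card (\<Union>i<m. A i) = (\<Sum>i<m. card (A i))"
    using A(1) finA by (intro card_UN_disjoint) (auto simp: disjoint_family_on_def)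
  then have sumA: "(\<Sum>i<m. card (A i)) = n" using A(2) by simp
  have nr: "\<not> partn_lst {..<m} [k, k] 2"
    using m(2) not_less_Least[of m "\<lambda>r. partn_lst {..<r} [k, k] 2"] by (simp add: ramsey_number_def)
  obtain g where g: "g \<in> colorings3 n"
      "card (embs n g) \<le> (\<Sum>i<m. ffall t (card (rescls n m i)))"
    using blowup[OF m(1) nr] by blast
  have "int (\<Sum>i<m. ffall t (card (rescls n m i))) = M"
  proof -
    have "int (ffall t (card (rescls n m i))) =
        int (ffall t b) + (int (card (rescls n m i)) - int b) * int (t * ffall (t - 1) b)"
      if "i < m" for i
      using card_residue_class[OF that, of n] ffall_Suc_Suc[of "t - 1" b] t2
      by (auto simp: b_def)
    then have "(\<Sum>i<m. int (ffall t (card (rescls n m i)))) =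
        (\<Sum>i<m. int (ffall t b) + (int (card (rescls n m i)) - int b) * int (t * ffall (t - 1) b))"
      by (intro sum.cong) auto
    also have "\<dots> = int m * int (ffall t b) +
        (\<Sum>i<m. int (card (rescls n m i)) - int b) * int (t * ffall (t - 1) b)"
      unfolding sum.distrib sum_distrib_right by simp
    also have "(\<Sum>i<m. int (card (rescls n m i)) - int b) =
        int (\<Sum>i<m. card (rescls n m i)) - int m * int b"
      unfolding sum_subtractf by simp
    also have "(\<Sum>i<m. card (rescls n m i)) = card (\<Union>i<m. rescls n m i)"
      by (intro card_UN_disjoint[symmetric]) auto
    also have "(\<Union>i<m. rescls n m i) = {..<n}" using m by auto
    finally show ?thesis by (simp add: M_def)
  qed
  then have gM: "int (card (embs n g)) \<le> M" using g(2) by linarith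
  define J where "J = (\<Union>i<m. injs (A i))"
  have J: "J \<subseteq> emb n f c" "card J = (\<Sum>i<m. ffall t (card (A i)))"
    unfolding J_def using clique_partition_ge[OF A] by auto
  have Jf: "J \<subseteq> embs n f" using J(1) c by (auto simp: embs_def)
  have "M \<le> int (\<Sum>i<m. ffall t (card (A i)))"
    unfolding M_def by (rule sum_tangent[OF t2 sumA])
  moreover have fg: "card (embs n f) \<le> card (embs n g)" using f g by (simp add: minimizer_def)
  moreover have "card J \<le> card (embs n f)" using Jf by (intro card_mono) auto
  ultimately have eq: "int (\<Sum>i<m. ffall t (card (A i))) \<le> M" "card (embs n f) \<le> card J"
    using gM J(2) by linarith+
  have fJ: "embs n f = J"
    using card_seteq[OF _ Jf eq(2)] by simp
  have b: "card (A i) = b \<or> card (A i) = Suc b" if "i < m" for i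
    by (rule sum_tangent(2)[OF t2 sumA _ _ that]) (use n eq(1) in \<open>auto simp: b_def M_def\<close>)
  have bal: "int (card (A i)) = \<lfloor>real n / real m\<rfloor> \<or> int (card (A i)) = \<lceil>real n / real m\<rceil>" if i: "i < m" for i
  proof (cases "card (A i) = b")
    case True
    then show ?thesis by (simp add: b_def floor_divide_of_nat_eq)
  next
    case False
    then have Suc: "card (A i) = Suc b" using b[OF i] by simp
    \<comment> \<open>A class of size \<open>b + 1\<close> occurs only if \<open>m\<close> does not
      divide \<open>n\<close>, and then the ceiling is \<open>b + 1\<close>.\<close>
    have "b \<le> card (A j)" if "j < m" for j using b[OF that] by auto
    moreover have "\<exists>j\<in>{..<m}. b < card (A j)" using i Suc by (intro bexI[of _ i]) auto
    ultimately have "(\<Sum>i<m. b) < (\<Sum>i<m. card (A i))"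
      by (intro sum_strict_mono_ex1) auto
    then have "m * b < n" using sumA by simp
    moreover have "n < m * Suc b" using dividend_less_times_div[OF m(1), of n] by (simp add: b_def)
    ultimately have "real b < real n / real m" "real n / real m \<le> real b + 1"
      using m(1) by (simp_all add: field_simps flip: of_nat_mult of_nat_add of_nat_Suc)
    then have "\<lceil>real n / real m\<rceil> = int b + 1" by (intro ceiling_unique) auto
    then show ?thesis using Suc by simp
  qed
  obtain p where p: "p \<in> V - K" using q by (metis card.empty ex_in_conv less_irrefl)
  have pp: "par p \<in> K" "par p \<in> V" "par p \<noteq> p" using par[OF p] p KV by auto
  have cross: "f {x, y} \<noteq> c" if ij: "i < m" "j < m" "i \<noteq> j" and xy: "x \<in> A i" "y \<in> A j" for i j x y
  proof
    assume fxy: "f {x, y} = c"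
    have "card (V - {par p}) \<le> card (A i - {x})"
      using b[OF ij(1)] n finA[OF ij(1)] finV pp xy by (auto simp: b_def)
    then obtain h where h: "h ` (V - {par p}) \<subseteq> A i - {x}" "inj_on h (V - {par p})"
      using card_le_inj[of "V - {par p}" "A i - {x}"] finV finA[OF ij(1)] by auto
    \<comment> \<open>The crossing edge carries the pendant edge at \<open>p\<close>, and all other
      vertices go into \<open>A i\<close>; the result is an embedding outside
      \<open>J\<close>.\<close>
    define \<phi> where "\<phi> = (\<lambda>z\<in>V. if z = p then y else if z = par p then x else h z)"
    have disj: "A i \<inter> A j = {}" using A(1) ij by (auto simp: disjoint_family_on_def)
    then have ne: "x \<noteq> y" using xy by auto
    have Ai: "\<phi> z \<in> A i" if "z \<in> V" "z \<noteq> p" for z using that h xy by (auto simp: \<phi>_def)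
    have \<phi>p: "\<phi> p = y" "\<phi> (par p) = x" using p pp by (auto simp: \<phi>_def)
    have inj': "\<phi> z \<noteq> \<phi> w" if "z \<in> V" "w \<in> V" "z \<noteq> w" "z \<noteq> p" "w \<noteq> p" for z w
    proof -
      have "h z \<noteq> h w" if "z \<noteq> par p" "w \<noteq> par p"
        using that \<open>z \<in> V\<close> \<open>w \<in> V\<close> \<open>z \<noteq> w\<close> h(2) by (auto dest: inj_onD)
      moreover have "h z \<noteq> x" if "z \<noteq> par p" using that \<open>z \<in> V\<close> h(1) by auto
      moreover have "h w \<noteq> x" if "w \<noteq> par p" using that \<open>w \<in> V\<close> h(1) by auto
      ultimately show ?thesis using that by (auto simp: \<phi>_def)
    qed
    have inj: "inj_on \<phi> V"
    proof (rule inj_onI)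
      fix z w assume zw: "z \<in> V" "w \<in> V" "\<phi> z = \<phi> w"
      show "z = w"
      proof (rule ccontr)
        assume "z \<noteq> w"
        then consider "z = p" "w \<noteq> p" | "w = p" "z \<noteq> p" | "z \<noteq> p" "w \<noteq> p" by auto
        then show False
          using inj'[OF zw(1,2) \<open>z \<noteq> w\<close>] Ai[OF zw(1)] Ai[OF zw(2)] \<phi>p(1) disj xy(2) zw(3)
          by cases auto
      qed
    qed
    have fc: "f {\<phi> z, \<phi> w} = c" if "z \<in> V" "w \<in> V" "z \<noteq> w" "z \<noteq> p" "w \<noteq> p" for z w
      using A(3)[OF ij(1)] Ai[OF that(1,4)] Ai[OF that(2,5)] inj'[OF that] by (simp add: mono_clique_def)
    have "\<phi> \<in> emb n f c"
      unfolding emb_iff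
    proof (intro conjI ballI impI)
      show "\<phi> \<in> V \<rightarrow>\<^sub>E {..<n}"
      proof (rule PiE_I)
        fix z assume "z \<in> V"
        then show "\<phi> z \<in> {..<n}"
          using Ai[of z] An ij xy(2) \<phi>p by (cases "z = p") auto
      qed (simp add: \<phi>_def)
      show "f {\<phi> z, \<phi> w} = c" if "z \<in> K" "w \<in> K" "z \<noteq> w" for z w
        using that KV p by (intro fc) auto
      show "f {\<phi> z, \<phi> (par z)} = c" if z: "z \<in> V - K" for z
      proof (cases "z = p")
        case True
        then show ?thesis using \<phi>p fxy by (simp add: insert_commute)
      next
        case False
        then show ?thesis using z par[OF z] KV p by (intro fc) auto
      qed
    qed (rule inj)
    then have "\<phi> \<in> J" using fJ c by (auto simp: embs_def)
    then obtain l where l: "l < m" "\<phi> \<in> V \<rightarrow>\<^sub>E A l" by (auto simp: J_def)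
    have "x \<in> A l" "y \<in> A l" using PiE_mem[OF l(2)] \<phi>p p pp by force+
    then have "l = i" "l = j"
      using A(1) xy ij l(1) by (auto simp: disjoint_family_on_def)
    then show False using ij by simp
  qed
  have edges: "{e \<in> [{..<n}]\<^bsup>2\<^esup>. f e = c} = (\<Union>i<m. [A i]\<^bsup>2\<^esup>)"
  proof (intro set_eqI iffI)
    fix e assume "e \<in> {e \<in> [{..<n}]\<^bsup>2\<^esup>. f e = c}"
    then obtain x y where e: "e = {x, y}" "x < n" "y < n" "x \<noteq> y" "f {x, y} = c"
      by (auto elim!: nsets2_E)
    then obtain i j where "i < m" "j < m" "x \<in> A i" "y \<in> A j" using A(2) by (metis UN_E lessThan_iff)
    moreover from this have "i = j" using cross[of i j x y] e by blast
    ultimately show "e \<in> (\<Union>i<m. [A i]\<^bsup>2\<^esup>)" using e by auto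
  next
    fix e assume "e \<in> (\<Union>i<m. [A i]\<^bsup>2\<^esup>)"
    then obtain i where i: "i < m" "e \<in> [A i]\<^bsup>2\<^esup>" by auto
    then obtain x y where e: "e = {x, y}" "x \<in> A i" "y \<in> A i" "x \<noteq> y" by (auto elim!: nsets2_E)
    then show "e \<in> {e \<in> [{..<n}]\<^bsup>2\<^esup>. f e = c}"
      using A(3)[OF i(1)] An[OF i(1)] by (auto simp: mono_clique_def)
  qed
  have no: "\<not> monochromatic {..<n} k 2 f d" if d: "d < 3" "d \<noteq> c" for d
  proof
    assume "monochromatic {..<n} k 2 f d"
    then obtain Q where Q: "Q \<in> [{..<n}]\<^bsup>k\<^esup>" "f ` [Q]\<^bsup>2\<^esup> \<subseteq> {d}" by (auto simp: monochromatic_def)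
    have Qn: "Q \<subseteq> {..<n}" "card Q = k" "finite Q" using Q by (auto simp: nsets_def)
    have mono: "mono_clique f d Q"
      unfolding mono_clique_def
    proof (intro ballI impI)
      fix u v assume "u \<in> Q" "v \<in> Q" "u \<noteq> v"
      then have "{u, v} \<in> [Q]\<^bsup>2\<^esup>" by simp
      then show "f {u, v} = d" using Q(2) by blast
    qed
    obtain \<sigma> where \<sigma>: "bij_betw \<sigma> K Q"
      using finite_same_card_bij[OF finK Qn(3)] cardK Qn(2) by auto
    \<comment> \<open>All degrees in color \<open>d\<close> exceed \<open>t\<close>, so the clique
      \<open>Q\<close> extends to an embedding of color \<open>d\<close>, which cannot belong to
      \<open>J\<close>.\<close>
    have pos: "0 < (\<Prod>z\<in>V - K. cdeg f n d (\<sigma> (par z)) - t)"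
    proof (intro prod_pos)
      fix z assume "z \<in> V - K"
      then have "\<sigma> (par z) \<in> Q" using par \<sigma> by (auto simp: bij_betw_def)
      then show "0 < cdeg f n d (\<sigma> (par z)) - t" using high[of "\<sigma> (par z)" d] d Qn by auto
    qed
    have "card {\<phi> \<in> emb n f d. \<forall>x\<in>K. \<phi> x = \<sigma> x} \<noteq> 0"
      using extend_clique[OF \<sigma> Qn(1) mono] pos by linarith
    then obtain \<phi> where \<phi>: "\<phi> \<in> emb n f d" by (metis (no_types, lifting) card.empty empty_Collect_eq)
    then have "\<phi> \<in> emb n f c" using fJ J(1) d by (auto simp: embs_def)
    then show False using \<phi> p d by (auto simp: emb_iff)
  qed
  show ?thesis
    unfolding ramsey_blowup_like_def Let_def m(2) diff_Suc_1
    using c A(1,2) bal edges no by blast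
qed

end

subsection \<open>Light sets\<close>

text \<open>Members of \<open>F\<close> are never light, yet all but few vertices can be added to a small light set,
  so a greedy choice of vertices can avoid \<open>F\<close> altogether.\<close>

definition light :: "nat set set \<Rightarrow> real \<Rightarrow> nat \<Rightarrow> nat set \<Rightarrow> bool" where
  "light F x k T \<longleftrightarrow> (\<forall>S\<subseteq>T. card S \<le> k \<longrightarrow> real (card {Q \<in> F. S \<subseteq> Q}) < x ^ (k - card S))"

lemma not_light_superset:
  assumes "light F x k T" "finite F" "Q \<in> F" "card Q = k" "Q \<subseteq> T"
  shows False
proof -
  have "real (card {P \<in> F. Q \<subseteq> P}) < x ^ (k - card Q)"
    using assms(1,4,5) unfolding light_def by (metis order_refl)
  moreover have "Q \<in> {P \<in> F. Q \<subseteq> P}" "finite {P \<in> F. Q \<subseteq> P}" using assms(2,3) by simp_all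
  then have "0 < card {P \<in> F. Q \<subseteq> P}" by (metis card_gt_0_iff empty_iff)
  ultimately show False using assms(4) by simp
qed

text \<open>Markov for each \<open>S\<close> in \<open>T\<close>: every member of \<open>F\<close>
  over \<open>S\<close> has only \<open>k\<close> elements, so at most \<open>k * x\<close> vertices
  \<open>w\<close> make \<open>insert w S\<close> too heavy. There are at most
  \<open>2 ^ card T\<close> sets \<open>S\<close>, and a new violation must involve
  \<open>w\<close>.\<close>

lemma light_extend_heavy:
  fixes x :: real
  assumes F: "finite F" "\<And>Q. Q \<in> F \<Longrightarrow> Q \<subseteq> {..<n} \<and> card Q = k" and x: "0 < x"
    and T: "light F x k T" "T \<subseteq> {..<n}"
  shows "real (card {w \<in> {..<n}. w \<in> T \<or> \<not> light F x k (insert w T)}) \<le> card T + 2 ^ card T * (k * x)"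
proof -
  define deg where "deg = (\<lambda>S. card {Q \<in> F. S \<subseteq> Q})"
  define bad where "bad = (\<lambda>S. {w \<in> {..<n}. w \<notin> S \<and> x ^ (k - Suc (card S)) \<le> deg (insert w S)})"
  define \<S> where "\<S> = {S. S \<subseteq> T \<and> card S < k}"
  have finT: "finite T" using T(2) by (rule finite_subset) simp
  have fin\<S>: "finite \<S>" unfolding \<S>_def using finT by simp
  have bad: "card (bad S) \<le> k * x" if S: "S \<in> \<S>" for S
  proof -
    have finS: "finite S" using S finT finite_subset by (auto simp: \<S>_def)
    have Sk: "card S < k" using S by (simp add: \<S>_def)
    have "card (bad S) * x ^ (k - Suc (card S)) = (\<Sum>w\<in>bad S. x ^ (k - Suc (card S)))" by simp
    also have "\<dots> \<le> (\<Sum>w\<in>bad S. real (deg (insert w S)))"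
      by (intro sum_mono) (auto simp: bad_def)
    also have "\<dots> = real (\<Sum>w\<in>bad S. deg (insert w S))" by simp
    also have "(\<Sum>w\<in>bad S. deg (insert w S)) = (\<Sum>w\<in>bad S. card {Q \<in> {Q \<in> F. S \<subseteq> Q}. w \<in> Q})"
      unfolding deg_def by (intro sum.cong refl arg_cong[of _ _ card]) auto
    also have "\<dots> = (\<Sum>Q\<in>{Q \<in> F. S \<subseteq> Q}. card {w \<in> bad S. w \<in> Q})"
      using F(1) by (intro sum_card_swap) (auto simp: bad_def)
    also have "\<dots> \<le> (\<Sum>Q\<in>{Q \<in> F. S \<subseteq> Q}. k)"
    proof (intro sum_mono)
      fix Q assume "Q \<in> {Q \<in> F. S \<subseteq> Q}"
      then have "card Q = k" "finite Q" using F(2)[of Q] finite_subset by auto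
      then show "card {w \<in> bad S. w \<in> Q} \<le> k" using card_mono[of Q "{w \<in> bad S. w \<in> Q}"] by auto
    qed
    also have "\<dots> = deg S * k" by (simp add: deg_def)
    finally have "card (bad S) * x ^ (k - Suc (card S)) \<le> real (deg S) * k" by simp
    also have "\<dots> \<le> x ^ (k - card S) * k"
      using T(1) S Sk by (intro mult_right_mono) (auto simp: light_def deg_def \<S>_def less_imp_le)
    also have "x ^ (k - card S) = x * x ^ (k - Suc (card S))"
      using Sk by (metis Suc_diff_Suc power_Suc)
    finally have "card (bad S) * x ^ (k - Suc (card S)) \<le> (k * x) * x ^ (k - Suc (card S))"
      by (simp add: mult_ac)
    then show ?thesis using x by (subst (asm) mult_le_cancel_right) auto
  qed
  have sub: "{w \<in> {..<n}. w \<in> T \<or> \<not> light F x k (insert w T)} \<subseteq> T \<union> (\<Union>S\<in>\<S>. bad S)"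
  proof
    fix w assume w: "w \<in> {w \<in> {..<n}. w \<in> T \<or> \<not> light F x k (insert w T)}"
    show "w \<in> T \<union> (\<Union>S\<in>\<S>. bad S)"
    proof (cases "w \<in> T")
      case False
      then obtain S where S: "S \<subseteq> insert w T" "card S \<le> k" "x ^ (k - card S) \<le> deg S"
        using w by (auto simp: light_def deg_def not_less)
      have finS: "finite S" using S(1) finT finite_subset by auto
      have wS: "w \<in> S"
      proof (rule ccontr)
        assume "w \<notin> S"
        then have "S \<subseteq> T" using S(1) by auto
        then show False using T(1) S by (auto simp: light_def deg_def)
      qed
      then have "card S = Suc (card (S - {w}))" using finS by (metis card.remove)
      moreover have "insert w (S - {w}) = S" using wS by auto
      ultimately have "w \<in> bad (S - {w})" "S - {w} \<in> \<S>"
        using S w False by (auto simp: bad_def \<S>_def)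
      then show ?thesis by blast
    qed simp
  qed
  have "card {w \<in> {..<n}. w \<in> T \<or> \<not> light F x k (insert w T)} \<le> card (T \<union> (\<Union>S\<in>\<S>. bad S))"
    using finT fin\<S> sub by (intro card_mono) (auto simp: bad_def)
  also have "\<dots> \<le> card T + card (\<Union>S\<in>\<S>. bad S)" by (rule card_Un_le)
  also have "card (\<Union>S\<in>\<S>. bad S) \<le> (\<Sum>S\<in>\<S>. card (bad S))" by (rule card_UN_le[OF fin\<S>])
  finally have "real (card {w \<in> {..<n}. w \<in> T \<or> \<not> light F x k (insert w T)})
      \<le> card T + (\<Sum>S\<in>\<S>. real (card (bad S)))"
    by (simp flip: of_nat_sum of_nat_add)
  also have "(\<Sum>S\<in>\<S>. real (card (bad S))) \<le> (\<Sum>S\<in>\<S>. k * x)"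
    by (intro sum_mono bad)
  also have "\<dots> = card \<S> * (k * x)" by simp
  also have "\<dots> \<le> 2 ^ card T * (k * x)"
  proof (intro mult_right_mono)
    have "card \<S> \<le> card (Pow T)" using finT by (intro card_mono) (auto simp: \<S>_def)
    then have "card \<S> \<le> 2 ^ card T" using finT by (simp add: card_Pow)
    then show "real (card \<S>) \<le> 2 ^ card T" by (metis of_nat_le_iff of_nat_numeral of_nat_power)
  qed (use x in auto)
  finally show ?thesis by simp
qed

lemma light_mono:
  assumes "light F x k T" "finite F" "G \<subseteq> F"
  shows "light G x k T"
  unfolding light_def
proof (intro allI impI)
  fix S assume S: "S \<subseteq> T" "card S \<le> k"
  have "card {Q \<in> G. S \<subseteq> Q} \<le> card {Q \<in> F. S \<subseteq> Q}"
    using assms by (intro card_mono) auto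
  moreover have "real (card {Q \<in> F. S \<subseteq> Q}) < x ^ (k - card S)"
    using assms(1) S by (simp add: light_def)
  ultimately show "real (card {Q \<in> G. S \<subseteq> Q}) < x ^ (k - card S)" by linarith
qed

subsection \<open>Ramsey numbers\<close>

lemma four_power_le_fact: "4 \<le> k \<Longrightarrow> 4 * 2 ^ k \<le> (fact k :: nat)\<^sup>2"
proof (induction k rule: dec_induct)
  case base
  then show ?case by (simp add: fact_numeral)
next
  case (step k)
  have "4 * 2 ^ Suc k \<le> 2 * (fact k :: nat)\<^sup>2" using step by simp
  also have "\<dots> \<le> (Suc k)\<^sup>2 * (fact k :: nat)\<^sup>2"
    using step by (intro mult_right_mono) (auto simp: power2_eq_square)
  finally show ?case by (simp add: power_mult_distrib del: mult_Suc)
qed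

text \<open>The union bound of Erdos in counting form: every 2-coloring, given by one color class
  \<open>S\<close>, has a monochromatic \<open>k\<close>-set, so \<open>2 ^ c\<close> is at most
  twice the number of \<open>k\<close>-sets. Squaring avoids half-integral exponents.\<close>

lemma ramsey_lower:
  fixes k r :: nat
  assumes k: "4 \<le> k" and r: "partn_lst {..<r} [k, k] 2"
  shows "2 ^ k \<le> r\<^sup>2"
proof -
  define P where "P = [{..<r}]\<^bsup>2\<^esup>"
  define c where "c = k choose 2"
  have finP: "finite P" by (simp add: P_def finite_imp_finite_nsets)
  have finK: "finite ([{..<r}]\<^bsup>k\<^esup>)" by (simp add: finite_imp_finite_nsets)
  define U where "U = (\<lambda>H. {S. [H]\<^bsup>2\<^esup> \<subseteq> S \<and> S \<subseteq> P} \<union> Pow (P - [H]\<^bsup>2\<^esup>))"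
  have UH: "card (U H) \<le> 2 * 2 ^ (card P - c)" and cH: "c \<le> card P" if H: "H \<in> [{..<r}]\<^bsup>k\<^esup>" for H
  proof -
    have sub: "[H]\<^bsup>2\<^esup> \<subseteq> P" unfolding P_def using H by (intro nsets_mono) (auto simp: nsets_def)
    have cH: "card ([H]\<^bsup>2\<^esup>) = c" unfolding card_nsets c_def using H by (simp add: nsets_def)
    have finH: "finite ([H]\<^bsup>2\<^esup>)" using sub finP by (rule finite_subset)
    have cd: "card (P - [H]\<^bsup>2\<^esup>) = card P - c" using sub finH cH by (simp add: card_Diff_subset)
    have "card {S. [H]\<^bsup>2\<^esup> \<subseteq> S \<and> S \<subseteq> P} = card (Pow (P - [H]\<^bsup>2\<^esup>))"
      by (intro bij_betw_same_card[of "\<lambda>S. S - [H]\<^bsup>2\<^esup>"] bij_betwI[of _ _ _ "\<lambda>S. S \<union> [H]\<^bsup>2\<^esup>"])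
        (use sub in auto)
    then show "card (U H) \<le> 2 * 2 ^ (card P - c)"
      unfolding U_def using card_Un_le[of "{S. [H]\<^bsup>2\<^esup> \<subseteq> S \<and> S \<subseteq> P}" "Pow (P - [H]\<^bsup>2\<^esup>)"] finP cd
      by (simp add: card_Pow)
    show "c \<le> card P" using card_mono[OF finP sub] cH by simp
  qed
  have mono: "\<exists>H\<in>[{..<r}]\<^bsup>k\<^esup>. S \<in> U H" if S: "S \<subseteq> P" for S
  proof -
    define f where "f = (\<lambda>e. if e \<in> S then 0 else 1 :: nat)"
    have "f \<in> [{..<r}]\<^bsup>2\<^esup> \<rightarrow> {..<length [k, k]}" by (auto simp: f_def)
    then obtain i where i: "i < length [k, k]" "monochromatic {..<r} ([k, k] ! i) 2 f i"
      using r unfolding partn_lst_def by blast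
    then have "[k, k] ! i = k" by (auto simp: less_Suc_eq)
    then obtain H where H: "H \<in> [{..<r}]\<^bsup>k\<^esup>" "f ` [H]\<^bsup>2\<^esup> \<subseteq> {i}"
      using i(2) by (auto simp: monochromatic_def)
    have "S \<in> U H"
    proof (cases "i = 0")
      case True
      then have "[H]\<^bsup>2\<^esup> \<subseteq> S" using H(2) by (auto simp: f_def split: if_splits)
      then show ?thesis using S by (simp add: U_def)
    next
      case False
      then have "[H]\<^bsup>2\<^esup> \<inter> S = {}" using H(2) by (auto simp: f_def)
      then show ?thesis using S by (auto simp: U_def)
    qed
    then show ?thesis using H(1) by blast
  qed
  have "Pow P \<subseteq> (\<Union>H\<in>[{..<r}]\<^bsup>k\<^esup>. U H)" using mono by auto
  moreover have "finite (\<Union>H\<in>[{..<r}]\<^bsup>k\<^esup>. U H)"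
    using finK finP by (auto simp: U_def intro: finite_subset[of _ "Pow P"])
  ultimately have "card (Pow P) \<le> card (\<Union>H\<in>[{..<r}]\<^bsup>k\<^esup>. U H)" by (intro card_mono)
  also have "\<dots> \<le> (\<Sum>H\<in>[{..<r}]\<^bsup>k\<^esup>. card (U H))" by (rule card_UN_le[OF finK])
  also have "\<dots> \<le> (\<Sum>H\<in>[{..<r}]\<^bsup>k\<^esup>. 2 * 2 ^ (card P - c))" by (intro sum_mono UH)
  finally have le: "2 ^ card P \<le> (r choose k) * (2 * 2 ^ (card P - c))" using finP by (simp add: card_Pow)
  obtain H where "H \<in> [{..<r}]\<^bsup>k\<^esup>" using mono[of "{}"] by auto
  then have "c \<le> card P" by (rule cH)
  then have "(2::nat) ^ card P = 2 ^ c * 2 ^ (card P - c)" by (simp flip: power_add)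
  then have "2 ^ c * 2 ^ (card P - c) \<le> 2 * (r choose k) * 2 ^ (card P - c)" using le by (simp add: mult_ac)
  then have c: "2 ^ c \<le> 2 * (r choose k)" by simp
  have "2 ^ c * fact k \<le> 2 * (r choose k) * fact k" using c by (rule mult_right_mono) simp
  also have "\<dots> \<le> 2 * r ^ k" using binomial_fact_pow[of r k] by (simp add: mult.assoc)
  finally have "(2 ^ c * fact k)\<^sup>2 \<le> (2 * r ^ k)\<^sup>2" by (intro power_mono) auto
  moreover have "((2::nat) ^ c)\<^sup>2 = 2 ^ (k * (k - 1))"
  proof -
    have "even (k * (k - 1))" by (cases k) auto
    then have "2 * c = k * (k - 1)" unfolding c_def choose_two by (rule dvd_mult_div_cancel)
    then show ?thesis by (metis mult.commute power_mult)
  qed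
  ultimately have "2 ^ (k * (k - 1)) * (fact k)\<^sup>2 \<le> 4 * (r\<^sup>2) ^ k"
    by (simp add: power_mult_distrib) (simp flip: power_mult add: mult.commute)
  \<comment> \<open>The squared factorial supplies a factor \<open>2 ^ k\<close>, which completes
    the exponent to \<open>k * k\<close>, and a factor 4 that cancels the one on the right.\<close>
  moreover have "2 ^ (k * (k - 1)) * (4 * 2 ^ k) \<le> 2 ^ (k * (k - 1)) * (fact k :: nat)\<^sup>2"
    using four_power_le_fact[OF k] by (rule mult_left_mono) simp
  ultimately have "4 * (2 ^ (k * (k - 1)) * 2 ^ k) \<le> 4 * (r\<^sup>2) ^ k" by linarith
  moreover have "2 ^ (k * (k - 1)) * 2 ^ k = ((2::nat) ^ k) ^ k"
    using k by (cases k) (auto simp flip: power_add power_mult simp: algebra_simps)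
  ultimately have "((2::nat) ^ k) ^ k \<le> (r\<^sup>2) ^ k" by simp
  then show ?thesis using k by (simp add: power_mono_iff)
qed

text \<open>The constant coloring 0 has no pair of color 1, so for \<open>2 \<le> h\<close> the
  partition property must produce a \<open>k\<close>-set of color 0.\<close>

lemma ramsey_number_ge:
  assumes k: "2 \<le> h"
  shows "k \<le> ramsey_number k h"
proof -
  define s where "s = ramsey_number k h"
  have "partn_lst {..<s} [k, h] 2" unfolding s_def by (rule partn_lst_ramsey_number)
  then have "\<exists>i<2. monochromatic {..<s} ([k, h] ! i) 2 (\<lambda>e. 0 :: nat) i"
    unfolding partn_lst_def by (auto simp: numeral_2_eq_2)
  then obtain i H where iH: "i < 2" "H \<in> [{..<s}]\<^bsup>([k, h] ! i)\<^esup>" "(\<lambda>e. 0 :: nat) ` [H]\<^bsup>2\<^esup> \<subseteq> {i}"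
    unfolding monochromatic_def by blast
  show ?thesis
  proof (cases "i = 0")
    case True
    then have "card H = k" "H \<subseteq> {..<s}" using iH by (auto simp: nsets_def)
    then show ?thesis using card_mono[of "{..<s}" H] by (simp add: s_def)
  next
    case False
    then have "finite H" "card H = h" "[H]\<^bsup>2\<^esup> = {}" using iH by (auto simp: nsets_def less_2_cases_iff)
    then show ?thesis using k by (simp add: nsets_eq_empty_iff)
  qed
qed

lemma polite_constantsI:
  assumes k: "4 \<le> k" and pol: "polite k"
  obtains h s p R m z where "polite_constants k h (ramsey_number k k) s p R m z"
proof -
  define h where "h = nat \<lceil>real k / 2\<rceil>"
  define r where "r = ramsey_number k k"
  define s where "s = ramsey_number k h"
  define p where "p = ramsey_number k (k - 1)"
  define z where "z = root 4 (real s / real r)"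
  define m where "m = r - 1"
  obtain R :: nat where R: "partn_lst {..<R} [k, k, k] 2" using ramsey_full[of "[k, k, k]" 2] by blast
  have h: "k \<le> 2 * h" "2 \<le> h" unfolding h_def using k by linarith+
  have s_le: "real s \<le> real r / 2 ^ 31" and p_ge: "(real r - 1) / real p \<ge> 1 + 25 * z"
    using pol by (simp_all add: polite_def r_def s_def p_def z_def h_def)
  have ks: "k \<le> s" unfolding s_def by (rule ramsey_number_ge[OF h(2)])
  \<comment> \<open>\<open>s\<close> is at least \<open>k\<close>, so the first politeness
    inequality alone makes \<open>r\<close> huge.\<close>
  have r_large: "4 * 2 ^ 31 \<le> real r"
  proof -
    have "4 \<le> real s" using ks k by simp
    then show ?thesis using s_le by simp
  qed
  have r_eq: "r = Suc m" "100 \<le> m" using r_large by (auto simp: m_def)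
  have z4: "z ^ 4 = s / r" unfolding z_def by (rule real_root_pow_pos2) auto
  have sr: "0 < real s / r" "real s / r \<le> 1 / 2 ^ 31"
    using ks k r_large s_le by (auto simp: field_simps)
  have z0: "0 < z" unfolding z_def using sr by simp
  have z1: "z \<le> 1 / 128"
  proof (rule power_le_imp_le_base)
    show "z ^ Suc 3 \<le> (1 / 128) ^ Suc 3" using sr z4 by (simp add: eval_nat_numeral)
  qed simp
  have pm: "p * (1 + 25 * z) \<le> m"
  proof (cases "p = 0")
    case False
    then show ?thesis using p_ge r_eq by (simp add: field_simps)
  qed simp
  \<comment> \<open>The eighth power removes the root: \<open>z ^ 8\<close> is at least
    \<open>1 / r ^ 2\<close>, hence \<open>(z * m) ^ 8\<close> is at least
    \<open>r ^ 6 / 256\<close> and so at least \<open>2 ^ (3 * k) / 256\<close>. As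
    \<open>8 * (9 / 10) ^ 8\<close> exceeds 1, \<open>y\<close> would be at least 1/2.\<close>
  have zk: "2 \<le> 10 * z * m * (9 / 10) ^ (k - 1)"
  proof (rule ccontr)
    define y where "y = z * m * (9 / 10) ^ k"
    assume "\<not> ?thesis"
    then have small: "10 * z * m * (9 / 10) ^ (k - 1) < 2" by simp
    have "10 * y \<le> 10 * z * m * (9 / 10) ^ (k - 1)"
    proof -
      have "(9 / 10 :: real) ^ k \<le> (9 / 10) ^ (k - 1)" by (intro power_decreasing) auto
      then have "10 * z * m * (9 / 10) ^ k \<le> 10 * z * m * (9 / 10) ^ (k - 1)"
        using z0 by (intro mult_left_mono) auto
      then show ?thesis by (simp add: y_def)
    qed
    then have "y < 1 / 5" using small by simp
    moreover have "0 \<le> y" using z0 by (simp add: y_def)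
    ultimately have y8: "y ^ 8 < (1 / 5) ^ 8" by (intro power_strict_mono) auto
    have "1 / r \<le> z ^ 4" unfolding z4 using ks k by (intro divide_right_mono) auto
    then have "(1 / real r) ^ 2 \<le> (z ^ 4) ^ 2" by (intro power_mono) auto
    then have z8: "1 / real r ^ 2 \<le> z ^ 8" by (simp add: power_divide flip: power_mult)
    have "real r / 2 \<le> m" using r_eq by simp
    then have "(real r / 2) ^ 8 \<le> real m ^ 8" by (intro power_mono) auto
    with z8 have A: "1 / real r ^ 2 * (real r / 2) ^ 8 \<le> z ^ 8 * real m ^ 8"
      by (intro mult_mono) auto
    have B: "1 / real r ^ 2 * (real r / 2) ^ 8 = (real r ^ 2) ^ 3 / 256"
      using r_eq by (simp add: power_divide field_simps flip: power_mult power_add)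
    have C: "((2::real) ^ k) ^ 3 \<le> (real r ^ 2) ^ 3"
    proof (rule power_mono)
      have "2 ^ k \<le> r\<^sup>2"
        using k partn_lst_ramsey_number unfolding r_def by (rule ramsey_lower)
      then show "(2::real) ^ k \<le> real r ^ 2" by (metis of_nat_le_iff of_nat_numeral of_nat_power)
    qed simp
    have "((2::real) ^ k) ^ 3 / 256 \<le> z ^ 8 * real m ^ 8"
      by (rule order_trans[OF divide_right_mono[OF C] A[unfolded B]]) simp
    then have "((2::real) ^ k) ^ 3 / 256 * ((9 / 10) ^ k) ^ 8 \<le> z ^ 8 * real m ^ 8 * ((9 / 10) ^ k) ^ 8"
      by (intro mult_right_mono) auto
    also have "\<dots> = y ^ 8" by (simp add: y_def power_mult_distrib)
    also have "((2::real) ^ k) ^ 3 / 256 * ((9 / 10) ^ k) ^ 8 = (2 ^ 3 * (9 / 10) ^ 8) ^ k / 256"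
    proof -
      have "((2::real) ^ k) ^ 3 = (2 ^ 3) ^ k" "(((9 / 10 :: real)) ^ k) ^ 8 = ((9 / 10) ^ 8) ^ k"
        by (metis mult.commute power_mult)+
      then show ?thesis by (simp only: power_mult_distrib times_divide_eq_left)
    qed
    finally have "(2 ^ 3 * (9 / 10) ^ 8) ^ k / 256 \<le> y ^ 8" .
    moreover have "1 \<le> (2 ^ 3 * (9 / 10 :: real) ^ 8) ^ k" by (intro one_le_power) (simp add: eval_nat_numeral)
    ultimately have "1 / 256 \<le> y ^ 8" by simp
    then show False using y8 by (simp add: eval_nat_numeral)
  qed
  have "polite_constants k h r s p R m z"
  proof unfold_locales
    show "partn_lst {..<r} [k, k] 2" "partn_lst {..<s} [k, h] 2" "partn_lst {..<p} [k, k - 1] 2"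
      unfolding r_def s_def p_def by (rule partn_lst_ramsey_number)+
    show "real s = z ^ 4 * r" unfolding z4 using r_eq by simp
  qed (use R h k r_eq z0 z1 ks pm zk in auto)
  then show thesis using that by (simp add: r_def)
qed

text \<open>Each of \<open>X\<close> rich cliques carries \<open>(x1 * \<mu>) ^ q\<close>
  embeddings, out of at most \<open>C * (x2 * \<mu>) ^ (j + q)\<close>. The factor
  \<open>\<theta> ^ q\<close> absorbs \<open>C\<close> and leaves \<open>w ^ k\<close>, at most
  \<open>w ^ j\<close>; the outcome is what lightness demands of a set of \<open>k - j\<close>
  vertices.\<close>

lemma few_rich_arith:
  fixes X C x1 x2 \<mu> \<theta> w :: real
  assumes X: "X * (x1 * \<mu>) ^ q \<le> C * (x2 * \<mu>) ^ (j + q)" and x: "x2 \<le> \<theta> * x1" "0 < x1" "0 \<le> x2" "x2 \<le> 2"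
    and pos: "0 < \<mu>" "0 \<le> C" and \<theta>: "0 \<le> \<theta>" "C * \<theta> ^ q < w ^ k" and w: "0 < w" "w \<le> 1" and j: "j \<le> k"
  shows "X < (2 * w * \<mu>) ^ j"
proof -
  have "X * (x1 * \<mu>) ^ q \<le> C * ((x2 * \<mu>) ^ j * (x2 * \<mu>) ^ q)"
    using X by (simp add: power_add)
  also have "\<dots> \<le> C * ((2 * \<mu>) ^ j * (\<theta> * x1 * \<mu>) ^ q)"
    using x pos by (intro mult_left_mono mult_mono power_mono mult_right_mono) auto
  also have "\<dots> = (C * \<theta> ^ q * (2 * \<mu>) ^ j) * (x1 * \<mu>) ^ q"
    by (simp add: power_mult_distrib)
  finally have le: "X * (x1 * \<mu>) ^ q \<le> (C * \<theta> ^ q * (2 * \<mu>) ^ j) * (x1 * \<mu>) ^ q" .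
  have "0 < (x1 * \<mu>) ^ q" using x pos by simp
  then have "X \<le> C * \<theta> ^ q * (2 * \<mu>) ^ j"
    using le by (rule mult_right_le_imp_le[rotated])
  also have "\<dots> < w ^ k * (2 * \<mu>) ^ j"
    using \<theta> pos by (intro mult_strict_right_mono) auto
  also have "\<dots> \<le> w ^ j * (2 * \<mu>) ^ j"
    using w j pos by (intro mult_right_mono power_decreasing) auto
  also have "\<dots> = (2 * w * \<mu>) ^ j" by (simp add: power_mult_distrib)
  finally show ?thesis .
qed

section \<open>Choice of the constants\<close>

context polite_constants
begin

text \<open>\<open>lB\<close> bounds the size of all sets that are chosen greedily, \<open>dlt\<close> is the tolerance for degrees and for
  the number of excluded vertices, \<open>err\<close> the resulting relative error of the degrees in the special
  color, \<open>kap\<close> the threshold for light sets; \<open>thet < 1\<close> bounds the ratio of the degrees in a blowup to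
  those in a rich clique, and \<open>thet ^ q\<close> makes rich cliques rare.\<close>

definition lB :: nat where "lB = R + 2 * s + r + p + k + 2"
definition dlt :: real where "dlt = 1 / (5000 * k * m * real r ^ 4)"
definition err :: real where "err = 32 * k * m * dlt"
definition kap :: real where "kap = dlt / (2 ^ (lB + 1) * k)"
text \<open>Makes \<open>2 * wgt * \<mu>\<close> equal to the threshold \<open>kap * n\<close>, in
  the shape required by \<open>few_rich_arith\<close>.\<close>

definition wgt :: real where "wgt = kap * m / 2"
definition thet :: real where "thet = (1 + dlt / 4) / (1 + dlt / 2)"

lemma constants_pos: "0 < dlt" "0 < err" "0 < kap" "0 < wgt" "0 < thet"
proof -
  show "0 < dlt" unfolding dlt_def using k2 m1 r_eq by simp
  then show "0 < err" "0 < kap" unfolding err_def kap_def using k2 m1 by simp_all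
  then show "0 < wgt" unfolding wgt_def using m1 by simp
  show "0 < thet" unfolding thet_def using \<open>0 < dlt\<close> by simp
qed

lemma dlt_eq: "k * m * dlt * (5000 * real r ^ 4) = 1"
proof -
  have "real k \<noteq> 0" "real m \<noteq> 0" "real r \<noteq> 0" using k2 m1 r_eq by auto
  then show ?thesis by (simp add: dlt_def)
qed

lemma dlt_le: "k * m * dlt \<le> 1 / 5000" "dlt * m \<le> 1 / 5000" "dlt \<le> 1 / 5000"
proof -
  have "k * m * dlt * 5000 * 1 \<le> k * m * dlt * 5000 * real r ^ 4"
    using constants_pos r_eq by (intro mult_left_mono) auto
  then show 1: "k * m * dlt \<le> 1 / 5000" using dlt_eq by simp
  have "1 * (m * dlt) \<le> k * (m * dlt)" using k2 constants_pos by (intro mult_right_mono) auto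
  then show 2: "dlt * m \<le> 1 / 5000" using 1 by (simp add: mult_ac)
  have "dlt * 1 \<le> dlt * m" using m1 constants_pos by (intro mult_left_mono) auto
  then show "dlt \<le> 1 / 5000" using 2 by simp
qed

text \<open>The constant 5000 in \<open>dlt\<close> is chosen for the second claim: 128 times 32 is
  4096, and the other factors cancel.\<close>

lemma err: "dlt * m \<le> err" "128 * real r ^ 4 * err \<le> 1" "4 * m * dlt \<le> err"
proof -
  have "4 * (m * dlt) \<le> 32 * k * (m * dlt)" using k2 constants_pos by (intro mult_right_mono) auto
  then show "4 * m * dlt \<le> err" by (simp add: err_def mult_ac)
  moreover have "0 \<le> m * dlt" using constants_pos by simp
  ultimately show "dlt * m \<le> err" by (simp add: mult_ac)
  show "128 * real r ^ 4 * err \<le> 1" using dlt_eq unfolding err_def by (simp add: mult_ac)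
qed

lemma wgt_le: "wgt \<le> 1"
proof -
  have "1 \<le> (2::real) ^ (lB + 1)" by (rule one_le_power) simp
  then have "1 * 1 \<le> 2 ^ (lB + 1) * real k" using k2 by (intro mult_mono) auto
  then have "kap \<le> dlt / 1" unfolding kap_def using constants_pos k2 by (intro divide_left_mono) auto
  then have "kap * m \<le> dlt * m" by (intro mult_right_mono) auto
  then show ?thesis using dlt_le by (simp add: wgt_def)
qed

lemma thet: "thet < 1" "9 / 10 \<le> thet"
  unfolding thet_def using constants_pos dlt_le by (simp_all add: field_simps)

end

section \<open>A minimal coloring for large \<open>t\<close> and \<open>n\<close>\<close>

locale bonbon_setup = polite_constants k h r s p R m z + clique_pendants k V K E par
  for k h r s p R m :: nat and z :: real and V K :: "'a set" and E :: "'a set set" and par :: "'a \<Rightarrow> 'a" +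
  fixes n :: nat and f :: "nat set \<Rightarrow> nat" and \<mu> :: real
  assumes k3: "3 \<le> k" and q0: "0 < card (V - K)" and ram: "ramsey_number k k = r"
    and t_large: "3 * m * (card V)\<^sup>2 * thet ^ card (V - K) < wgt ^ k"
    and \<mu>: "\<mu> * m = n"
    and n_large: "100 \<le> \<mu>" "4 / dlt \<le> \<mu>" "4 * card V * real m ^ k / dlt \<le> \<mu>" "real m ^ card V \<le> \<mu>"
      "2 * lB / dlt \<le> \<mu>" "card V + 1 \<le> \<mu>"
    and min: "minimizer n f"
begin

text \<open>Sizes relative to \<open>\<mu>\<close>: \<open>x1\<close> is what a rich clique still
  offers a pendant vertex after \<open>t\<close> values are avoided, \<open>x2\<close> bounds the
  class sizes of a blowup including rounding, and \<open>thet\<close> is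
  \<open>x2 / x1\<close>.\<close>

definition x1 :: real where "x1 = 1 + dlt / 2"
definition x2 :: real where "x2 = 1 + dlt / 4"

lemma \<mu>_pos: "0 < \<mu>" using n_large by simp

lemma m_pos: "0 < m" using m1 by simp

lemma n_pos: "0 < n" "\<mu> \<le> n"
proof -
  have "\<mu> * 1 \<le> \<mu> * m" using m1 \<mu>_pos by (intro mult_left_mono) auto
  then show "\<mu> \<le> n" using \<mu> by simp
  then show "0 < n" using \<mu>_pos by simp
qed

lemma n_large':
  "1 \<le> dlt / 4 * \<mu>" "t * m ^ k \<le> dlt / 4 * n" "lB \<le> dlt / 2 * n"
proof -
  show "1 \<le> dlt / 4 * \<mu>" using n_large(2) constants_pos by (simp add: field_simps)
  have "real t * m ^ k \<le> dlt / 4 * \<mu>" using n_large(3) constants_pos by (simp add: field_simps)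
  also have "\<dots> \<le> dlt / 4 * n" using n_pos constants_pos by (intro mult_left_mono) auto
  finally show "t * m ^ k \<le> dlt / 4 * n" by simp
  have "lB \<le> dlt / 2 * \<mu>" using n_large(5) constants_pos by (simp add: field_simps)
  also have "\<dots> \<le> dlt / 2 * n" using n_pos constants_pos by (intro mult_left_mono) auto
  finally show "lB \<le> dlt / 2 * n" .
qed

lemma xs: "x1 \<le> (1 - dlt / 4) * (1 + dlt)" "x2 \<le> thet * x1" "0 < x1" "0 \<le> x2" "x2 \<le> 2" "1 \<le> x2"
proof -
  have "dlt * dlt \<le> dlt * 1" using constants_pos dlt_le by (intro mult_left_mono) auto
  moreover have "(1 - dlt / 4) * (1 + dlt) = 1 + 3 / 4 * dlt - dlt * dlt / 4" by (simp add: field_simps)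
  ultimately show "x1 \<le> (1 - dlt / 4) * (1 + dlt)" unfolding x1_def by linarith
qed (use constants_pos dlt_le in \<open>auto simp: x1_def x2_def thet_def\<close>)

lemma colors: "u < n \<Longrightarrow> v < n \<Longrightarrow> u \<noteq> v \<Longrightarrow> f {u, v} < 3"
  using min by (auto simp: minimizer_def colorings3_def Pi_iff)

lemma card_embs_le: "real (card (embs n f)) \<le> m * (x2 * \<mu>) ^ t"
proof -
  have nr: "\<not> partn_lst {..<m} [k, k] 2"
    using ram r_eq not_less_Least[of m "\<lambda>r. partn_lst {..<r} [k, k] 2"] by (simp add: ramsey_number_def)
  obtain g where g: "g \<in> colorings3 n"
      "card (embs n g) \<le> (\<Sum>i<m. ffall t (card (rescls n m i)))"
    using blowup[OF m_pos nr] by blast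
  have "card (embs n f) \<le> card (embs n g)" using min g by (simp add: minimizer_def)
  then have "real (card (embs n f)) \<le> real (\<Sum>i<m. ffall t (card (rescls n m i)))"
    using g(2) by linarith
  also have "\<dots> = (\<Sum>i<m. real (ffall t (card (rescls n m i))))" by simp
  also have "\<dots> \<le> (\<Sum>i<m. (x2 * \<mu>) ^ t)"
  proof (intro sum_mono)
    fix i assume "i \<in> {..<m}"
    then have "card (rescls n m i) \<le> n div m + 1"
      using card_residue_class[of i m n] by simp
    moreover have "real (n div m) \<le> \<mu>"
      using m_pos \<mu> by (metis of_nat_div_le_of_nat nonzero_mult_div_cancel_right of_nat_0_less_iff less_irrefl)
    ultimately have "real (card (rescls n m i)) \<le> \<mu> + 1" by linarith
    also have "\<dots> \<le> x2 * \<mu>" using n_large'(1) by (simp add: x2_def algebra_simps)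
    finally have "real (card (rescls n m i)) ^ t \<le> (x2 * \<mu>) ^ t" by (intro power_mono) auto
    moreover have "real (ffall t (card (rescls n m i))) \<le> real (card (rescls n m i) ^ t)"
      by (intro of_nat_mono ffall_le)
    ultimately show "real (ffall t (card (rescls n m i))) \<le> (x2 * \<mu>) ^ t"
      unfolding of_nat_power by linarith
  qed
  also have "\<dots> = m * (x2 * \<mu>) ^ t" by simp
  finally show ?thesis .
qed

text \<open>The error \<open>t * t * n ^ (t - 2)\<close> of cloning is harmless, because
  \<open>n ^ (t - 2)\<close> is at most \<open>\<mu> ^ (t - 1)\<close> once \<open>\<mu>\<close>
  exceeds \<open>m ^ t\<close>.\<close>

lemma card_vertex_le:
  assumes v: "v < n"
  shows "real (card {\<phi> \<in> embs n f. v \<in> \<phi> ` V}) \<le> 3 * m * t\<^sup>2 * (x2 * \<mu>) ^ (t - 1)"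
proof -
  define y where "y = (x2 * \<mu>) ^ (t - 1)"
  have y0: "0 \<le> y" using xs \<mu>_pos by (simp add: y_def)
  have "real n * card {\<phi> \<in> embs n f. v \<in> \<phi> ` V}
      \<le> real t * card (embs n f) + real n * (real t * real t * real n ^ (t - 2))"
    using minimizer_vertex[OF min v] by (simp flip: of_nat_mult of_nat_add of_nat_power)
  also have "\<dots> \<le> t * (m * (x2 * \<mu>) ^ t) + n * (real t * real t * y)"
  proof (intro add_mono mult_left_mono card_embs_le)
    have "real n ^ (t - 2) = real m ^ (t - 2) * \<mu> ^ (t - 2)"
      unfolding \<mu>[symmetric] by (simp add: power_mult_distrib mult.commute)
    also have "\<dots> \<le> \<mu> * \<mu> ^ (t - 2)"
    proof (intro mult_right_mono)
      have "real m ^ (t - 2) \<le> real m ^ t" using m1 by (intro power_increasing) auto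
      then show "real m ^ (t - 2) \<le> \<mu>" using n_large(4) by simp
    qed (use \<mu>_pos in auto)
    also have "\<dots> = \<mu> ^ (t - 1)" using t2 by (metis One_nat_def Suc_1 Suc_diff_le power_Suc diff_Suc_Suc)
    also have "\<dots> \<le> y" unfolding y_def using xs \<mu>_pos by (intro power_mono) auto
    finally show "real n ^ (t - 2) \<le> y" .
  qed auto
  also have "(x2 * \<mu>) ^ t = x2 * \<mu> * y" using t2 by (simp add: y_def power_eq_if)
  also have "t * (m * (x2 * \<mu> * y)) = n * (t * x2 * y)"
    unfolding \<mu>[symmetric] by (simp add: mult_ac)
  also have "n * (t * x2 * y) + n * (real t * real t * y) = n * ((t * x2 + real t * t) * y)" by (simp add: algebra_simps)
  finally have "real (card {\<phi> \<in> embs n f. v \<in> \<phi> ` V}) \<le> (t * x2 + real t * t) * y"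
    using n_pos by (subst (asm) mult_le_cancel_left) auto
  also have "\<dots> \<le> 3 * m * t\<^sup>2 * y"
  proof (intro mult_right_mono y0)
    have "real t * 1 \<le> real t * t" using t2 by (intro mult_left_mono) auto
    moreover have "t * x2 \<le> real t * 2" using xs by (intro mult_left_mono) auto
    moreover have "3 * (real t * t) * 1 \<le> 3 * (real t * t) * m" using m1 by (intro mult_left_mono) auto
    ultimately show "t * x2 + real t * t \<le> 3 * m * t\<^sup>2" by (simp add: power2_eq_square mult_ac)
  qed
  finally show ?thesis by (simp add: y_def)
qed

abbreviation F1 :: "nat set set" where "F1 \<equiv> rich n f {..<3} ((1 + dlt) * \<mu>)"

lemma kn: "2 * wgt * \<mu> = kap * n"
  unfolding wgt_def \<mu>[symmetric] by simp

lemma F1_le: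
  "card {Q \<in> F1. S \<subseteq> Q} * (x1 * \<mu>) ^ q \<le> card {\<phi> \<in> embs n f. S \<subseteq> \<phi> ` K}"
proof -
  have "card {Q \<in> F1. S \<subseteq> Q} * (x1 * \<mu>) ^ q
      \<le> card {Q \<in> F1. S \<subseteq> Q} * ((1 - dlt / 4) * ((1 + dlt) * \<mu>)) ^ q"
  proof (intro mult_left_mono power_mono)
    have "x1 * \<mu> \<le> (1 - dlt / 4) * (1 + dlt) * \<mu>"
      using xs(1) \<mu>_pos by (intro mult_right_mono) auto
    then show "x1 * \<mu> \<le> (1 - dlt / 4) * ((1 + dlt) * \<mu>)" by (simp add: mult.assoc)
  qed (use xs \<mu>_pos in auto)
  also have "\<dots> \<le> card {\<phi> \<in> (\<Union>c\<in>{..<3}. emb n f c). S \<subseteq> \<phi> ` K}"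
    using \<mu>_pos \<mu> n_large' constants_pos dlt_le m_pos by (intro card_rich_le) auto
  finally show ?thesis by (simp add: embs_def)
qed

text \<open>Too many rich cliques would yield more embeddings than a blowup has.\<close>

lemma light_F1_empty: "light F1 (kap * n) k {}"
proof -
  have "real (card {Q \<in> F1. {} \<subseteq> Q}) < (2 * wgt * \<mu>) ^ k"
  proof (rule few_rich_arith[where C = "3 * m * t\<^sup>2"])
    have "real (card {\<phi> \<in> embs n f. {} \<subseteq> \<phi> ` K}) \<le> real (card (embs n f))" by simp
    also note card_embs_le
    also have "m * (x2 * \<mu>) ^ t \<le> 3 * m * t\<^sup>2 * (x2 * \<mu>) ^ t"
    proof (intro mult_right_mono)
      have "1 \<le> real t ^ 2" using t2 by simp
      then have "real m * 1 \<le> m * (3 * real t ^ 2)" by (intro mult_left_mono) auto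
      then show "real m \<le> 3 * m * t\<^sup>2" by simp
    qed (use xs \<mu>_pos in auto)
    finally show "real (card {Q \<in> F1. {} \<subseteq> Q}) * (x1 * \<mu>) ^ q \<le> 3 * m * t\<^sup>2 * (x2 * \<mu>) ^ (k + q)"
      using F1_le[of "{}"] t_eq by simp
  qed (use xs \<mu>_pos constants_pos wgt_le t_large in auto)
  then show ?thesis by (simp add: light_def kn)
qed

text \<open>The same comparison at one vertex, with the cloning bound in place of the blowup
  bound.\<close>

lemma light_F1_single:
  assumes v: "v < n"
  shows "light F1 (kap * n) k {v}"
proof -
  have "real (card {Q \<in> F1. {v} \<subseteq> Q}) < (2 * wgt * \<mu>) ^ (k - 1)"
  proof (rule few_rich_arith[where C = "3 * m * t\<^sup>2"])
    have "card {\<phi> \<in> embs n f. {v} \<subseteq> \<phi> ` K} \<le> card {\<phi> \<in> embs n f. v \<in> \<phi> ` V}"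
      using KV by (intro card_mono) auto
    then have "real (card {Q \<in> F1. {v} \<subseteq> Q}) * (x1 * \<mu>) ^ q \<le> 3 * m * t\<^sup>2 * (x2 * \<mu>) ^ (t - 1)"
      using F1_le[of "{v}"] card_vertex_le[OF v] by linarith
    moreover have "k - 1 + q = t - 1" using t_eq k2 by simp
    ultimately show "real (card {Q \<in> F1. {v} \<subseteq> Q}) * (x1 * \<mu>) ^ q \<le> 3 * m * t\<^sup>2 * (x2 * \<mu>) ^ (k - 1 + q)"
      by simp
  qed (use xs \<mu>_pos constants_pos wgt_le t_large in auto)
  then show ?thesis
    using light_F1_empty by (auto simp: light_def kn subset_singleton_iff)
qed

lemma light_family_of_rich:
  assumes F: "finite F" "\<And>Q. Q \<in> F \<Longrightarrow> Q \<subseteq> {..<n} \<and> card Q = k"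
  shows "light_family n f (light F (kap * n) k) lB dlt"
proof
  fix T assume T: "light F (kap * n) k T" "T \<subseteq> {..<n}" "card T \<le> lB"
  have "real (card {w \<in> {..<n}. w \<in> T \<or> \<not> light F (kap * n) k (insert w T)})
      \<le> card T + 2 ^ card T * (k * (kap * n))"
    using constants_pos n_pos T by (intro light_extend_heavy F) auto
  also have "\<dots> \<le> lB + 2 ^ lB * (k * (kap * n))"
    using T(3) constants_pos by (intro add_mono mult_right_mono power_increasing) auto
  \<comment> \<open>This determines \<open>kap\<close>; the other half of \<open>dlt * n\<close>
    covers the at most \<open>lB\<close> old vertices.\<close>
  also have "2 ^ lB * (k * (kap * n)) = dlt / 2 * n"
    using k2 by (simp add: kap_def)
  finally show "real (card {w \<in> {..<n}. w \<in> T \<or> \<not> light F (kap * n) k (insert w T)}) \<le> dlt * n"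
    using n_large'(3) by simp
qed (rule colors)

lemma not_light_F1:
  assumes "light F1 (kap * n) k T" "T \<subseteq> {..<n}" "Q \<subseteq> T" "card Q = k" "c < 3" "mono_clique f c Q"
  shows "(\<Prod>v\<in>Q. real (cdeg f n c v)) < ((1 + dlt) * \<mu>) ^ k"
proof (rule ccontr)
  assume "\<not> ?thesis"
  then have "Q \<in> F1" using assms by (auto simp: rich_def not_less)
  then show False using assms by (intro not_light_superset[OF assms(1)]) auto
qed

text \<open>By minimality few embeddings have \<open>{u, v}\<close> in the core: recoloring it
  creates at most about \<open>(11 / 10 * \<mu>) ^ (t - 2)\<close> per position. A clique in
  \<open>F2\<close> offers almost \<open>2 * \<mu>\<close> per pendant vertex, a much larger base.
  Smaller subsets inherit lightness from \<open>F1\<close>.\<close>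

lemma light_pair_rich:
  assumes uv: "u < n" "v < n" "u \<noteq> v" "f {u, v} \<noteq> c" and c: "c < 3"
    and deg: "\<And>w. w < n \<Longrightarrow> cdeg f n c w \<le> (1 + err) * \<mu>"
  defines "F2 \<equiv> rich n f ({..<3} - {c}) (2 * \<mu>)"
  shows "light F2 (kap * n) k {u, v}"
proof -
  have F21: "F2 \<subseteq> F1"
  proof
    fix Q assume "Q \<in> F2"
    then obtain d where d: "d < 3" "Q \<subseteq> {..<n}" "card Q = k" "mono_clique f d Q"
        "(2 * \<mu>) ^ k \<le> (\<Prod>v\<in>Q. real (cdeg f n d v))"
      by (auto simp: F2_def rich_def)
    have "((1 + dlt) * \<mu>) ^ k \<le> (2 * \<mu>) ^ k"
      using dlt_le constants_pos \<mu>_pos by (intro power_mono mult_right_mono) auto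
    then show "Q \<in> F1" using d by (auto simp: rich_def intro: order_trans)
  qed
  define D where "D = nat \<lfloor>(1 + err) * \<mu>\<rfloor>"
  have D: "cdeg f n c w \<le> D" if "w < n" for w
    using deg[OF that] unfolding D_def by linarith
  have err1: "err \<le> 1 / 128"
  proof -
    have "1 * err \<le> real r ^ 4 * err" using constants_pos r_eq by (intro mult_right_mono) auto
    then show ?thesis using err(2) by simp
  qed
  have D1: "real (D + 1) \<le> 11 / 10 * \<mu>"
  proof -
    have "err * \<mu> \<le> 1 / 128 * \<mu>" using err1 \<mu>_pos by (intro mult_right_mono) auto
    moreover have "0 \<le> (1 + err) * \<mu>" using constants_pos \<mu>_pos by simp
    then have "real D \<le> (1 + err) * \<mu>" unfolding D_def by linarith
    ultimately show ?thesis using n_large(1) unfolding distrib_right of_nat_add by linarith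
  qed
  define d where "d = f {u, v}"
  \<comment> \<open>A monochromatic core containing the pair can only have the color
    \<open>d\<close> of the pair.\<close>
  have "card {\<phi> \<in> (\<Union>c\<in>{..<3} - {c}. emb n f c). {u, v} \<subseteq> \<phi> ` K} \<le> card {\<phi> \<in> emb n f d. {u, v} \<subseteq> \<phi> ` K}"
  proof (intro card_mono subsetI)
    fix \<phi> assume "\<phi> \<in> {\<phi> \<in> (\<Union>c\<in>{..<3} - {c}. emb n f c). {u, v} \<subseteq> \<phi> ` K}"
    then obtain d' where d': "\<phi> \<in> emb n f d'" "{u, v} \<subseteq> \<phi> ` K" by auto
    then have "d = d'" using emb_mono_clique[OF d'(1)] uv by (auto simp: mono_clique_def d_def)
    then show "\<phi> \<in> {\<phi> \<in> emb n f d. {u, v} \<subseteq> \<phi> ` K}" using d' by simp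
  qed simp
  also have "\<dots> \<le> t * t * (D + 1) ^ (t - 2)"
    using uv c k3 D by (intro minimizer_pair[OF min]) (auto simp: d_def)
  finally have "real (card {\<phi> \<in> (\<Union>c\<in>{..<3} - {c}. emb n f c). {u, v} \<subseteq> \<phi> ` K})
      \<le> real (t * t * (D + 1) ^ (t - 2))" by (rule of_nat_mono)
  also have "\<dots> = t\<^sup>2 * real (D + 1) ^ (t - 2)" by (simp add: power2_eq_square)
  also have "\<dots> \<le> 3 * m * t\<^sup>2 * (11 / 10 * \<mu>) ^ (t - 2)"
  proof (intro mult_mono power_mono D1)
    have "real t ^ 2 * 1 \<le> real t ^ 2 * (3 * m)" using m1 by (intro mult_left_mono) auto
    then show "real (t\<^sup>2) \<le> 3 * m * t\<^sup>2" by (simp add: mult_ac)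
  qed auto
  finally have pair: "real (card {\<phi> \<in> (\<Union>c\<in>{..<3} - {c}. emb n f c). {u, v} \<subseteq> \<phi> ` K})
      \<le> 3 * m * t\<^sup>2 * (11 / 10 * \<mu>) ^ (t - 2)" .
  have "card {Q \<in> F2. {u, v} \<subseteq> Q} * ((1 - dlt / 4) * (2 * \<mu>)) ^ q
      \<le> card {\<phi> \<in> (\<Union>c\<in>{..<3} - {c}. emb n f c). {u, v} \<subseteq> \<phi> ` K}"
    unfolding F2_def
    using \<mu>_pos \<mu> n_large' constants_pos dlt_le m_pos by (intro card_rich_le) auto
  moreover have eq: "k - 2 + q = t - 2" using t_eq k2 by simp
  ultimately have le: "card {Q \<in> F2. {u, v} \<subseteq> Q} * ((1 - dlt / 4) * 2 * \<mu>) ^ q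
      \<le> 3 * m * t\<^sup>2 * (11 / 10 * \<mu>) ^ (k - 2 + q)"
    using pair unfolding eq mult.assoc[of _ 2 \<mu>] by linarith
  have "real (card {Q \<in> F2. {u, v} \<subseteq> Q}) < (2 * wgt * \<mu>) ^ (k - 2)"
  proof (rule few_rich_arith[OF le, where k = k])
    have "9 / 10 * (19 / 10) \<le> thet * ((1 - dlt / 4) * 2)"
      using thet dlt_le by (intro mult_mono) auto
    then show "11 / 10 \<le> thet * ((1 - dlt / 4) * 2)" by simp
  qed (use dlt_le \<mu>_pos constants_pos wgt_le t_large in auto)
  then have 2: "real (card {Q \<in> F2. {u, v} \<subseteq> Q}) < (kap * n) ^ (k - 2)" by (simp add: kn)
  have 1: "light F2 (kap * n) k {u}" "light F2 (kap * n) k {v}"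
    using light_mono[OF light_F1_single finite_rich F21] uv by auto
  show ?thesis
    unfolding light_def
  proof (intro allI impI)
    fix S assume S: "S \<subseteq> {u, v}" "card S \<le> k"
    then consider "S \<subseteq> {u}" | "S \<subseteq> {v}" | "S = {u, v}" by blast
    then show "real (card {Q \<in> F2. S \<subseteq> Q}) < (kap * n) ^ (k - card S)"
    proof cases
      case 3
      moreover have "card {u, v} = 2" using uv by simp
      ultimately show ?thesis using 2 by simp
    qed (use 1 S in \<open>auto simp: light_def\<close>)
  qed
qed

theorem minimizer_blowup_like: "ramsey_blowup_like k n f"
proof -
  have F1: "finite F1" "\<And>Q. Q \<in> F1 \<Longrightarrow> Q \<subseteq> {..<n} \<and> card Q = k" by (auto simp: rich_def[of n f _ "(1 + dlt) * \<mu>"])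
  interpret L1: light_family n f "light F1 (kap * n) k" lB dlt
    by (rule light_family_of_rich[OF F1])
  interpret S1: ramsey_light n f "light F1 (kap * n) k" lB dlt k h r s p R m z \<mu>
  proof unfold_locales
    show "R + 1 \<le> lB" "2 * s \<le> lB" "r + 1 \<le> lB" "p + 1 \<le> lB" "k \<le> lB" by (auto simp: lB_def)
    show "light F1 (kap * n) k {}" by (rule light_F1_empty)
    show "light F1 (kap * n) k {v}" if "v < n" for v using that by (rule light_F1_single)
    show "k * m * dlt \<le> 1 / 1000" using dlt_le by simp
  qed (use \<mu> n_large constants_pos not_light_F1 in auto)
  obtain a b c where abc: "{a, b, c} = {..<3::nat}" "a \<noteq> b" "b \<noteq> c" "a \<noteq> c"
    and high: "\<And>v. v < n \<Longrightarrow> 2 * \<mu> \<le> cdeg f n a v" "\<And>v. v < n \<Longrightarrow> 2 * \<mu> \<le> cdeg f n b v"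
    and low: "\<And>v. v < n \<Longrightarrow> (1 - 4 * m * dlt) * \<mu> \<le> cdeg f n c v"
      "\<And>v. v < n \<Longrightarrow> cdeg f n c v \<le> (1 + 32 * k * m * dlt) * \<mu>"
    using S1.special_color_degrees by metis
  have c3: "c < 3" using abc by auto
  have high': "2 * \<mu> \<le> cdeg f n d v" if "v < n" "d < 3" "d \<noteq> c" for v d
  proof -
    have "d \<in> {a, b, c}" using that abc by simp
    then show ?thesis using that high by auto
  qed
  have low': "cdeg f n c v \<le> (1 + err) * \<mu>" if "v < n" for v
    using low(2)[OF that] by (simp add: err_def)
  \<comment> \<open>All degrees in the other two colors are at least \<open>2 * \<mu>\<close>, so
    every \<open>k\<close>-clique of such a color belongs to \<open>F2\<close>, and light sets
    contain none.\<close>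
  define F2 where "F2 = rich n f ({..<3} - {c}) (2 * \<mu>)"
  have F2: "finite F2" "\<And>Q. Q \<in> F2 \<Longrightarrow> Q \<subseteq> {..<n} \<and> card Q = k" by (auto simp: F2_def rich_def[of n f _ "2 * \<mu>"])
  interpret L2: light_family n f "light F2 (kap * n) k" lB dlt
    by (rule light_family_of_rich[OF F2])
  interpret S2: light_pairs n f "light F2 (kap * n) k" lB dlt k r m a b c \<mu> err
  proof unfold_locales
    show "light F2 (kap * n) k {u, v}" if "u < n" "v < n" "u \<noteq> v" "f {u, v} \<noteq> c" for u v
      unfolding F2_def using that c3 low' by (rule light_pair_rich)
    show "\<not> mono_clique f d Q"
      if "light F2 (kap * n) k T" "T \<subseteq> {..<n}" "Q \<subseteq> T" "card Q = k" "d < 3" "d \<noteq> c" for T Q d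
    proof
      assume "mono_clique f d Q"
      moreover have "(\<Prod>v\<in>Q. 2 * \<mu>) \<le> (\<Prod>v\<in>Q. real (cdeg f n d v))"
        using that \<mu>_pos by (intro prod_mono conjI high') auto
      ultimately have "Q \<in> F2" using that by (auto simp: F2_def rich_def)
      then show False using that F2 by (intro not_light_superset[OF that(1)]) auto
    qed
    show "(1 - err) * \<mu> \<le> cdeg f n c v" if "v < n" for v
    proof -
      have "(1 - err) * \<mu> \<le> (1 - 4 * m * dlt) * \<mu>"
        using err \<mu>_pos by (intro mult_right_mono) auto
      then show ?thesis using low(1)[OF that] by linarith
    qed
    show "r \<le> lB" by (simp add: lB_def)
  qed (use abc partn_r r_eq m1 \<mu> n_large err constants_pos low' in auto)
  obtain A where A: "disjoint_family_on A {..<m}" "(\<Union>i<m. A i) = {..<n}"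
      "\<And>i. i < m \<Longrightarrow> mono_clique f c (A i)"
    using S2.clique_partition by metis
  show ?thesis
  proof (rule ramsey_blowup_like_of_partition[OF min c3 m_pos _ A])
    show "ramsey_number k k = Suc m" using ram r_eq by simp
    show "t < cdeg f n d v" if "v < n" "d < 3" "d \<noteq> c" for v d
      using high'[OF that] n_large(6) by linarith
    have "real t * m \<le> \<mu> * m" using n_large(6) by (intro mult_right_mono) auto
    then have "t * m \<le> n" using \<mu> by (metis of_nat_le_iff of_nat_mult)
    then show "t \<le> n div m" using m_pos by (simp add: less_eq_div_iff_mult_less_eq)
  qed (use q0 in auto)
qed

end

subsection \<open>The graph \<open>H\<close> and the main theorem\<close>

context clique_pendants
begin

lemma edge_pendant: "x \<in> V - K \<Longrightarrow> {x, y} \<in> E \<Longrightarrow> x \<noteq> y \<Longrightarrow> y = par x \<or> (y \<in> V - K \<and> x = par y)"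
  by (auto simp: E_eq doubleton_eq_iff)

lemma connected: "connected_graph V E"
proof -
  define rel where "rel = {(x, y). {x, y} \<in> E}"
  have symr: "sym rel" by (auto simp: sym_def rel_def insert_commute)
  have "K \<noteq> {}" using cardK k2 by auto
  then obtain z where z: "z \<in> K" by blast
  have K: "(x, z) \<in> rel\<^sup>*" if "x \<in> K" for x
  proof (cases "x = z")
    case False
    then have "(x, z) \<in> rel" using that z by (auto simp: rel_def E_eq)
    then show ?thesis by blast
  qed simp
  have to_z: "(x, z) \<in> rel\<^sup>*" if "x \<in> V" for x
  proof (cases "x \<in> K")
    case False
    then have "(x, par x) \<in> rel" "par x \<in> K" using that par by (auto simp: rel_def E_eq)
    then show ?thesis using K by (meson converse_rtrancl_into_rtrancl)
  qed (rule K)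
  have "(x, y) \<in> rel\<^sup>*" if "x \<in> V" "y \<in> V" for x y
    using to_z[OF that(1)] to_z[OF that(2)] symr by (meson rtrancl_trans sym_rtrancl symD)
  moreover have "E \<subseteq> [V]\<^bsup>2\<^esup>"
    using E_subset E_card by (auto simp: nsets_def card_ge_0_finite)
  ultimately show ?thesis
    using finV KV z by (auto simp: connected_graph_def simple_graph_def rel_def)
qed

text \<open>A clique through a pendant vertex has at most 2 elements, and
  \<open>2 \<le> k\<close>.\<close>

lemma clique_number_eq: "clique_number V E = k"
  unfolding clique_number_def
proof (rule Max_eqI)
  have "finite {L. L \<subseteq> V \<and> clique L E}" using finV by simp
  then show "finite (card ` {L. L \<subseteq> V \<and> clique L E})" by simp
  have "clique K E" by (auto simp: clique_def E_eq)
  then show "k \<in> card ` {L. L \<subseteq> V \<and> clique L E}" using KV cardK by auto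
  fix x assume "x \<in> card ` {L. L \<subseteq> V \<and> clique L E}"
  then obtain L where L: "L \<subseteq> V" "clique L E" "x = card L" by auto
  show "x \<le> k"
  proof (cases "L \<subseteq> K")
    case True
    then show ?thesis using L cardK finK card_mono by auto
  next
    case False
    then obtain l where l: "l \<in> L" "l \<in> V - K" using L by auto
    have "y = l \<or> y = par l" if "y \<in> L" for y
    proof (rule ccontr)
      assume neg: "\<not> ?thesis"
      then have "{l, y} \<in> E" using L(2) l that by (auto simp: clique_def)
      then have "l = par y" "y \<in> V - K" using edge_pendant[OF l(2)] neg by auto
      then show False using par l by auto
    qed
    then have "card L \<le> card {l, par l}" by (intro card_mono) auto
    also have "\<dots> \<le> 2" by (simp add: card_insert_if)
    finally show ?thesis using L k2 by simp
  qed
qed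

end

lemma clique_pendantsI:
  assumes "clique_plus_pendants k V E" "2 \<le> k"
  obtains K par where "clique_pendants k V K E par"
proof -
  have simple: "finite V" "E \<subseteq> [V]\<^bsup>2\<^esup>" using assms(1) by (auto simp: clique_plus_pendants_def simple_graph_def)
  obtain K where K: "K \<subseteq> V" "card K = k" "clique K E" "\<forall>v\<in>V - K. \<exists>u\<in>K. {w. {v, w} \<in> E} = {u}"
    using assms(1) by (auto simp: clique_plus_pendants_def)
  obtain par where par: "\<And>v. v \<in> V - K \<Longrightarrow> par v \<in> K \<and> {w. {v, w} \<in> E} = {par v}"
    using K(4) by metis
  have edge: "{v, w} \<in> E \<longleftrightarrow> w = par v" if "v \<in> V - K" for v w
    using par[OF that] by blast
  have "E = [K]\<^bsup>2\<^esup> \<union> (\<lambda>p. {p, par p}) ` (V - K)"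
  proof (intro equalityI subsetI)
    fix e assume e: "e \<in> E"
    then obtain x y where xy: "e = {x, y}" "x \<in> V" "y \<in> V" "x \<noteq> y"
      using simple(2) by (metis nsets2_E subsetD)
    show "e \<in> [K]\<^bsup>2\<^esup> \<union> (\<lambda>p. {p, par p}) ` (V - K)"
    proof (cases "x \<in> K \<and> y \<in> K")
      case True
      then show ?thesis using xy by simp
    next
      case False
      then consider "x \<in> V - K" | "y \<in> V - K" using xy by auto
      then show ?thesis
      proof cases
        case 1
        then show ?thesis using edge[OF 1, of y] e xy by auto
      next
        case 2
        then show ?thesis using edge[OF 2, of x] e xy by (auto simp: insert_commute)
      qed
    qed
  next
    fix e assume "e \<in> [K]\<^bsup>2\<^esup> \<union> (\<lambda>p. {p, par p}) ` (V - K)"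
    then show "e \<in> E"
      using K(3) edge by (auto simp: clique_def elim!: nsets2_E)
  qed
  then have "clique_pendants k V K E par"
    using simple K par assms(2) by unfold_locales auto
  then show thesis by (rule that)
qed

theorem theorem1p6:
  shows "\<exists>k\<^sub>0::nat. \<forall>k\<ge>k\<^sub>0. polite k \<longrightarrow>
    (\<exists>t\<^sub>0::nat. \<forall>t\<ge>t\<^sub>0. \<forall>(V :: 'a set) E.
       card V = t \<and> clique_plus_pendants k V E \<longrightarrow> bonbon3 V E)"
proof (rule exI[of _ 4], intro allI impI)
  \<comment> \<open>4 is the bound that \<open>ramsey_lower\<close> asks for.\<close>
  fix k assume k: "4 \<le> k" and pol: "polite k"
  obtain h s p R m z where pc: "polite_constants k h (ramsey_number k k) s p R m z"
    using polite_constantsI[OF k pol] by blast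
  define r where "r = ramsey_number k k"
  interpret polite_constants k h r s p R m z using pc by (simp add: r_def)
  \<comment> \<open>The square of this null sequence is \<open>t ^ 2 * thet ^ t\<close>, so a limit
    with a single factor \<open>t\<close> suffices.\<close>
  have "(\<lambda>t. real t * sqrt thet ^ t) \<longlonglongrightarrow> 0"
    using thet by (intro powser_times_n_limit_0) auto
  then have "(\<lambda>t. 3 * m / thet ^ k * (real t * sqrt thet ^ t)\<^sup>2) \<longlonglongrightarrow> 3 * m / thet ^ k * 0\<^sup>2"
    by (intro tendsto_intros)
  then have "eventually (\<lambda>t. 3 * m / thet ^ k * (real t * sqrt thet ^ t)\<^sup>2 < wgt ^ k) sequentially"
    by (rule order_tendstoD) (use constants_pos in auto)
  then obtain t1 where t1: "\<And>t. t1 \<le> t \<Longrightarrow> 3 * m / thet ^ k * (real t * sqrt thet ^ t)\<^sup>2 < wgt ^ k"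
    by (auto simp: eventually_sequentially)
  have t_large: "3 * m * t\<^sup>2 * thet ^ (t - k) < wgt ^ k" if "t1 \<le> t" "k \<le> t" for t
  proof -
    have "(real t * sqrt thet ^ t)\<^sup>2 = t\<^sup>2 * ((sqrt thet)\<^sup>2) ^ t"
      by (simp add: power_mult_distrib) (simp flip: power_mult add: mult.commute)
    also have "\<dots> = t\<^sup>2 * (thet ^ (t - k) * thet ^ k)"
      using constants_pos that by (simp flip: power_add)
    finally show ?thesis using t1[OF that(1)] constants_pos by simp
  qed
  show "\<exists>t\<^sub>0::nat. \<forall>t\<ge>t\<^sub>0. \<forall>(V :: 'a set) E. card V = t \<and> clique_plus_pendants k V E \<longrightarrow> bonbon3 V E"
  \<comment> \<open>\<open>t\<close> exceeds \<open>k\<close>, so there is at least one pendant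
    vertex, as \<open>q0\<close> requires.\<close>
  proof (rule exI[of _ "t1 + k + 1"], intro allI impI, elim conjE)
    fix t and V :: "'a set" and E
    assume t: "t1 + k + 1 \<le> t" "card V = t" and cp: "clique_plus_pendants k V E"
    obtain K par where "clique_pendants k V K E par" using clique_pendantsI[OF cp] k by auto
    then interpret clique_pendants k V K E par .
    have q: "card (V - K) = card V - k" using t_eq by simp
    \<comment> \<open>The sum of all lower bounds that \<open>n_large\<close> demands of
      \<open>\<mu>\<close>.\<close>
    define N where "N = 100 + 4 / dlt + 4 * card V * real m ^ k / dlt + real m ^ card V + 2 * lB / dlt + card V + 1"
    have "ramsey_blowup_like k n f" if n: "nat \<lceil>N * m\<rceil> \<le> n" and f: "minimizes_mono_copies V E n f" for n f
    proof -
      define \<mu> where "\<mu> = real n / m"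
      have m0: "0 < real m" using m1 by simp
      have "N * m \<le> n" using n by linarith
      then have N\<mu>: "N \<le> \<mu>" using m0 by (simp add: \<mu>_def field_simps)
      obtain a where a: "0 < a" "\<And>n f. card (embs n f) = a * card (mono_copies V E n f)"
        using card_embs by blast
      have "minimizer n f"
        using f a by (simp add: minimizer_def minimizes_mono_copies_def)
      moreover have "0 \<le> 4 / dlt" "0 \<le> 4 * card V * real m ^ k / dlt" "0 \<le> real m ^ card V" "0 \<le> 2 * lB / dlt"
        using constants_pos by auto
      then have "100 \<le> \<mu>" "4 / dlt \<le> \<mu>" "4 * card V * real m ^ k / dlt \<le> \<mu>" "real m ^ card V \<le> \<mu>"
        "2 * lB / dlt \<le> \<mu>" "card V + 1 \<le> \<mu>"
        using N\<mu> unfolding N_def by linarith+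
      moreover have "3 * m * (card V)\<^sup>2 * thet ^ card (V - K) < wgt ^ k"
        unfolding q using t by (intro t_large) auto
      ultimately interpret bonbon_setup k h r s p R m z V K E par n f \<mu>
        using k t q m0 by unfold_locales (auto simp: r_def \<mu>_def)
      show ?thesis by (rule minimizer_blowup_like)
    qed
    then show "bonbon3 V E"
      unfolding bonbon3_def clique_number_eq using connected by blast
  qed
qed

end
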